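(* Let $G_1, G_2$ be countable subgroups of $\mathrm{Homeo}_+(S^1)$ such that neither the action of $G_1$ on $S^1$ nor the action of $G_2$ on $S^1$ admits an invariant probability measure, and let $\mu_1,\mu_2$ be nondegenerate probability measures on $G_1, G_2$ respectively. Then for $\mathbb{P}_1\otimes\mathbb{P}_2$-almost every $(\omega,\omega')\in\Omega_1\times\Omega_2$, the set of $n\in\mathbb{N}$ such that $f^n_\omega, f^n_{\omega'}$ are a ping-pong pair has density $1$, that is, \[ \lim_{N\to\infty}\frac{1}{N}\left|\{0\leq n\leq N \mid f^n_\omega, f^n_{\omega'} \text{ are a ping-pong pair}\}\right| = 1. \]
   Context: $\mathrm{Homeo}_+(S^1)$ is the group of orientation-preserving homeomorphisms of $S^1$. A probability measure $\mu$ on a group $G$ is nondegenerate if the semigroup generated by its support is $G$. $(\Omega_i,\mathbb{P}_i)=(G_i^{\mathbb{N}},\mu_i^{\otimes\mathbb{N}})$; for $\omega=(f_{\omega_k})_{k\in\mathbb{N}}\in\Omega_1$, $f^n_\omega=f_{\omega_n}\circ f_{\omega_{n-1}}\circ\cdots\circ f_{\omega_0}$, and similarly for $\omega'\in\Omega_2$. Two homeomorphisms $f,g$ of $S^1$ are a ping-pong pair if there exist pairwise disjoint open subsets $U_1,U_2,V_1,V_2\subseteq S^1$ with $f(S^1\setminus U_1)\subseteq V_1$ and $g(S^1\setminus U_2)\subseteq V_2$. *)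

theory Defs
  imports "HOL-Probability.Probability"
begin

definition S1 :: "complex set" where
  "S1 = sphere 0 1"

text \<open>Orientation-preserving homeomorphisms of S^1: homeomorphisms of S^1 admitting a
  lift to a continuous strictly increasing map F of the real line with F(x+1) = F(x)+1.
  To make composition and inversion a genuine group structure on functions, elements are
  normalised to be the identity off the circle.\<close>
definition Homeo_plus :: "(complex \<Rightarrow> complex) set" where
  "Homeo_plus = {f. (\<exists>g. homeomorphism S1 S1 f g)
      \<and> (\<exists>F::real \<Rightarrow> real. continuous_on UNIV F \<and> strict_mono F
            \<and> (\<forall>x. F (x + 1) = F x + 1)
            \<and> (\<forall>x. f (cis (2 * pi * x)) = cis (2 * pi * F x)))
      \<and> (\<forall>z. z \<notin> S1 \<longrightarrow> f z = z)}"

definition subgroup_Homeo_plus :: "(complex \<Rightarrow> complex) set \<Rightarrow> bool" where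
  "subgroup_Homeo_plus G \<longleftrightarrow> G \<subseteq> Homeo_plus \<and> id \<in> G
     \<and> (\<forall>f\<in>G. \<forall>g\<in>G. f \<circ> g \<in> G) \<and> (\<forall>f\<in>G. inv f \<in> G)"

definition has_invariant_prob :: "(complex \<Rightarrow> complex) set \<Rightarrow> bool" where
  "has_invariant_prob G \<longleftrightarrow> (\<exists>\<nu>. prob_space \<nu> \<and> sets \<nu> = sets (restrict_space borel S1)
      \<and> (\<forall>f\<in>G. \<forall>A\<in>sets \<nu>. emeasure \<nu> (f -` A \<inter> S1) = emeasure \<nu> A))"

inductive_set gen_semigroup :: "('a \<Rightarrow> 'a) set \<Rightarrow> ('a \<Rightarrow> 'a) set" for S where
  base: "s \<in> S \<Longrightarrow> s \<in> gen_semigroup S"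
| comp: "a \<in> gen_semigroup S \<Longrightarrow> b \<in> gen_semigroup S \<Longrightarrow> a \<circ> b \<in> gen_semigroup S"

text \<open>A probability measure on the countable group G (necessarily discrete, hence a pmf)
  is nondegenerate if the semigroup generated by its support is G.\<close>
definition nondegenerate :: "(complex \<Rightarrow> complex) set \<Rightarrow> (complex \<Rightarrow> complex) pmf \<Rightarrow> bool" where
  "nondegenerate G \<mu> \<longleftrightarrow> set_pmf \<mu> \<subseteq> G \<and> gen_semigroup (set_pmf \<mu>) = G"

primrec rwalk :: "(nat \<Rightarrow> ('a \<Rightarrow> 'a)) \<Rightarrow> nat \<Rightarrow> 'a \<Rightarrow> 'a" where
  "rwalk \<omega> 0 = \<omega> 0"
| "rwalk \<omega> (Suc n) = \<omega> (Suc n) \<circ> rwalk \<omega> n"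

definition ping_pong_pair :: "(complex \<Rightarrow> complex) \<Rightarrow> (complex \<Rightarrow> complex) \<Rightarrow> bool" where
  "ping_pong_pair f g \<longleftrightarrow> (\<exists>U1 U2 V1 V2.
      openin (top_of_set S1) U1 \<and> openin (top_of_set S1) U2 \<and>
      openin (top_of_set S1) V1 \<and> openin (top_of_set S1) V2 \<and>
      U1 \<inter> U2 = {} \<and> U1 \<inter> V1 = {} \<and> U1 \<inter> V2 = {} \<and>
      U2 \<inter> V1 = {} \<and> U2 \<inter> V2 = {} \<and> V1 \<inter> V2 = {} \<and>
      f ` (S1 - U1) \<subseteq> V1 \<and> g ` (S1 - U2) \<subseteq> V2)"

definition path_space :: "(complex \<Rightarrow> complex) pmf \<Rightarrow> (nat \<Rightarrow> (complex \<Rightarrow> complex)) measure" where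
  "path_space \<mu> = PiM UNIV (\<lambda>_. measure_pmf \<mu>)"

end

theory Submission
  imports Defs
begin

text \<open>
  All maps are lifted to the line. The core is a concentration estimate: unless there is an invariant
  probability measure, the law of the random walk after \<open>n\<close> steps gives uniformly small mass to all short
  arcs, whatever the starting point.

  Consequently there is a continuous monotone function \<open>H\<close> (the distribution function of a measure that is
  stationary for the inverse walk) for which the heights \<open>H (W y) - H (W x)\<close> of the images of an arc form a
  bounded martingale. Their increments tend to zero, so every accumulation point of the images is an arc
  whose height is preserved by the whole group. Such a height defines a translation which commutes with
  the group, and these translations form a discrete set since otherwise \<open>H\<close> itself would be invariant.
  Hence the height of an arc either tends to zero or is eventually bounded below, and a fine grid contains a
  bounded number of arcs of the second kind, the repelling ones. An arc whose height tends to zero is short at most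
  times: otherwise its end point would often be close to one of finitely many points, contradicting
  concentration through a Chernoff bound.

  For two independent walks the repelling arcs are apart for arbitrarily fine grids, and concentration keeps
  the attracted points away from the repelling arcs and from each other, except for a set of times of
  small density.
\<close>

section \<open>Limits along a universal filter\<close>

text \<open>Until the return to the circle, a probability measure on it is represented by a monotone
  function of degree one on the line, weak convergence by pointwise convergence along one fixed
  filter, and an atom by a jump. Three obstacles shape the argument. The action need not be minimal,
  so \<open>H\<close> may be constant on intervals, and an arc of small height may be long; hence
  the detour through concentration. It need not be proximal: the collapsed action may commute with a
  nontrivial translation, so there can be several repelling arcs. Only their number is controlled,
  by \<open>2 / gap\<close>, but for all grids at once. This uniformity is essential, because the
  grid is chosen last: the number of arcs fixes the admissible density, the density fixes the radius
  given by concentration, and the mesh must be finer than that radius. Finally, attracted points of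
  the two walks have to be compared with each other. Concentration is therefore proved for arbitrary
  moving targets, with a radius independent of the target, so that one walk can serve as the target
  of the other.\<close>

lemma universal_filter_exists:
  "\<exists>U::nat filter. U \<noteq> bot \<and> U \<le> sequentially
     \<and> (\<forall>u::nat \<Rightarrow> real. (\<exists>B. \<forall>n. \<bar>u n\<bar> \<le> B) \<longrightarrow> (\<exists>l. (u \<longlongrightarrow> l) U))"
proof -
  define b :: "(nat \<Rightarrow> real) \<Rightarrow> real" where "b u = (SOME B. \<forall>n. \<bar>u n\<bar> \<le> B)" for u
  define bd where "bd u \<longleftrightarrow> (\<exists>B. \<forall>n. \<bar>u n\<bar> \<le> B)" for u :: "nat \<Rightarrow> real"
  have b: "\<bar>u n\<bar> \<le> b u" if "bd u" for u n
    using someI_ex[of "\<lambda>B. \<forall>n. \<bar>u n\<bar> \<le> B"] that unfolding bd_def b_def by blast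
  \<comment> \<open>One coordinate for each bounded sequence: by Tychonoff the points
    \<open>X n\<close> have a cluster point, and pulling back its neighbourhoods makes all bounded
    sequences converge at once. Unbounded sequences get the value 0, which keeps \<open>X n\<close>
    inside the compact product.\<close>
  define X :: "nat \<Rightarrow> (nat \<Rightarrow> real) \<Rightarrow> real" where "X n u = (if bd u then u n else 0)" for n u
  let ?S = "PiE UNIV (\<lambda>u. cball 0 (\<bar>b u\<bar>)) :: ((nat \<Rightarrow> real) \<Rightarrow> real) set"
  have "compactin (product_topology (\<lambda>u. euclideanreal) UNIV) ?S"
    by (subst compactin_PiE) auto
  then have S: "compact ?S"
    by (simp add: euclidean_product_topology)
  have "\<bar>X n u\<bar> \<le> \<bar>b u\<bar>" for n u
    using b[of u n] by (auto simp: X_def)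
  then have "X n \<in> ?S" for n
    by auto
  then have "eventually (\<lambda>x. x \<in> ?S) (filtermap X sequentially)"
    by (simp add: eventually_filtermap)
  then obtain x where x: "inf (nhds x) (filtermap X sequentially) \<noteq> bot"
    using S unfolding compact_filter by (metis filtermap_bot_iff sequentially_bot)
  define U where "U = inf sequentially (filtercomap X (nhds x))"
  have Ubot: "U \<noteq> bot"
  proof
    assume "U = bot"
    then have "eventually (\<lambda>_. False) U" by simp
    then obtain P Q where P: "eventually P sequentially" and Q: "eventually Q (filtercomap X (nhds x))"
      and PQ: "\<And>n. P n \<Longrightarrow> Q n \<Longrightarrow> False"
      unfolding U_def eventually_inf by blast
    from Q obtain R where R: "eventually R (nhds x)" "\<And>n. R (X n) \<Longrightarrow> Q n"
      unfolding eventually_filtercomap by blast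
    have "eventually (\<lambda>y. \<not> R y) (filtermap X sequentially)"
      unfolding eventually_filtermap using P by eventually_elim (use PQ R in blast)
    then have "eventually (\<lambda>_. False) (inf (nhds x) (filtermap X sequentially))"
      unfolding eventually_inf using R(1) by blast
    with x show False by (simp add: trivial_limit_def)
  qed
  have lim: "filterlim X (nhds x) U"
    unfolding U_def filterlim_def by (meson filtermap_le_iff_le_filtercomap inf.cobounded2)
  have "(u \<longlongrightarrow> x u) U" if "bd u" for u
  proof -
    have "((\<lambda>n. X n u) \<longlongrightarrow> x u) U"
    proof (rule topological_tendstoI)
      fix T :: "real set" assume T: "open T" "x u \<in> T"
      have "open {y :: (nat \<Rightarrow> real) \<Rightarrow> real. y u \<in> T}"
        using open_vimage[OF T(1) continuous_on_product_coordinates[of u]] by (simp add: vimage_def)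
      then have "eventually (\<lambda>y. y u \<in> T) (nhds x)"
        using eventually_nhds[of "\<lambda>y. y u \<in> T" x] T(2) by (metis (mono_tags, lifting) mem_Collect_eq)
      then show "eventually (\<lambda>n. X n u \<in> T) U"
        using lim filterlim_iff by blast
    qed
    then show ?thesis using that by (simp add: X_def)
  qed
  moreover have "U \<le> sequentially" by (simp add: U_def)
  ultimately show ?thesis using Ubot unfolding bd_def by blast
qed

text \<open>With one filter for all sequences, limits exist at every real point simultaneously and
  are compatible with sums and inequalities, without diagonal subsequences.\<close>

definition ufilter :: "nat filter" where
  "ufilter = (SOME U. U \<noteq> bot \<and> U \<le> sequentially
     \<and> (\<forall>u::nat \<Rightarrow> real. (\<exists>B. \<forall>n. \<bar>u n\<bar> \<le> B) \<longrightarrow> (\<exists>l. (u \<longlongrightarrow> l) U)))"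

definition ulim :: "(nat \<Rightarrow> real) \<Rightarrow> real" where
  "ulim u = Lim ufilter u"

lemma ufilter_props: "ufilter \<noteq> bot \<and> ufilter \<le> sequentially
     \<and> (\<forall>u::nat \<Rightarrow> real. (\<exists>B. \<forall>n. \<bar>u n\<bar> \<le> B) \<longrightarrow> (\<exists>l. (u \<longlongrightarrow> l) ufilter))"
  unfolding ufilter_def by (rule someI_ex[OF universal_filter_exists])

lemma ufilter_neq_bot [simp]: "ufilter \<noteq> bot"
  and ufilter_le_sequentially: "ufilter \<le> sequentially"
  using ufilter_props by auto

lemma ulim_tendsto: "(\<And>n. \<bar>u n\<bar> \<le> B) \<Longrightarrow> (u \<longlongrightarrow> ulim u) ufilter"
  unfolding ulim_def using ufilter_props tendsto_Lim by metis

lemma eventually_ufilter: "eventually P sequentially \<Longrightarrow> eventually P ufilter"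
  using ufilter_le_sequentially filter_leD by blast

lemma tendsto_ufilter: "(u \<longlongrightarrow> l) sequentially \<Longrightarrow> (u \<longlongrightarrow> l) ufilter"
  using ufilter_le_sequentially tendsto_mono by blast

section \<open>Expectations\<close>

lemma pmf_finite_almost_all:
  fixes \<mu> :: "'a pmf"
  assumes "e > 0"
  obtains S where "finite S" "S \<subseteq> set_pmf \<mu>" "measure_pmf.prob \<mu> (- S) < e"
proof -
  define A where "A n = from_nat_into (set_pmf \<mu>) ` {..<n::nat}" for n
  have "(\<lambda>n. measure_pmf.prob \<mu> (A n)) \<longlonglongrightarrow> measure_pmf.prob \<mu> (\<Union>n. A n)"
    by (rule measure_pmf.finite_Lim_measure_incseq) (auto simp: A_def incseq_def)
  moreover have "(\<Union>n. A n) = set_pmf \<mu>"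
    unfolding A_def image_UN[symmetric]
    using range_from_nat_into[OF set_pmf_not_empty countable_set_pmf, of \<mu>] 
    by (metis UN_lessThan_UNIV)
  moreover have "measure_pmf.prob \<mu> (set_pmf \<mu>) = 1"
    by (simp add: measure_pmf.prob_eq_1 AE_measure_pmf)
  ultimately have "(\<lambda>n. measure_pmf.prob \<mu> (A n)) \<longlonglongrightarrow> 1" by simp
  then have "eventually (\<lambda>n. measure_pmf.prob \<mu> (A n) > 1 - e) sequentially"
    using assms by (intro order_tendstoD) auto
  then obtain n where "measure_pmf.prob \<mu> (A n) > 1 - e"
    using eventually_sequentially by auto
  moreover have "measure_pmf.prob \<mu> (- A n) = 1 - measure_pmf.prob \<mu> (A n)"
    by (metis Compl_eq_Diff_UNIV UNIV_I measure_pmf.prob_compl sets_measure_pmf space_measure_pmf)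
  ultimately show ?thesis
    using from_nat_into[OF set_pmf_not_empty, of \<mu>] 
    by (intro that[of "A n"]) (auto simp: A_def)
qed

lemma integrable_pmf_bounded:
  fixes f :: "'a \<Rightarrow> real"
  assumes "\<And>a. \<bar>f a\<bar> \<le> B"
  shows "integrable (measure_pmf \<mu>) f"
  by (rule measure_pmf.integrable_const_bound[of _ B]) (use assms in auto)

text \<open>Bounded convergence for a filter that need not be countably generated, such as
  \<open>ufilter\<close>: all but a small part of the mass sits on a finite set, where convergence
  is uniform.\<close>

lemma pmf_expectation_tendsto:
  fixes g :: "'n \<Rightarrow> 'a \<Rightarrow> real"
  assumes F: "F \<noteq> bot" and lim: "\<And>a. ((\<lambda>n. g n a) \<longlongrightarrow> l a) F"
    and bd: "\<And>n a. \<bar>g n a\<bar> \<le> B"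
  shows "((\<lambda>n. measure_pmf.expectation \<mu> (g n)) \<longlongrightarrow> measure_pmf.expectation \<mu> l) F"
proof (rule tendstoI)
  fix e :: real assume e: "e > 0"
  have lbd: "\<bar>l a\<bar> \<le> B" for a
    by (rule tendsto_upperbound[OF tendsto_rabs[OF lim]]) (use bd F in auto)
  have B: "B \<ge> 0" using lbd[of undefined] by linarith
  \<comment> \<open>Outside \<open>S\<close> the integrands differ by at most \<open>2 * B\<close>,
    so this mass costs less than \<open>e / 2\<close>; the added 1 covers the case
    \<open>B = 0\<close>.\<close>
  obtain S where S: "finite S" "measure_pmf.prob \<mu> (- S) < e / (2 * (2 * B + 1))"
    by (rule pmf_finite_almost_all[of "e / (2 * (2 * B + 1))" \<mu>]) (use e B in simp)
  have "eventually (\<lambda>n. \<forall>a\<in>S. \<bar>g n a - l a\<bar> < e / 2) F"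
    unfolding eventually_ball_finite_distrib[OF S(1)]
    using tendstoD[OF lim, of "e/2"] e by (auto simp: dist_real_def)
  then show "eventually (\<lambda>n. dist (measure_pmf.expectation \<mu> (g n)) (measure_pmf.expectation \<mu> l) < e) F"
  proof eventually_elim
    case (elim n)
    have *: "\<bar>g n a - l a\<bar> \<le> e / 2 + 2 * B * indicator (- S) a" for a
    proof (cases "a \<in> S")
      case True
      then show ?thesis using elim by fastforce
    next
      case False
      then show ?thesis using bd[of n a] lbd[of a] e by simp
    qed
    have **: "\<bar>g n a - l a\<bar> \<le> 2 * B" for a
      using bd[of n a] lbd[of a] by linarith
    have "\<bar>measure_pmf.expectation \<mu> (g n) - measure_pmf.expectation \<mu> l\<bar>
        = \<bar>measure_pmf.expectation \<mu> (\<lambda>a. g n a - l a)\<bar>"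
      by (subst Bochner_Integration.integral_diff) (auto intro!: integrable_pmf_bounded bd lbd)
    also have "\<dots> \<le> measure_pmf.expectation \<mu> (\<lambda>a. e / 2 + 2 * B * indicator (- S) a)"
    proof (rule order_trans[OF integral_abs_bound integral_mono])
      show "integrable (measure_pmf \<mu>) (\<lambda>a. \<bar>g n a - l a\<bar>)"
        by (rule integrable_pmf_bounded[where B="2*B"]) (use ** in auto)
      show "integrable (measure_pmf \<mu>) (\<lambda>a. e / 2 + 2 * B * indicator (- S) a)"
        by (rule integrable_pmf_bounded[where B="e + 2 * B"]) (use e B in \<open>auto simp: indicator_def\<close>)
    qed (use * in auto)
    also have "\<dots> = e / 2 + 2 * B * measure_pmf.prob \<mu> (- S)"
    proof (subst Bochner_Integration.integral_add)
      show "integrable (measure_pmf \<mu>) (\<lambda>a. 2 * B * indicator (- S) a)"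
        by (rule integrable_pmf_bounded[where B="2 * B"]) (use e B in \<open>auto simp: indicator_def\<close>)
    qed auto
    also have "2 * B * measure_pmf.prob \<mu> (- S) \<le> 2 * B * (e / (2 * (2 * B + 1)))"
      using S B by (intro mult_left_mono) auto
    also have "\<dots> < e / 2" using e B by (simp add: field_simps)
    finally show ?case by (simp add: dist_real_def)
  qed
qed

section \<open>Monotone maps of degree one\<close>

text \<open>Such a \<open>K\<close> stands for a probability measure on the circle, with
  \<open>K t - K s\<close> the mass of the arc from \<open>s\<close> to \<open>t\<close>. Values at
  jumps are left free, so that the class is closed under pointwise limits.\<close>

definition circle_fun :: "(real \<Rightarrow> real) \<Rightarrow> bool" where
  "circle_fun K \<longleftrightarrow> mono K \<and> (\<forall>x. K (x + 1) = K x + 1)"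

definition circle_homeo :: "(real \<Rightarrow> real) \<Rightarrow> bool" where
  "circle_homeo F \<longleftrightarrow> continuous_on UNIV F \<and> strict_mono F \<and> (\<forall>x. F (x + 1) = F x + 1)"

lemma circle_homeo_fun: "circle_homeo F \<Longrightarrow> circle_fun F"
  by (simp add: circle_homeo_def circle_fun_def strict_mono_mono)

lemma circle_fun_mono: "circle_fun K \<Longrightarrow> x \<le> y \<Longrightarrow> K x \<le> K y"
  by (simp add: circle_fun_def monoD)

lemma circle_fun_add_int:
  assumes "circle_fun K"
  shows "K (x + of_int k) = K x + of_int k"
proof (induction k rule: int_induct[where k=0])
  case (step1 i)
  then show ?case using assms unfolding circle_fun_def
    by (metis (no_types, opaque_lifting) add.assoc of_int_1 of_int_add)
next
  case (step2 i)
  have "K ((x + of_int (i - 1)) + 1) = K (x + of_int (i - 1)) + 1"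
    using assms unfolding circle_fun_def by blast
  with step2 show ?case by simp
qed simp

lemma circle_fun_diff_bound:
  assumes K: "circle_fun K" and xy: "x \<le> y"
  shows "K y - K x \<le> y - x + 1"
proof -
  have "K y \<le> K (x + of_int \<lceil>y - x\<rceil>)"
    by (rule circle_fun_mono[OF K]) linarith
  also have "\<dots> = K x + of_int \<lceil>y - x\<rceil>" by (rule circle_fun_add_int[OF K])
  finally show ?thesis by linarith
qed

lemma circle_fun_abs_bound:
  assumes K: "circle_fun K"
  shows "\<bar>K y - K x\<bar> \<le> \<bar>y - x\<bar> + 1"
  using circle_fun_diff_bound[OF K, of x y] circle_fun_diff_bound[OF K, of y x]
    circle_fun_mono[OF K, of x y] circle_fun_mono[OF K, of y x]
  by (cases "x \<le> y") auto

lemma circle_fun_compose: "circle_fun K \<Longrightarrow> circle_fun L \<Longrightarrow> circle_fun (K \<circ> L)"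
  by (auto simp: circle_fun_def intro!: monoI dest: monoD)

lemma circle_fun_surj:
  assumes K: "circle_fun K" and c: "continuous_on UNIV K"
  shows "\<exists>x. K x = y"
proof -
  let ?a = "real_of_int \<lfloor>y - K 0\<rfloor>" and ?b = "real_of_int \<lceil>y - K 0\<rceil>"
  have "K ?a \<le> y" "y \<le> K ?b"
    using circle_fun_add_int[OF K, of 0] by (simp_all) linarith+
  moreover have "?a \<le> ?b" by linarith
  ultimately show ?thesis
    using IVT'[of K ?a y ?b] c continuous_on_subset by blast
qed

lemma circle_homeo_strict: "circle_homeo F \<Longrightarrow> F x < F y \<longleftrightarrow> x < y"
  by (simp add: circle_homeo_def strict_mono_less)

lemma circle_homeo_le: "circle_homeo F \<Longrightarrow> F x \<le> F y \<longleftrightarrow> x \<le> y"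
  by (simp add: circle_homeo_def strict_mono_less_eq)

lemma circle_homeo_bij: 
  assumes "circle_homeo F" shows "bij F"
proof -
  have "surj F"
    unfolding surj_def using circle_fun_surj[of F] assms circle_homeo_fun[OF assms]
    by (metis circle_homeo_def)
  then show ?thesis
    using assms by (simp add: bij_def circle_homeo_def strict_mono_imp_inj_on)
qed

lemma circle_homeo_inv_apply [simp]:
  assumes "circle_homeo F"
  shows "F (inv F x) = x" "inv F (F x) = x"
  using circle_homeo_bij[OF assms] by (simp_all add: bij_is_surj surj_f_inv_f bij_is_inj)

lemma circle_homeo_id: "circle_homeo (\<lambda>x. x)"
  by (simp add: circle_homeo_def strict_mono_def)

lemma circle_homeo_compose: "circle_homeo F \<Longrightarrow> circle_homeo G \<Longrightarrow> circle_homeo (F \<circ> G)"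
  using continuous_on_compose[of UNIV G F] continuous_on_subset[of UNIV F "range G"]
  by (auto simp: circle_homeo_def strict_mono_def)

lemma circle_homeo_isCont: "circle_homeo F \<Longrightarrow> isCont F x"
  by (simp add: circle_homeo_def continuous_on_eq_continuous_at)

lemma circle_homeo_inv:
  assumes F: "circle_homeo F"
  shows "circle_homeo (inv F)"
proof -
  have *: "inv F x \<le> inv F y \<longleftrightarrow> x \<le> y" for x y
    using circle_homeo_le[OF F, of "inv F x" "inv F y"] F by simp
  have "surj (inv F)" using circle_homeo_bij[OF F] bij_imp_bij_inv bij_is_surj by blast
  then have "continuous_on UNIV (inv F)"
    by (intro continuous_onI_mono) (auto simp: *)
  moreover have "strict_mono (inv F)"
    using * by (metis linorder_not_le strict_monoI)
  moreover have "inv F (x + 1) = inv F x + 1" for x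
  proof -
    have "F (inv F x + 1) = x + 1" using F by (simp add: circle_homeo_def[of F])
    then show ?thesis using F by (metis circle_homeo_inv_apply(2))
  qed
  ultimately show ?thesis by (simp add: circle_homeo_def)
qed

subsection \<open>Jumps\<close>

text \<open>The mass of the atom at \<open>z\<close>. The infimum over surrounding arcs makes it
  independent of the value of \<open>K\<close> at \<open>z\<close>.\<close>

definition jump :: "(real \<Rightarrow> real) \<Rightarrow> real \<Rightarrow> real" where
  "jump K z = (INF p\<in>{p. fst p < z \<and> z < snd p}. K (snd p) - K (fst p))"

lemma jump_le:
  assumes K: "circle_fun K" and "x < z" "z < y"
  shows "jump K z \<le> K y - K x"
proof -
  have "bdd_below ((\<lambda>p. K (snd p) - K (fst p)) ` {p. fst p < z \<and> z < snd p})"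
    by (rule bdd_belowI[of _ 0]) (use circle_fun_mono[OF K] in force)
  then have "jump K z \<le> K (snd (x, y)) - K (fst (x, y))"
    unfolding jump_def using assms by (intro cINF_lower) auto
  then show ?thesis by simp
qed

lemma jump_greatest:
  assumes "\<And>x y. x < z \<Longrightarrow> z < y \<Longrightarrow> c \<le> K y - K x"
  shows "c \<le> jump K z"
proof -
  have "(z - 1, z + 1) \<in> {p. fst p < z \<and> z < snd p}" by simp
  then show ?thesis unfolding jump_def using assms
    by (intro cINF_greatest) (blast, auto)
qed

lemma jump_nonneg: "circle_fun K \<Longrightarrow> 0 \<le> jump K z"
  by (rule jump_greatest) (simp add: circle_fun_mono)

lemma jump_tendsto:
  assumes K: "circle_fun K" and x: "x \<longlonglongrightarrow> z" "\<And>n. x n < z" and y: "y \<longlonglongrightarrow> z" "\<And>n. z < y n"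
  shows "(\<lambda>n. K (y n) - K (x n)) \<longlonglongrightarrow> jump K z"
proof (rule order_tendstoI)
  fix a assume "a < jump K z"
  then show "eventually (\<lambda>n. a < K (y n) - K (x n)) sequentially"
    using jump_le[OF K x(2) y(2)] by (intro always_eventually allI) (meson less_le_trans)
next
  fix a assume a: "jump K z < a"
  then obtain u v where uv: "u < z" "z < v" "K v - K u < a"
    using jump_greatest[of z a K] by (meson not_le)
  have "eventually (\<lambda>n. u < x n) sequentially" "eventually (\<lambda>n. y n < v) sequentially"
    using uv x(1) y(1) by (auto intro: order_tendstoD)
  then show "eventually (\<lambda>n. K (y n) - K (x n) < a) sequentially"
  proof eventually_elim
    case (elim n)
    then show ?case
      using uv circle_fun_mono[OF K, of u "x n"] circle_fun_mono[OF K, of "y n" v] by linarith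
  qed
qed

lemma sum_jump_le:
  assumes K: "circle_fun K" and "finite Z" "Z \<subseteq> {u<..<v}" "u \<le> v"
  shows "sum (jump K) Z \<le> K v - K u"
  using assms(2-)
proof (induction Z arbitrary: v rule: finite_linorder_max_induct)
  case empty
  then show ?case using circle_fun_mono[OF K] by simp
next
  case (insert b A)
  \<comment> \<open>The point \<open>m\<close> separates the largest atom \<open>b\<close> from the
    others, so the arcs on its two sides carry their masses separately.\<close>
  define m where "m = (if A = {} then (u + b) / 2 else (Max A + b) / 2)"
  have "u < m \<and> m < b \<and> A \<subseteq> {u<..<m}"
  proof (cases "A = {}")
    case True
    then show ?thesis using insert.prems by (simp add: m_def)
  next
    case False
    then have "Max A \<in> A" using insert by simp
    then have "u < Max A" "Max A < b" using insert by auto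
    moreover have "z \<in> {u<..<m}" if "z \<in> A" for z
    proof -
      have "z \<le> Max A" "u < z" using that insert by auto
      then show ?thesis using \<open>Max A < b\<close> False by (simp add: m_def)
    qed
    ultimately show ?thesis using False by (auto simp: m_def)
  qed
  then have m: "u < m" "m < b" "A \<subseteq> {u<..<m}" by auto
  then have "sum (jump K) A \<le> K m - K u" using insert by simp
  moreover have "jump K b \<le> K v - K m" using m insert by (intro jump_le[OF K]) auto
  moreover have "b \<notin> A" using insert by auto
  ultimately show ?case using insert(1) by simp
qed

lemma sum_jump_period_le:
  assumes K: "circle_fun K" and "finite Z" "Z \<subseteq> {0..<1}"
  shows "sum (jump K) Z \<le> 1"
proof -
  \<comment> \<open>Atoms must lie strictly inside the arc, but \<open>Z\<close> may contain 0; the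
    period is therefore moved to the left by \<open>r\<close>.\<close>
  obtain r where r: "0 < r" "r < 1" "\<And>z. z \<in> Z \<Longrightarrow> z < 1 - r"
  proof (cases "Z = {}")
    case True then show ?thesis using that[of "1/2"] by simp
  next
    case False
    then have "Max Z < 1" using assms by (simp add: subset_iff)
    moreover have "0 \<le> Max Z" using False assms by (meson Max_in atLeastLessThan_iff subset_iff)
    moreover have "z < 1 - (1 - Max Z) / 2" if "z \<in> Z" for z
      using Max_ge[OF assms(2) that] \<open>Max Z < 1\<close> by (simp add: field_simps)
    ultimately show ?thesis by (intro that[of "(1 - Max Z) / 2"]) auto
  qed
  have "sum (jump K) Z \<le> K (1 - r) - K (- r)"
    using r assms by (intro sum_jump_le[OF K]) force+
  also have "\<dots> = 1" using K unfolding circle_fun_def by (metis add_diff_cancel_left' diff_conv_add_uminus add.commute)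
  finally show ?thesis .
qed

subsection \<open>Pointwise limits\<close>

definition plim :: "(nat \<Rightarrow> real \<Rightarrow> real) \<Rightarrow> real \<Rightarrow> real" where
  "plim L t = ulim (\<lambda>n. L n t)"

lemma plim_tendsto:
  assumes "\<And>n. circle_fun (L n)" "\<And>n. L n 0 = 0"
  shows "((\<lambda>n. L n t) \<longlongrightarrow> plim L t) ufilter"
  unfolding plim_def
  by (rule ulim_tendsto[of _ "\<bar>t\<bar> + 1"]) (use circle_fun_abs_bound[OF assms(1), of _ t 0] assms(2) in simp)

lemma circle_fun_plim:
  assumes "\<And>n. circle_fun (L n)" "\<And>n. L n 0 = 0"
  shows "circle_fun (plim L)"
  unfolding circle_fun_def
proof (intro conjI monoI allI)
  show "plim L x \<le> plim L y" if "x \<le> y" for x y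
    using that circle_fun_mono[OF assms(1)]
    by (intro tendsto_le[OF _ plim_tendsto plim_tendsto] always_eventually allI assms) auto
  have "((\<lambda>n. L n x + 1) \<longlongrightarrow> plim L (x + 1)) ufilter" for x
    using plim_tendsto[of L "x + 1", OF assms] assms(1) by (simp add: circle_fun_def)
  moreover have "((\<lambda>n. L n x + 1) \<longlongrightarrow> plim L x + 1) ufilter" for x
    by (intro tendsto_intros plim_tendsto assms)
  ultimately show "plim L (x + 1) = plim L x + 1" for x
    using tendsto_unique[OF ufilter_neq_bot] by blast
qed

section \<open>Concentration functions of the transfer operator\<close>

text \<open>Subtracting \<open>L i 0\<close> changes no increment and normalises the average at 0,
  as \<open>plim\<close> requires for bounded values.\<close>

definition cesaro :: "(nat \<Rightarrow> real \<Rightarrow> real) \<Rightarrow> nat \<Rightarrow> real \<Rightarrow> real" where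
  "cesaro L n t = (\<Sum>i\<le>n. L i t - L i 0) / real (Suc n)"

lemma cesaro_zero [simp]: "cesaro L n 0 = 0"
  by (simp add: cesaro_def)

lemma circle_fun_cesaro:
  assumes "\<And>i. circle_fun (L i)"
  shows "circle_fun (cesaro L n)"
  unfolding circle_fun_def cesaro_def
proof (intro conjI monoI allI)
  show "(\<Sum>i\<le>n. L i x - L i 0) / real (Suc n) \<le> (\<Sum>i\<le>n. L i y - L i 0) / real (Suc n)" if "x \<le> y" for x y
    using that circle_fun_mono[OF assms] by (intro divide_right_mono sum_mono) auto
  have eq: "(\<Sum>i\<le>n. L i (x + 1) - L i 0) = (\<Sum>i\<le>n. (L i x - L i 0) + 1)" for x
    by (intro sum.cong) (use assms in \<open>auto simp: circle_fun_def\<close>)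
  show "(\<Sum>i\<le>n. L i (x + 1) - L i 0) / real (Suc n) = (\<Sum>i\<le>n. L i x - L i 0) / real (Suc n) + 1" for x
    unfolding eq sum.distrib by (simp add: add_divide_distrib)
qed

text \<open>The function \<open>\<lfloor>t - z\<rfloor>\<close> of \<open>t\<close> represents the
  point mass at \<open>z\<close>; here \<open>F\<close> carries that mass to \<open>F z\<close>,
  because it preserves order and commutes with integer translations.\<close>

lemma floor_circle_homeo:
  assumes F: "circle_homeo F"
  shows "\<lfloor>F t - F z\<rfloor> = \<lfloor>t - z\<rfloor>"
proof (rule floor_unique)
  have "F (z + of_int \<lfloor>t - z\<rfloor>) \<le> F t"
    using circle_homeo_le[OF F] by (metis add.commute le_diff_eq of_int_floor_le)
  then show "of_int \<lfloor>t - z\<rfloor> \<le> F t - F z"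
    using circle_fun_add_int[OF circle_homeo_fun[OF F]] by simp
  have "F t < F (z + of_int (\<lfloor>t - z\<rfloor> + 1))"
    by (subst circle_homeo_strict[OF F]) linarith
  then show "F t - F z < of_int \<lfloor>t - z\<rfloor> + 1"
    using circle_fun_add_int[OF circle_homeo_fun[OF F], of z "\<lfloor>t - z\<rfloor> + 1"] by simp
qed

lemma jump_add_int:
  assumes K: "circle_fun K"
  shows "jump K (z + of_int k) = jump K z"
proof -
  define d where "d n = 1 / real (Suc n)" for n
  have d: "d \<longlonglongrightarrow> 0" "d n > 0" for n
    unfolding d_def using LIMSEQ_inverse_real_of_nat by (simp_all add: inverse_eq_divide)
  have lim: "(\<lambda>n. K (w + d n) - K (w - d n)) \<longlonglongrightarrow> jump K w" for w
    by (rule jump_tendsto[OF K]) (use tendsto_diff[OF tendsto_const d(1), of w] tendsto_add[OF tendsto_const d(1), of w] d in auto)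
  have "K (z + of_int k + d n) - K (z + of_int k - d n) = K (z + d n) - K (z - d n)" for n
    using circle_fun_add_int[OF K, of "z + d n" k] circle_fun_add_int[OF K, of "z - d n" k]
    by (simp add: algebra_simps)
  then show ?thesis
    using lim[of "z + of_int k"] lim[of z] LIMSEQ_unique by simp
qed

section \<open>The transfer operator of a random family of circle homeomorphisms\<close>

locale circle_system =
  fixes \<mu> :: "'a pmf" and \<phi> :: "'a \<Rightarrow> real \<Rightarrow> real"
  assumes homeo: "\<And>a. circle_homeo (\<phi> a)"
    and no_inv: "\<And>K. circle_fun K \<Longrightarrow> \<exists>a\<in>set_pmf \<mu>. \<exists>s t. K (\<phi> a t) - K (\<phi> a s) \<noteq> K t - K s"
begin

abbreviation E :: "('a \<Rightarrow> real) \<Rightarrow> real" where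
  "E \<equiv> measure_pmf.expectation \<mu>"

text \<open>If \<open>K\<close> represents a measure, then \<open>K \<circ> \<phi> a\<close>
  represents its image under the inverse of \<open>\<phi> a\<close>. Thus \<open>T\<close> is one
  step of the inverse walk on measures, normalised at 0.\<close>

definition T :: "(real \<Rightarrow> real) \<Rightarrow> real \<Rightarrow> real" where
  "T K t = E (\<lambda>a. K (\<phi> a t) - K (\<phi> a 0))"

lemma phi_fun: "circle_fun (\<phi> a)"
  using homeo circle_homeo_fun by blast

lemma phi_diff_bound:
  assumes "circle_fun K"
  shows "\<bar>K (\<phi> a t) - K (\<phi> a s)\<bar> \<le> \<bar>t - s\<bar> + 2"
  using circle_fun_abs_bound[OF assms, of "\<phi> a t" "\<phi> a s"] circle_fun_abs_bound[OF phi_fun, of a t s]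
  by linarith

lemma integrable_phi_diff:
  assumes "circle_fun K"
  shows "integrable (measure_pmf \<mu>) (\<lambda>a. K (\<phi> a t) - K (\<phi> a s))"
  by (rule integrable_pmf_bounded[OF phi_diff_bound[OF assms]])

lemma T_diff:
  assumes "circle_fun K"
  shows "T K t - T K s = E (\<lambda>a. K (\<phi> a t) - K (\<phi> a s))"
  unfolding T_def
  by (subst Bochner_Integration.integral_diff[symmetric]) (auto intro!: integrable_phi_diff assms)

lemma T_zero [simp]: "T K 0 = 0"
  by (simp add: T_def)

lemma circle_fun_T:
  assumes K: "circle_fun K"
  shows "circle_fun (T K)"
  unfolding circle_fun_def
proof (intro conjI monoI allI)
  fix x y :: real assume xy: "x \<le> y"
  have "0 \<le> E (\<lambda>a. K (\<phi> a y) - K (\<phi> a x))"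
    using circle_fun_mono[OF K circle_fun_mono[OF phi_fun xy]] by (intro integral_nonneg_AE) auto
  then show "T K x \<le> T K y" using T_diff[OF K, of y x] by simp
next
  fix x
  have "K (\<phi> a (x + 1)) - K (\<phi> a x) = 1" for a
    using K phi_fun[of a] by (simp add: circle_fun_def)
  then show "T K (x + 1) = T K x + 1" using T_diff[OF K, of "x+1" x] by simp
qed

lemma circle_fun_Titer: "circle_fun K \<Longrightarrow> circle_fun ((T ^^ n) K)"
  by (induction n) (auto simp: circle_fun_T)

lemma Titer_zero: "n \<ge> 1 \<Longrightarrow> (T ^^ n) K 0 = 0"
  by (cases n) auto

lemma Titer_plim:
  assumes "\<And>n. e n \<ge> 1" "\<And>n. circle_fun (L n)"
  shows "circle_fun (plim (\<lambda>n. (T ^^ e n) (L n)))"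
    and "((\<lambda>n. (T ^^ e n) (L n) t) \<longlongrightarrow> plim (\<lambda>n. (T ^^ e n) (L n)) t) ufilter"
  using circle_fun_plim[of "\<lambda>n. (T ^^ e n) (L n)", OF circle_fun_Titer Titer_zero]
    plim_tendsto[of "\<lambda>n. (T ^^ e n) (L n)", OF circle_fun_Titer Titer_zero] assms by blast+

lemma T_tendsto:
  assumes F: "F \<noteq> bot" and L: "\<And>n. circle_fun (L n)" and lim: "\<And>t. ((\<lambda>n. L n t) \<longlongrightarrow> K t) F"
  shows "((\<lambda>n. T (L n) t) \<longlongrightarrow> T K t) F"
  unfolding T_def
  by (rule pmf_expectation_tendsto[OF F _ phi_diff_bound[OF L]]) (intro tendsto_intros lim)

subsection \<open>Extremal states\<close>

text \<open>The largest mass that the \<open>n\<close>-th image of any measure can give to an arc of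
  radius \<open>1 / Suc n\<close>. Tying the radius to \<open>n\<close> lets one index express both
  late times and short arcs.\<close>

definition osc :: "nat \<Rightarrow> real" where
  "osc n = (SUP p\<in>{K. circle_fun K} \<times> UNIV.
      (T ^^ n) (fst p) (snd p + 1 / real (Suc n)) - (T ^^ n) (fst p) (snd p - 1 / real (Suc n)))"

lemma osc_bdd:
  "bdd_above ((\<lambda>p. (T ^^ n) (fst p) (snd p + 1 / real (Suc n)) - (T ^^ n) (fst p) (snd p - 1 / real (Suc n)))
     ` ({K. circle_fun K} \<times> UNIV))"
proof (rule bdd_aboveI2)
  fix p :: "(real \<Rightarrow> real) \<times> real" assume "p \<in> {K. circle_fun K} \<times> UNIV"
  then have "circle_fun ((T ^^ n) (fst p))" by (auto intro: circle_fun_Titer)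
  from circle_fun_abs_bound[OF this, of "snd p + 1 / real (Suc n)" "snd p - 1 / real (Suc n)"]
  show "(T ^^ n) (fst p) (snd p + 1 / real (Suc n)) - (T ^^ n) (fst p) (snd p - 1 / real (Suc n)) \<le>
    \<bar>2 / real (Suc n)\<bar> + 1" by simp
qed

lemma osc_upper:
  assumes "circle_fun K"
  shows "(T ^^ n) K (t + 1 / real (Suc n)) - (T ^^ n) K (t - 1 / real (Suc n)) \<le> osc n"
  using cSUP_upper[OF _ osc_bdd, of "(K, t)" n] assms by (simp add: osc_def)

text \<open>A later iterate is an \<open>n\<close>-th iterate of another function, and the supremum
  in \<open>osc n\<close> runs over all of them.\<close>

lemma osc_upper':
  assumes "circle_fun K" "n \<le> m"
  shows "(T ^^ m) K (t + 1 / real (Suc n)) - (T ^^ m) K (t - 1 / real (Suc n)) \<le> osc n"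
  using osc_upper[OF circle_fun_Titer[OF assms(1), of "m - n"], of n t] assms(2)
  by (metis comp_apply funpow_add le_add_diff_inverse)

lemma osc_approx:
  assumes "r < osc n"
  obtains K t where "circle_fun K" "r < (T ^^ n) K (t + 1 / real (Suc n)) - (T ^^ n) K (t - 1 / real (Suc n))"
proof -
  have ne: "{K. circle_fun K} \<times> (UNIV :: real set) \<noteq> {}"
    using circle_homeo_fun[OF circle_homeo_id] by auto
  show ?thesis
    using assms that unfolding osc_def less_cSUP_iff[OF ne osc_bdd] by auto
qed

lemma osc_nonneg: "0 \<le> osc n"
proof -
  have "circle_fun (\<lambda>x. x)" by (rule circle_homeo_fun[OF circle_homeo_id])
  then have "0 \<le> (T ^^ n) (\<lambda>x. x) (0 + 1 / real (Suc n)) - (T ^^ n) (\<lambda>x. x) (0 - 1 / real (Suc n))"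
    using circle_fun_mono[OF circle_fun_Titer, of "\<lambda>x. x" "0 - 1 / real (Suc n)" "0 + 1 / real (Suc n)" n] by simp
  also have "\<dots> \<le> osc n"
    by (rule osc_upper[OF \<open>circle_fun (\<lambda>x. x)\<close>])
  finally show ?thesis .
qed

definition osc_lim :: real where
  "osc_lim = (INF n. osc n)"

lemma osc_lim_le: "osc_lim \<le> osc n"
  unfolding osc_lim_def by (rule cINF_lower) (auto intro: bdd_belowI[of _ 0] osc_nonneg)

text \<open>Weak limits of late iterates. By compactness each of them is the image under \<open>T\<close> of another one.\<close>

definition limit_state :: "(real \<Rightarrow> real) \<Rightarrow> bool" where
  "limit_state K \<longleftrightarrow> (\<exists>e L. filterlim e at_top sequentially \<and> (\<forall>n. e n \<ge> (1::nat) \<and> circle_fun (L n))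
      \<and> K = plim (\<lambda>n. (T ^^ e n) (L n)))"

lemma limit_stateE:
  assumes "limit_state K"
  obtains e L where "filterlim e at_top sequentially" "\<And>n. e n \<ge> (1::nat)" "\<And>n. circle_fun (L n)"
    "K = plim (\<lambda>n. (T ^^ e n) (L n))"
proof -
  from assms obtain e L where *: "filterlim e at_top sequentially \<and> (\<forall>n. e n \<ge> (1::nat) \<and> circle_fun (L n))
      \<and> K = plim (\<lambda>n. (T ^^ e n) (L n))"
    unfolding limit_state_def by (elim exE)
  show ?thesis
    by (rule that[of e L]) (use * in simp_all)
qed

lemma limit_state_fun: "limit_state K \<Longrightarrow> circle_fun K"
  unfolding limit_state_def using Titer_plim(1) by blast

text \<open>For each fixed \<open>m\<close>, late iterates obey the bound \<open>osc m\<close> on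
  arcs of radius \<open>1 / Suc m\<close>, and the bound survives the limit.\<close>

lemma limit_state_jump_le:
  assumes "limit_state K"
  shows "jump K z \<le> osc_lim"
proof -
  obtain e L where e: "filterlim e at_top sequentially" and L: "\<And>n. e n \<ge> (1::nat)" "\<And>n. circle_fun (L n)"
    and K: "K = plim (\<lambda>n. (T ^^ e n) (L n))"
    by (rule limit_stateE[OF assms], rule that; assumption)
  have lim: "((\<lambda>n. (T ^^ e n) (L n) t) \<longlongrightarrow> K t) ufilter" for t
    unfolding K by (rule Titer_plim(2)[OF L])
  have "jump K z \<le> osc m" for m
  proof -
    have "jump K z \<le> K (z + 1 / real (Suc m)) - K (z - 1 / real (Suc m))"
      by (intro jump_le limit_state_fun[OF assms]) auto
    also have "\<dots> \<le> osc m"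
    proof (rule tendsto_upperbound[OF tendsto_diff[OF lim lim]])
      have "eventually (\<lambda>n. m \<le> e n) sequentially"
        using e by (simp add: filterlim_at_top)
      then show "eventually (\<lambda>n. (T ^^ e n) (L n) (z + 1 / real (Suc m)) - (T ^^ e n) (L n) (z - 1 / real (Suc m)) \<le> osc m) ufilter"
        by (intro eventually_ufilter) (elim eventually_mono, rule osc_upper'[OF L(2)])
    qed simp
    finally show ?thesis .
  qed
  then show ?thesis unfolding osc_lim_def by (intro cINF_greatest) auto
qed

text \<open>Near-maximisers of \<open>osc (Suc n)\<close>, with centres moved into one period,
  converge along \<open>ufilter\<close>; as their arcs shrink to a point, the mass
  \<open>osc_lim\<close> ends up in one atom.\<close>

lemma limit_state_extremal:
  "\<exists>K z. limit_state K \<and> jump K z = osc_lim"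
proof -
  have "\<exists>K t. circle_fun K \<and> t \<in> {0..1} \<and> osc_lim - 1 / real (Suc n) < 
      (T ^^ Suc n) K (t + 1 / real (Suc (Suc n))) - (T ^^ Suc n) K (t - 1 / real (Suc (Suc n)))" for n
  proof -
    have "osc_lim - 1 / real (Suc n) < osc (Suc n)"
      using osc_lim_le[of "Suc n"] by (rule less_le_trans[rotated]) simp
    then obtain K t where K: "circle_fun K" and t: "osc_lim - 1 / real (Suc n) <
      (T ^^ Suc n) K (t + 1 / real (Suc (Suc n))) - (T ^^ Suc n) K (t - 1 / real (Suc (Suc n)))"
      by (rule osc_approx)
    have eq: "(T ^^ Suc n) K (frac t + x) = (T ^^ Suc n) K (t + x) - of_int \<lfloor>t\<rfloor>" for x
      using circle_fun_add_int[OF circle_fun_Titer[OF K], of "Suc n" "frac t + x" "\<lfloor>t\<rfloor>"]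
      by (simp add: frac_def algebra_simps)
    show ?thesis
      using K t eq[of "1 / real (Suc (Suc n))"] eq[of "- (1 / real (Suc (Suc n)))"] frac_ge_0[of t] frac_lt_1[of t]
      by (intro exI[of _ K] exI[of _ "frac t"]) (simp del: funpow.simps of_nat_Suc)
  qed
  then obtain L t where L: "\<And>n. circle_fun (L n)" and t: "\<And>n. t n \<in> {0..1}"
    and big: "\<And>n. osc_lim - 1 / real (Suc n) <
      (T ^^ Suc n) (L n) (t n + 1 / real (Suc (Suc n))) - (T ^^ Suc n) (L n) (t n - 1 / real (Suc (Suc n)))"
    by metis
  define K where "K = plim (\<lambda>n. (T ^^ Suc n) (L n))"
  define z where "z = ulim t"
  have K: "limit_state K"
    unfolding limit_state_def K_def
    by (intro exI[of _ Suc] exI[of _ L]) (auto simp: L filterlim_Suc)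
  have lim: "((\<lambda>n. (T ^^ Suc n) (L n) s) \<longlongrightarrow> K s) ufilter" for s
    unfolding K_def by (rule Titer_plim(2)[OF _ L]) simp
  have z: "(t \<longlongrightarrow> z) ufilter"
    unfolding z_def by (rule ulim_tendsto[of _ 1]) (use t in auto)
  have inv0: "((\<lambda>n. 1 / real (Suc n)) \<longlongrightarrow> 0) ufilter" "((\<lambda>n. 1 / real (Suc (Suc n))) \<longlongrightarrow> 0) ufilter"
    using LIMSEQ_inverse_real_of_nat LIMSEQ_Suc[OF LIMSEQ_inverse_real_of_nat]
    by (auto intro!: tendsto_ufilter simp: inverse_eq_divide)
  have "osc_lim \<le> jump K z"
  proof (rule jump_greatest)
    fix x y assume xy: "x < z" "z < y"
    have "osc_lim - 0 \<le> K y - K x"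
    proof (rule tendsto_le[OF ufilter_neq_bot tendsto_diff[OF lim lim] tendsto_diff[OF tendsto_const inv0(1)]])
      have "eventually (\<lambda>n. t n + 1 / real (Suc (Suc n)) < y) ufilter"
        using tendsto_add[OF z inv0(2)] xy by (intro order_tendstoD(2)) auto
      moreover have "eventually (\<lambda>n. x < t n - 1 / real (Suc (Suc n))) ufilter"
        using tendsto_diff[OF z inv0(2)] xy by (intro order_tendstoD(1)) auto
      ultimately show "eventually (\<lambda>n. osc_lim - 1 / real (Suc n) \<le> (T ^^ Suc n) (L n) y - (T ^^ Suc n) (L n) x) ufilter"
      proof eventually_elim
        case (elim n)
        have "circle_fun ((T ^^ Suc n) (L n))" by (rule circle_fun_Titer[OF L])
        from circle_fun_mono[OF this less_imp_le[OF elim(1)]] circle_fun_mono[OF this less_imp_le[OF elim(2)]]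
        show ?case using big[of n] by linarith
      qed
    qed
    then show "osc_lim \<le> K y - K x" by simp
  qed
  with limit_state_jump_le[OF K, of z] have "jump K z = osc_lim" by simp
  with K show ?thesis by blast
qed

text \<open>One factor \<open>T\<close> is removed from every iterate; \<open>T_tendsto\<close> lets
  it be applied again after the limit.\<close>

lemma limit_state_pred:
  assumes "limit_state K"
  shows "\<exists>K'. limit_state K' \<and> K = T K'"
proof -
  obtain e L where e: "filterlim e at_top sequentially" and L: "\<And>n. e n \<ge> (1::nat)" "\<And>n. circle_fun (L n)"
    and K: "K = plim (\<lambda>n. (T ^^ e n) (L n))"
    by (rule limit_stateE[OF assms], rule that; assumption)
  have lim: "((\<lambda>n. (T ^^ e n) (L n) t) \<longlongrightarrow> K t) ufilter" for t
    unfolding K by (rule Titer_plim(2)[OF L])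
  \<comment> \<open>The maximum with 1 affects only finitely many terms and keeps every term
    normalised at 0.\<close>
  define e' where "e' n = max 1 (e n - 1)" for n
  define K' where "K' = plim (\<lambda>n. (T ^^ e' n) (L n))"
  have ee: "eventually (\<lambda>n. e n \<ge> m) sequentially" for m
    using e by (simp add: filterlim_at_top)
  have e': "filterlim e' at_top sequentially"
    unfolding filterlim_at_top
  proof
    fix Z show "eventually (\<lambda>n. Z \<le> e' n) sequentially"
      using ee[of "Suc Z"] by eventually_elim (auto simp: e'_def)
  qed
  have K': "limit_state K'"
    unfolding limit_state_def K'_def using e' L(2)
    by (intro exI[of _ e'] exI[of _ L] conjI allI refl) (simp_all add: e'_def)
  have lim': "((\<lambda>n. (T ^^ e' n) (L n) t) \<longlongrightarrow> K' t) ufilter" for t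
    unfolding K'_def by (rule Titer_plim(2)[OF _ L(2)]) (simp add: e'_def)
  have "K t = T K' t" for t
  proof -
    have "((\<lambda>n. T ((T ^^ e' n) (L n)) t) \<longlongrightarrow> T K' t) ufilter"
      by (rule T_tendsto[OF ufilter_neq_bot circle_fun_Titer[OF L(2)] lim'])
    moreover have "eventually (\<lambda>n. T ((T ^^ e' n) (L n)) t = (T ^^ e n) (L n) t) ufilter"
    proof (rule eventually_ufilter, use ee[of 2] in eventually_elim)
      case (elim n)
      then have "e n = Suc (e' n)" by (auto simp: e'_def)
      then show ?case by simp
    qed
    ultimately have "((\<lambda>n. (T ^^ e n) (L n) t) \<longlongrightarrow> T K' t) ufilter"
      by (rule Lim_transform_eventually)
    with lim[of t] show ?thesis by (rule tendsto_unique[OF ufilter_neq_bot])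
  qed
  with K' show ?thesis by blast
qed

lemma jump_T:
  assumes K: "circle_fun K"
  shows "jump (T K) z = E (\<lambda>a. jump K (\<phi> a z))"
proof -
  define d where "d n = 1 / real (Suc n)" for n
  have d: "d \<longlonglongrightarrow> 0" "d n > 0" "d n \<le> 1" for n
    unfolding d_def using LIMSEQ_inverse_real_of_nat by (simp_all add: inverse_eq_divide)
  have x: "(\<lambda>n. z - d n) \<longlonglongrightarrow> z" "(\<lambda>n. z + d n) \<longlonglongrightarrow> z"
    using tendsto_diff[OF tendsto_const d(1), of z] tendsto_add[OF tendsto_const d(1), of z] by auto
  have "(\<lambda>n. T K (z + d n) - T K (z - d n)) \<longlonglongrightarrow> jump (T K) z"
    by (rule jump_tendsto[OF circle_fun_T[OF K]]) (use x d in auto)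
  moreover have "(\<lambda>n. E (\<lambda>a. K (\<phi> a (z + d n)) - K (\<phi> a (z - d n)))) \<longlonglongrightarrow> E (\<lambda>a. jump K (\<phi> a z))"
  proof (rule pmf_expectation_tendsto[where B=4])
    show "(\<lambda>n. K (\<phi> a (z + d n)) - K (\<phi> a (z - d n))) \<longlonglongrightarrow> jump K (\<phi> a z)" for a
      by (rule jump_tendsto[OF K])
         (use x d circle_homeo_strict[OF homeo] isCont_tendsto_compose[OF circle_homeo_isCont[OF homeo]] in auto)
    show "\<bar>K (\<phi> a (z + d n)) - K (\<phi> a (z - d n))\<bar> \<le> 4" for n a
      using phi_diff_bound[OF K, of a "z + d n" "z - d n"] d(2,3)[of n] by linarith
  qed simp
  ultimately show ?thesis
    unfolding T_diff[OF K] by (rule LIMSEQ_unique)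
qed

text \<open>A maximum principle: a mean of values at most \<open>c\<close> equals \<open>c\<close>
  only if no letter of the support falls below it.\<close>

lemma jump_T_extremal:
  assumes K: "circle_fun K" and le: "\<And>z. jump K z \<le> c" and eq: "jump (T K) z = c" and a: "a \<in> set_pmf \<mu>"
  shows "jump K (\<phi> a z) = c"
proof -
  have bd: "\<bar>jump K x\<bar> \<le> \<bar>c\<bar>" for x
    using le[of x] jump_nonneg[OF K, of x] by linarith
  have "E (\<lambda>a. c - jump K (\<phi> a z)) = 0"
    using eq jump_T[OF K, of z]
    by (subst Bochner_Integration.integral_diff) (auto intro!: integrable_pmf_bounded bd)
  then have "AE a in measure_pmf \<mu>. c - jump K (\<phi> a z) = 0"
    by (subst (asm) integral_nonneg_eq_0_iff_AE)
       (use le in \<open>auto intro!: integrable_pmf_bounded[OF bd] Bochner_Integration.integrable_diff\<close>)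
  then show ?thesis using a by (auto simp: AE_measure_pmf_iff)
qed

end

lemma lim_const_over_Suc: "(\<lambda>n. B * (1 / real (Suc n))) \<longlonglongrightarrow> 0"
  using tendsto_mult[OF tendsto_const LIMSEQ_inverse_real_of_nat, of B] by (simp add: inverse_eq_divide)

text \<open>The map \<open>F\<close> carries the measure of each \<open>\<kappa> i\<close> to that
  of the next one, so the sums before and after applying \<open>F\<close> differ by two boundary
  terms, which averaging removes.\<close>

lemma cesaro_invariant:
  assumes \<kappa>: "\<And>i. circle_fun (\<kappa> i)"
    and step: "\<And>i s t. \<kappa> (Suc i) (F t) - \<kappa> (Suc i) (F s) = \<kappa> i t - \<kappa> i s"
    and F: "circle_fun F"
  shows "plim (cesaro \<kappa>) (F t) - plim (cesaro \<kappa>) (F s) = plim (cesaro \<kappa>) t - plim (cesaro \<kappa>) s"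
proof -
  let ?C = "cesaro \<kappa>" and ?K = "plim (cesaro \<kappa>)"
  have C_diff: "?C n y - ?C n x = (\<Sum>i\<le>n. \<kappa> i y - \<kappa> i x) / real (Suc n)" for n x y
    unfolding cesaro_def diff_divide_distrib[symmetric] sum_subtractf[symmetric] by simp
  have lim: "((\<lambda>n. ?C n x) \<longlongrightarrow> ?K x) ufilter" for x
    by (rule plim_tendsto) (simp_all add: circle_fun_cesaro[OF \<kappa>])
  have tel: "(\<Sum>i\<le>n. \<kappa> i (F t) - \<kappa> i (F s)) - (\<Sum>i\<le>n. \<kappa> i t - \<kappa> i s)
      = (\<kappa> 0 (F t) - \<kappa> 0 (F s)) - (\<kappa> n t - \<kappa> n s)" for n
    by (induction n) (simp_all add: step)
  define B where "B = \<bar>F t - F s\<bar> + \<bar>t - s\<bar> + 2"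
  have bd: "\<bar>(?C n (F t) - ?C n (F s)) - (?C n t - ?C n s)\<bar> \<le> B * (1 / real (Suc n))" for n
  proof -
    have "\<bar>(\<kappa> 0 (F t) - \<kappa> 0 (F s)) - (\<kappa> n t - \<kappa> n s)\<bar> \<le> B"
      using circle_fun_abs_bound[OF \<kappa>[of 0], of "F t" "F s"] circle_fun_abs_bound[OF \<kappa>[of n], of t s]
      unfolding B_def by linarith
    then show ?thesis
      unfolding C_diff diff_divide_distrib[symmetric] tel by (simp add: divide_right_mono)
  qed
  have "(\<lambda>n. (?C n (F t) - ?C n (F s)) - (?C n t - ?C n s)) \<longlonglongrightarrow> 0"
    by (rule Lim_null_comparison[OF always_eventually lim_const_over_Suc]) (use bd in \<open>simp only: real_norm_def, blast\<close>)
  then have "((\<lambda>n. (?C n (F t) - ?C n (F s)) - (?C n t - ?C n s)) \<longlongrightarrow> 0) ufilter"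
    by (rule tendsto_ufilter)
  moreover have "((\<lambda>n. (?C n (F t) - ?C n (F s)) - (?C n t - ?C n s)) \<longlongrightarrow>
      (?K (F t) - ?K (F s)) - (?K t - ?K s)) ufilter"
    by (intro tendsto_diff lim)
  ultimately have "0 = (?K (F t) - ?K (F s)) - (?K t - ?K s)" by (rule tendsto_unique[OF ufilter_neq_bot])
  then show ?thesis by simp
qed

context circle_system
begin

text \<open>Otherwise there is an infinite past of states whose largest atoms all have mass \<open>osc_lim\<close>. Every
  \<open>\<phi> a\<close> maps the maximal atoms of one state injectively to those of its predecessor, so bijectively once
  their number has stabilised, and averaging the counting measures of these finite sets gives
  an invariant function.\<close>

lemma osc_lim_zero: "osc_lim = 0"
proof (rule ccontr)
  assume "osc_lim \<noteq> 0"
  moreover have "0 \<le> osc_lim"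
    unfolding osc_lim_def by (rule cINF_greatest) (auto intro: osc_nonneg)
  ultimately have pos: "osc_lim > 0" by simp
  obtain K0 z0 where K0: "limit_state K0" "jump K0 z0 = osc_lim"
    using limit_state_extremal by blast
  have "\<exists>Ks. \<forall>i. limit_state (Ks i) \<and> (i = 0 \<longrightarrow> Ks i = K0) \<and> Ks i = T (Ks (Suc i))"
    using dependent_nat_choice[of "\<lambda>i K. limit_state K \<and> (i = 0 \<longrightarrow> K = K0)" "\<lambda>i K K'. K = T K'"]
      K0(1) limit_state_pred by (metis nat.distinct(2))
  then obtain Ks where Ks: "\<And>i. limit_state (Ks i)" "Ks 0 = K0" "\<And>i. Ks i = T (Ks (Suc i))"
    by blast
  have Kf: "circle_fun (Ks i)" for i by (rule limit_state_fun[OF Ks(1)])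
  define A where "A i = {z\<in>{0..<1}. jump (Ks i) z = osc_lim}" for i
  have card_le: "real (card Z) * osc_lim \<le> 1" if "finite Z" "Z \<subseteq> A i" for Z i
  proof -
    have "sum (jump (Ks i)) Z \<le> 1"
      using that by (intro sum_jump_period_le[OF Kf]) (auto simp: A_def)
    moreover have "sum (jump (Ks i)) Z = (\<Sum>z\<in>Z. osc_lim)"
      by (rule sum.cong) (use that in \<open>auto simp: A_def\<close>)
    ultimately show ?thesis by simp
  qed
  define B where "B = nat \<lceil>1 / osc_lim\<rceil>"
  have card_B: "card Z \<le> B" if "finite Z" "Z \<subseteq> A i" for Z i
  proof -
    have "real (card Z) \<le> 1 / osc_lim" using card_le[OF that] pos by (simp add: field_simps)
    then show ?thesis unfolding B_def by linarith
  qed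
  have fin: "finite (A i)" for i
  proof (rule ccontr)
    assume "infinite (A i)"
    then obtain Z where "finite Z" "card Z = Suc B" "Z \<subseteq> A i"
      using infinite_arbitrarily_large by blast
    with card_B[of Z i] show False by simp
  qed
  define g where "g a z = frac (\<phi> a z)" for a z
  have gA: "g a z \<in> A (Suc i)" if "z \<in> A i" "a \<in> set_pmf \<mu>" for a z i
  proof -
    have "jump (Ks (Suc i)) (\<phi> a z) = osc_lim"
    proof (rule jump_T_extremal[OF Kf _ _ that(2)])
      show "jump (Ks (Suc i)) w \<le> osc_lim" for w by (rule limit_state_jump_le[OF Ks(1)])
      show "jump (T (Ks (Suc i))) z = osc_lim" using that Ks(3)[of i] by (simp add: A_def)
    qed
    then show ?thesis
      using jump_add_int[OF Kf, of "Suc i" "\<phi> a z" "- \<lfloor>\<phi> a z\<rfloor>"] frac_lt_1[of "\<phi> a z"]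
      by (simp add: A_def g_def frac_def)
  qed
  have ginj: "inj_on (g a) (A i)" for a i
  proof (rule inj_onI)
    fix z w assume zw: "z \<in> A i" "w \<in> A i" "g a z = g a w"
    define k where "k = \<lfloor>\<phi> a z\<rfloor> - \<lfloor>\<phi> a w\<rfloor>"
    have "\<phi> a z = \<phi> a (w + of_int k)"
      using zw(3) circle_fun_add_int[OF phi_fun, of a w k] by (simp add: g_def frac_def k_def)
    then have zwk: "z = w + of_int k"
      using circle_homeo_le[OF homeo[of a]] by (metis order_antisym order_refl)
    moreover have "\<bar>z - w\<bar> < 1" using zw by (auto simp: A_def)
    ultimately have "k = 0" by linarith
    with zwk show "z = w" by simp
  qed
  obtain a0 where a0: "a0 \<in> set_pmf \<mu>" using set_pmf_not_empty by fast
  have card_step: "card (A i) \<le> card (A (Suc i))" for i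
    using card_inj_on_le[OF ginj[of a0 i] _ fin] gA a0 by blast
  have card_mono: "card (A i) \<le> card (A j)" if "i \<le> j" for i j
    using lift_Suc_mono_le[of "\<lambda>i. card (A i)", OF card_step that] .
  have "finite (range (\<lambda>i. card (A i)))"
    by (rule finite_subset[of _ "{..B}"]) (use card_B[OF fin] in auto)
  then obtain i0 where i0: "card (A i0) = Max (range (\<lambda>i. card (A i)))"
    using Max_in by (metis (mono_tags, lifting) UNIV_not_empty image_iff image_is_empty)
  have card_eq: "card (A (i0 + i)) = card (A i0)" for i
  proof (rule antisym)
    show "card (A (i0 + i)) \<le> card (A i0)"
      unfolding i0 by (rule Max_ge) (use \<open>finite (range (\<lambda>i. card (A i)))\<close> in auto)
  qed (rule card_mono, simp)
  have bij: "bij_betw (g a) (A (i0 + i)) (A (Suc (i0 + i)))" if a: "a \<in> set_pmf \<mu>" for a i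
    unfolding bij_betw_def
  proof
    show "g a ` A (i0 + i) = A (Suc (i0 + i))"
    proof (rule card_subset_eq[OF fin])
      show "g a ` A (i0 + i) \<subseteq> A (Suc (i0 + i))" using gA a by blast
      show "card (g a ` A (i0 + i)) = card (A (Suc (i0 + i)))"
        using card_image[OF ginj] card_eq[of i] card_eq[of "Suc i"] by simp
    qed
  qed (rule ginj)
  have "frac z0 \<in> A 0"
    using K0 jump_add_int[OF Kf, of 0 z0 "- \<lfloor>z0\<rfloor>"] frac_lt_1[of z0] Ks(2) by (simp add: A_def frac_def)
  then have "card (A 0) > 0" using fin card_gt_0_iff by blast
  then have cpos: "card (A i0) > 0" using card_mono[of 0 i0] by simp
  \<comment> \<open>Up to a constant, the distribution function of the uniform measure on
    \<open>A (i0 + i)\<close>, written as a mean of point masses.\<close>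
  define \<kappa> where "\<kappa> i t = (\<Sum>z\<in>A (i0 + i). real_of_int \<lfloor>t - z\<rfloor>) / real (card (A i0))" for i t
  have \<kappa>: "circle_fun (\<kappa> i)" for i
    unfolding circle_fun_def
  proof (intro conjI monoI allI)
    show "\<kappa> i x \<le> \<kappa> i y" if "x \<le> y" for x y
      unfolding \<kappa>_def using that by (intro divide_right_mono sum_mono) (auto intro: floor_mono)
    have "\<lfloor>x + 1 - z\<rfloor> = \<lfloor>x - z\<rfloor> + 1" for x z :: real by linarith
    then show "\<kappa> i (x + 1) = \<kappa> i x + 1" for x
      using card_eq[of i] cpos by (simp add: \<kappa>_def sum.distrib add_divide_distrib)
  qed
  have step: "\<kappa> (Suc i) (\<phi> a t) - \<kappa> (Suc i) (\<phi> a s) = \<kappa> i t - \<kappa> i s" if a: "a \<in> set_pmf \<mu>" for a i s t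
  proof -
    \<comment> \<open>The integer parts \<open>\<lfloor>\<phi> a z\<rfloor>\<close> come from
      reducing \<open>\<phi> a z\<close> to one period. They do not depend on \<open>x\<close> and
      cancel in the increments.\<close>
    have "(\<Sum>z\<in>A (Suc (i0 + i)). real_of_int \<lfloor>\<phi> a x - z\<rfloor>)
        = (\<Sum>z\<in>A (i0 + i). real_of_int \<lfloor>x - z\<rfloor> + real_of_int \<lfloor>\<phi> a z\<rfloor>)" for x
    proof -
      have "(\<Sum>z\<in>A (Suc (i0 + i)). real_of_int \<lfloor>\<phi> a x - z\<rfloor>) = (\<Sum>z\<in>A (i0 + i). real_of_int \<lfloor>\<phi> a x - g a z\<rfloor>)"
        using sum.reindex_bij_betw[OF bij[OF a, of i], of "\<lambda>z. real_of_int \<lfloor>\<phi> a x - z\<rfloor>"] by simp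
      also have "\<dots> = (\<Sum>z\<in>A (i0 + i). real_of_int \<lfloor>x - z\<rfloor> + real_of_int \<lfloor>\<phi> a z\<rfloor>)"
      proof (rule sum.cong[OF refl])
        fix z
        have "\<lfloor>\<phi> a x - g a z\<rfloor> = \<lfloor>\<phi> a x - \<phi> a z\<rfloor> + \<lfloor>\<phi> a z\<rfloor>"
          unfolding floor_add_int by (simp add: g_def frac_def algebra_simps)
        then show "real_of_int \<lfloor>\<phi> a x - g a z\<rfloor> = real_of_int \<lfloor>x - z\<rfloor> + real_of_int \<lfloor>\<phi> a z\<rfloor>"
          unfolding floor_circle_homeo[OF homeo] by simp
      qed
      finally show ?thesis .
    qed
    then show ?thesis by (simp add: \<kappa>_def sum.distrib diff_divide_distrib[symmetric])
  qed
  have "plim (cesaro \<kappa>) (\<phi> a t) - plim (cesaro \<kappa>) (\<phi> a s) = plim (cesaro \<kappa>) t - plim (cesaro \<kappa>) s"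
    if "a \<in> set_pmf \<mu>" for a s t
    by (rule cesaro_invariant[where F="\<phi> a" and \<kappa>=\<kappa>, OF \<kappa> step[OF that] phi_fun])
  moreover have "circle_fun (plim (cesaro \<kappa>))"
    by (intro circle_fun_plim circle_fun_cesaro \<kappa> cesaro_zero)
  ultimately show False using no_inv by blast
qed

theorem concentration:
  assumes "\<delta> > 0"
  obtains n where "\<And>K t. circle_fun K \<Longrightarrow> (T ^^ n) K (t + 1 / real (Suc n)) - (T ^^ n) K (t - 1 / real (Suc n)) < \<delta>"
proof -
  have "\<exists>n. osc n < \<delta>"
  proof (rule ccontr)
    assume "\<not> (\<exists>n. osc n < \<delta>)"
    then have "\<delta> \<le> osc_lim" unfolding osc_lim_def by (intro cINF_greatest) (auto simp: not_less)
    with assms show False by (simp add: osc_lim_zero)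
  qed
  then obtain n where "osc n < \<delta>" ..
  then show ?thesis using osc_upper that by (meson le_less_trans)
qed

text \<open>A stationary \<open>K\<close> has the same increments as all its iterates, so the
  concentration bound is a modulus of continuity for \<open>K\<close> itself.\<close>

lemma stationary_continuous:
  assumes K: "circle_fun K" and st: "\<And>s t. E (\<lambda>a. K (\<phi> a t) - K (\<phi> a s)) = K t - K s"
  shows "continuous_on UNIV K"
proof -
  have Tn: "(T ^^ n) K t - (T ^^ n) K s = K t - K s" for n s t
  proof (induction n arbitrary: s t)
    case (Suc n)
    have "(T ^^ Suc n) K t - (T ^^ Suc n) K s = E (\<lambda>a. (T ^^ n) K (\<phi> a t) - (T ^^ n) K (\<phi> a s))"
      using T_diff[OF circle_fun_Titer[OF K]] by simp
    also have "\<dots> = K t - K s" by (simp add: Suc.IH st)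
    finally show ?case .
  qed simp
  show ?thesis
    unfolding continuous_on_eq_continuous_at[OF open_UNIV]
  proof
    fix t :: real
    show "isCont K t"
      unfolding continuous_at_eps_delta
    proof (intro allI impI)
      fix e :: real assume "e > 0"
      then obtain n where n: "\<And>L t. circle_fun L \<Longrightarrow> (T ^^ n) L (t + 1 / real (Suc n)) - (T ^^ n) L (t - 1 / real (Suc n)) < e"
        by (rule concentration) blast
      have n: "K (t + 1 / real (Suc n)) - K (t - 1 / real (Suc n)) < e"
        using n[OF K, of t] Tn by simp
      show "\<exists>d>0. \<forall>x'. dist x' t < d \<longrightarrow> dist (K x') (K t) < e"
      proof (intro exI[of _ "1 / real (Suc n)"] conjI allI impI)
        fix x' assume "dist x' t < 1 / real (Suc n)"
        then have x': "t - 1 / real (Suc n) \<le> x'" "x' \<le> t + 1 / real (Suc n)"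
          unfolding dist_real_def by linarith+
        have "t - 1 / real (Suc n) \<le> t" "t \<le> t + 1 / real (Suc n)" by simp_all
        note le = circle_fun_mono[OF K x'(1)] circle_fun_mono[OF K x'(2)]
          circle_fun_mono[OF K this(1)] circle_fun_mono[OF K this(2)]
        show "dist (K x') (K t) < e" using le n unfolding dist_real_def by linarith
      qed simp
    qed
  qed
qed

text \<open>The Krylov-Bogolyubov argument, started from the uniform measure: \<open>T\<close>
  changes the averages of the orbit only by boundary terms of order
  \<open>1 / Suc n\<close>.\<close>

lemma stationary_exists:
  obtains H where "circle_fun H" "\<And>s t. E (\<lambda>a. H (\<phi> a t) - H (\<phi> a s)) = H t - H s" "continuous_on UNIV H"
proof -
  define L where "L i = (T ^^ Suc i) (\<lambda>x. x)" for i
  have L: "circle_fun (L i)" for i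
    unfolding L_def by (rule circle_fun_Titer[OF circle_homeo_fun[OF circle_homeo_id]])
  have L0: "L i 0 = 0" for i by (simp add: L_def)
  define H where "H = plim (cesaro L)"
  have C: "circle_fun (cesaro L n)" for n by (rule circle_fun_cesaro[OF L])
  have H: "circle_fun H" unfolding H_def by (rule circle_fun_plim) (simp_all add: C)
  have lim: "((\<lambda>n. cesaro L n t) \<longlongrightarrow> H t) ufilter" for t
    unfolding H_def by (rule plim_tendsto) (simp_all add: C)
  have TC: "T (cesaro L n) t - cesaro L n t = (L (Suc n) t - L 0 t) / real (Suc n)" for n t
  proof -
    have "T (cesaro L n) t = E (\<lambda>a. (\<Sum>i\<le>n. L i (\<phi> a t) - L i (\<phi> a 0)) / real (Suc n))"
      unfolding T_def cesaro_def diff_divide_distrib[symmetric] sum_subtractf[symmetric] by simp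
    also have "\<dots> = (\<Sum>i\<le>n. E (\<lambda>a. L i (\<phi> a t) - L i (\<phi> a 0))) / real (Suc n)"
      by (simp add: Bochner_Integration.integral_sum integrable_phi_diff[OF L])
    also have "\<dots> = (\<Sum>i\<le>n. L (Suc i) t) / real (Suc n)"
      by (simp add: T_def[symmetric] L_def del: of_nat_Suc)
    finally have "T (cesaro L n) t - cesaro L n t = ((\<Sum>i\<le>n. L (Suc i) t) - (\<Sum>i\<le>n. L i t)) / real (Suc n)"
      by (simp add: cesaro_def L0 diff_divide_distrib)
    also have "(\<Sum>i\<le>n. L (Suc i) t) - (\<Sum>i\<le>n. L i t) = L (Suc n) t - L 0 t"
      by (induction n) simp_all
    finally show ?thesis .
  qed
  have TH: "T H t = H t" for t
  proof -
    have bd: "\<bar>T (cesaro L n) t - cesaro L n t\<bar> \<le> (2 * \<bar>t\<bar> + 2) * (1 / real (Suc n))" for n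
    proof -
      have "\<bar>L (Suc n) t - L 0 t\<bar> \<le> 2 * \<bar>t\<bar> + 2"
        using circle_fun_abs_bound[OF L[of "Suc n"], of t 0] circle_fun_abs_bound[OF L[of 0], of t 0]
        unfolding L0 by linarith
      then show ?thesis unfolding TC by (simp add: divide_right_mono)
    qed
    have "(\<lambda>n. T (cesaro L n) t - cesaro L n t) \<longlonglongrightarrow> 0"
      by (rule Lim_null_comparison[OF always_eventually lim_const_over_Suc]) (use bd in \<open>simp only: real_norm_def, blast\<close>)
    then have "((\<lambda>n. T (cesaro L n) t - cesaro L n t) \<longlongrightarrow> 0) ufilter"
      by (rule tendsto_ufilter)
    moreover have "((\<lambda>n. T (cesaro L n) t - cesaro L n t) \<longlongrightarrow> T H t - H t) ufilter"
      by (intro tendsto_diff lim T_tendsto ufilter_neq_bot C)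
    ultimately have "0 = T H t - H t" by (rule tendsto_unique[OF ufilter_neq_bot])
    then show ?thesis by simp
  qed
  have st: "E (\<lambda>a. H (\<phi> a t) - H (\<phi> a s)) = H t - H s" for s t
    using T_diff[OF H, of t s] TH by simp
  show ?thesis by (rule that[OF H st stationary_continuous[OF H st]])
qed

end

section \<open>Rigidity of the stationary height function\<close>

text \<open>The first letter of the list acts first, which reverses the order of a
  composition.\<close>

primrec word :: "('a \<Rightarrow> real \<Rightarrow> real) \<Rightarrow> 'a list \<Rightarrow> real \<Rightarrow> real" where
  "word \<phi> [] x = x"
| "word \<phi> (a # l) x = word \<phi> l (\<phi> a x)"

lemma word_append: "word \<phi> (l @ m) x = word \<phi> m (word \<phi> l x)"
  by (induction l arbitrary: x) auto

lemma circle_homeo_word: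
  assumes "\<And>a. circle_homeo (\<phi> a)"
  shows "circle_homeo (word \<phi> l)"
proof (induction l)
  case Nil
  have "word \<phi> [] = (\<lambda>x. x)" by auto
  then show ?case using circle_homeo_id by simp
next
  case (Cons a l)
  have "word \<phi> (a # l) = word \<phi> l \<circ> \<phi> a" by auto
  then show ?case using circle_homeo_compose[OF Cons assms, of a] by (simp only:)
qed

text \<open>A small period \<open>d\<close> determines \<open>f\<close> along the points
  \<open>x + m * d\<close>, and monotonicity leaves an error of at most \<open>d\<close> between two
  of them.\<close>

lemma mono_translation:
  fixes f :: "real \<Rightarrow> real"
  assumes f: "mono f" and small: "\<And>e. e > 0 \<Longrightarrow> \<exists>d. 0 < d \<and> d < e \<and> (\<forall>h. f (h + d) = f h + d)"
    and xy: "x \<le> y"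
  shows "f y - f x = y - x"
proof (rule ccontr)
  assume "f y - f x \<noteq> y - x"
  then obtain d where d: "0 < d" "d < \<bar>(f y - f x) - (y - x)\<bar>" "\<And>h. f (h + d) = f h + d"
    using small[of "\<bar>(f y - f x) - (y - x)\<bar>"] by auto
  have md: "f (x + real m * d) = f x + real m * d" for m
  proof (induction m)
    case (Suc m)
    have "f (x + real (Suc m) * d) = f ((x + real m * d) + d)" by (simp add: algebra_simps)
    also have "\<dots> = f (x + real m * d) + d" by (rule d(3))
    finally show ?case using Suc by (simp add: algebra_simps)
  qed simp
  define m where "m = nat \<lfloor>(y - x) / d\<rfloor>"
  have "0 \<le> (y - x) / d" using xy d by simp
  then have "real m = of_int \<lfloor>(y - x) / d\<rfloor>" unfolding m_def by simp
  then have "real m \<le> (y - x) / d" "(y - x) / d < real (Suc m)" by linarith+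
  then have m: "x + real m * d \<le> y" "y \<le> x + real (Suc m) * d"
    using d(1) by (auto simp: field_simps)
  have "f x + real m * d \<le> f y" "f y \<le> f x + real (Suc m) * d"
    using monoD[OF f m(1)] monoD[OF f m(2)] unfolding md .
  then have "\<bar>(f y - f x) - (y - x)\<bar> \<le> d" using m by (simp add: algebra_simps)
  with d show False by simp
qed

text \<open>A positive word in the support undoes each letter; the integer \<open>k\<close> appears
  because lifts of inverse maps are inverse only up to translation.\<close>

locale circle_walk = circle_system \<mu> \<phi> for \<mu> :: "'a::countable pmf" and \<phi> +
  assumes inverse_word: "a \<in> set_pmf \<mu> \<Longrightarrow>
    \<exists>l k. set l \<subseteq> set_pmf \<mu> \<and> (\<forall>x. word \<phi> l (\<phi> a x) = x + of_int k)"
begin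

section \<open>The height function and the action on its collapsed levels\<close>

definition H :: "real \<Rightarrow> real" where
  "H = (SOME H. circle_fun H \<and> (\<forall>s t. E (\<lambda>a. H (\<phi> a t) - H (\<phi> a s)) = H t - H s) \<and> continuous_on UNIV H)"

lemma H_exists: "\<exists>H. circle_fun H \<and> (\<forall>s t. E (\<lambda>a. H (\<phi> a t) - H (\<phi> a s)) = H t - H s) \<and> continuous_on UNIV H"
proof (rule stationary_exists)
  fix H :: "real \<Rightarrow> real"
  assume "circle_fun H" "\<And>s t. E (\<lambda>a. H (\<phi> a t) - H (\<phi> a s)) = H t - H s" "continuous_on UNIV H"
  then show ?thesis by (intro exI[of _ H] conjI allI)
qed

lemma H_props: "circle_fun H \<and> (\<forall>s t. E (\<lambda>a. H (\<phi> a t) - H (\<phi> a s)) = H t - H s) \<and> continuous_on UNIV H"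
  unfolding H_def by (rule someI_ex[OF H_exists])

lemmas H_fun = H_props[THEN conjunct1]
lemmas H_stationary = H_props[THEN conjunct2, THEN conjunct1, rule_format]
lemmas H_cont = H_props[THEN conjunct2, THEN conjunct2]
lemmas H_mono = circle_fun_mono[OF H_fun]
lemmas H_add_int = circle_fun_add_int[OF H_fun]

lemma word_homeo: "circle_homeo (word \<phi> l)"
  by (rule circle_homeo_word[OF homeo])

text \<open>By stationarity the nonnegative heights of the images of the arc have mean
  \<open>H t - H s = 0\<close>, so each letter of the support gives 0. This is what makes the
  collapsed action \<open>hat\<close> well defined.\<close>

lemma H_level_aux:
  assumes a: "a \<in> set_pmf \<mu>" and st: "H s = H t" "s \<le> t"
  shows "H (\<phi> a s) = H (\<phi> a t)"
proof -
  have nn: "0 \<le> H (\<phi> b t) - H (\<phi> b s)" for b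
    using H_mono[OF circle_fun_mono[OF phi_fun st(2)]] by simp
  have "E (\<lambda>b. H (\<phi> b t) - H (\<phi> b s)) = 0" using H_stationary st by simp
  then have "AE b in measure_pmf \<mu>. H (\<phi> b t) - H (\<phi> b s) = 0"
    by (subst (asm) integral_nonneg_eq_0_iff_AE) (use nn in \<open>auto intro: integrable_phi_diff H_fun\<close>)
  then show ?thesis using a by (simp add: AE_measure_pmf_iff)
qed

lemma H_level: "a \<in> set_pmf \<mu> \<Longrightarrow> H s = H t \<Longrightarrow> H (\<phi> a s) = H (\<phi> a t)"
  by (metis H_level_aux linorder_linear)

lemma H_level_word: "set l \<subseteq> set_pmf \<mu> \<Longrightarrow> H s = H t \<Longrightarrow> H (word \<phi> l s) = H (word \<phi> l t)"
proof (induction l arbitrary: s t)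
  case (Cons a l)
  have "H (word \<phi> l (\<phi> a s)) = H (word \<phi> l (\<phi> a t))"
    by (rule Cons.IH[OF _ H_level]) (use Cons.prems in \<open>simp_all only: set_simps, auto\<close>)
  then show ?case by (simp only: word.simps)
qed simp

definition sec :: "real \<Rightarrow> real" where
  "sec h = (SOME x. H x = h)"

lemma H_sec [simp]: "H (sec h) = h"
  unfolding sec_def by (rule someI_ex) (rule circle_fun_surj[OF H_fun H_cont])

text \<open>The action of a word on the circle obtained by collapsing the level sets of \<open>H\<close>.\<close>

definition hat :: "'a list \<Rightarrow> real \<Rightarrow> real" where
  "hat l h = H (word \<phi> l (sec h))"

lemma hat_H: "set l \<subseteq> set_pmf \<mu> \<Longrightarrow> hat l (H x) = H (word \<phi> l x)"
  unfolding hat_def by (rule H_level_word) auto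

lemma hat_Cons: "set (a # l) \<subseteq> set_pmf \<mu> \<Longrightarrow> hat (a # l) h = hat l (hat [a] h)"
  using hat_H[of "a # l" "sec h"] hat_H[of "[a]" "sec h"] hat_H[of l "\<phi> a (sec h)"] by simp

lemma sec_strict: "h < h' \<Longrightarrow> sec h < sec h'"
  using H_mono[of "sec h'" "sec h"] by force

lemma circle_fun_hat:
  assumes l: "set l \<subseteq> set_pmf \<mu>"
  shows "circle_fun (hat l)"
  unfolding circle_fun_def
proof (intro conjI monoI allI)
  fix x y :: real assume "x \<le> y"
  then have "sec x \<le> sec y" using sec_strict[of x y] by (cases "x = y") auto
  then show "hat l x \<le> hat l y"
    unfolding hat_def by (intro H_mono) (simp add: circle_homeo_le[OF word_homeo])
next
  fix h
  have "hat l (h + 1) = hat l (H (sec h + 1))" using H_add_int[of "sec h" 1] by simp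
  also have "\<dots> = H (word \<phi> l (sec h) + 1)"
    using word_homeo[of l] by (simp add: hat_H[OF l] circle_homeo_def)
  finally show "hat l (h + 1) = hat l h + 1" using H_add_int[of "word \<phi> l (sec h)" 1] by (simp add: hat_def)
qed

lemma hat_surj: 
  assumes l: "set l \<subseteq> set_pmf \<mu>"
  shows "\<exists>h. hat l h = y"
proof -
  have "continuous_on UNIV (H \<circ> word \<phi> l)"
    using continuous_on_compose[of UNIV "word \<phi> l" H] continuous_on_subset[OF H_cont] word_homeo[of l]
    by (simp add: circle_homeo_def)
  moreover have "circle_fun (H \<circ> word \<phi> l)"
    by (rule circle_fun_compose[OF H_fun circle_homeo_fun[OF word_homeo]])
  ultimately obtain x where "(H \<circ> word \<phi> l) x = y" using circle_fun_surj by blast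
  then show ?thesis using hat_H[OF l, of x] by auto
qed

lemma hat_cont: "set l \<subseteq> set_pmf \<mu> \<Longrightarrow> continuous_on UNIV (hat l)"
  by (rule continuous_onI_mono)
     (use hat_surj[of l] circle_fun_mono[OF circle_fun_hat[of l]] in \<open>auto simp: surj_def[symmetric], metis UNIV_I open_UNIV surj_def\<close>)

lemma hat_inverse:
  assumes "a \<in> set_pmf \<mu>"
  obtains l k where "set l \<subseteq> set_pmf \<mu>" "\<And>h. hat l (hat [a] h) = h + of_int k"
proof -
  obtain l k where l: "set l \<subseteq> set_pmf \<mu>" "\<And>x. word \<phi> l (\<phi> a x) = x + of_int k"
    using inverse_word[OF assms] by blast
  have "hat l (hat [a] h) = h + of_int k" for h
    using hat_Cons[of a l h] l assms by (simp add: hat_def H_add_int)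
  with l show ?thesis using that by blast
qed

text \<open>If a letter merged two levels, the word that undoes it could not separate them
  again.\<close>

lemma hat_strict: 
  assumes a: "a \<in> set_pmf \<mu>" and "h < h'"
  shows "hat [a] h < hat [a] h'"
proof -
  obtain l k where "\<And>h. hat l (hat [a] h) = h + of_int k"
    using hat_inverse[OF a] by metis
  then have "hat [a] h \<noteq> hat [a] h'" using assms(2) by (metis add_right_cancel less_irrefl)
  moreover have "hat [a] h \<le> hat [a] h'" using circle_fun_mono[OF circle_fun_hat[of "[a]"]] assms by simp
  ultimately show ?thesis by simp
qed

text \<open>Let \<open>p h\<close> be the first point of \<open>W\<close> to the right of \<open>h\<close>. As \<open>p\<close> commutes with the collapsed action, \<open>p \<circ> H\<close>
  is stationary as well, hence continuous, so that \<open>W\<close> has no gaps.\<close>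

lemma commutation_dichotomy:
  fixes d :: real
  defines "W \<equiv> {h. \<forall>l. set l \<subseteq> set_pmf \<mu> \<longrightarrow> hat l (h + d) = hat l h + d}"
  assumes "h0 \<in> W"
  shows "W = UNIV"
proof -
  have "W = (\<Inter>l\<in>{l. set l \<subseteq> set_pmf \<mu>}. {h. hat l (h + d) = hat l h + d})"
    by (auto simp: W_def)
  moreover have "closed {h. hat l (h + d) = hat l h + d}" if "set l \<subseteq> set_pmf \<mu>" for l
    by (intro closed_Collect_eq continuous_intros continuous_on_compose2[OF hat_cont[OF that]]) auto
  ultimately have W: "closed W" by auto
  have shift: "h + of_int k \<in> W" if "h \<in> W" for h k
  proof -
    have "hat l (h + of_int k + d) = hat l (h + of_int k) + d" if l: "set l \<subseteq> set_pmf \<mu>" for l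
      using \<open>h \<in> W\<close> l circle_fun_add_int[OF circle_fun_hat[OF l], of "h + d" k]
        circle_fun_add_int[OF circle_fun_hat[OF l], of h k]
      by (simp add: W_def add.commute add.left_commute)
    then show ?thesis by (simp add: W_def)
  qed
  have hatW: "hat [a] h \<in> W" if h: "h \<in> W" and a: "a \<in> set_pmf \<mu>" for a h
  proof -
    have "hat l (hat [a] h + d) = hat l (hat [a] h) + d" if l: "set l \<subseteq> set_pmf \<mu>" for l
    proof -
      have al: "set [a] \<subseteq> set_pmf \<mu>" "set (a # l) \<subseteq> set_pmf \<mu>" using a l by auto
      have "hat [a] h + d = hat [a] (h + d)" using h al(1) unfolding W_def by force
      then have "hat l (hat [a] h + d) = hat (a # l) (h + d)" using hat_Cons[OF al(2)] by simp
      also have "\<dots> = hat (a # l) h + d" using h al(2) unfolding W_def by force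
      finally show ?thesis using hat_Cons[OF al(2)] by simp
    qed
    then show ?thesis by (simp add: W_def)
  qed
  have hatW_word: "hat l h \<in> W" if "h \<in> W" "set l \<subseteq> set_pmf \<mu>" for l h
    using that
  proof (induction l arbitrary: h)
    case Nil then show ?case by (simp add: hat_def)
  next
    case (Cons a l) then show ?case using hatW[of h a] hat_Cons[of a l h] by simp
  qed
  \<comment> \<open>Invariance of \<open>W\<close> under inverses as well is needed for
    \<open>p\<close> to commute with the letters: a point of \<open>W\<close> reached after applying
    \<open>a\<close> must come from a point of \<open>W\<close>.\<close>
  have hatW_rev: "h \<in> W" if h: "hat [a] h \<in> W" and a: "a \<in> set_pmf \<mu>" for a h
  proof -
    obtain l k where l: "set l \<subseteq> set_pmf \<mu>" "\<And>h. hat l (hat [a] h) = h + of_int k"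
      using hat_inverse[OF a] by metis
    have "h + of_int k \<in> W" using hatW_word[OF h l(1)] l(2) by simp
    from shift[OF this, of "-k"] show ?thesis by simp
  qed
  define p where "p h = Inf (W \<inter> {h..})" for h
  have ne: "W \<inter> {h..} \<noteq> {}" for h
  proof -
    have "h0 + of_int \<lceil>h - h0\<rceil> \<in> W \<inter> {h..}" using shift[OF assms(2)] by (simp, linarith)
    then show ?thesis by blast
  qed
  have p_in: "p h \<in> W" "h \<le> p h" for h
  proof -
    have "p h \<in> W \<inter> {h..}" unfolding p_def
      by (intro closed_contains_Inf ne closed_Int W) (auto intro: bdd_belowI[of _ h])
    then show "p h \<in> W" "h \<le> p h" by auto
  qed
  have p_le: "p h \<le> w" if "w \<in> W" "h \<le> w" for h w
    unfolding p_def using that by (intro cInf_lower) (auto intro: bdd_belowI[of _ h])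
  have p_fun: "circle_fun p"
    unfolding circle_fun_def
  proof (intro conjI monoI allI antisym)
    show "p x \<le> p y" if "x \<le> y" for x y using p_le[OF p_in(1)[of y]] p_in(2)[of y] that by simp
    show "p (x + 1) \<le> p x + 1" for x using p_le[of "p x + 1" "x + 1"] shift[OF p_in(1), of x 1] p_in(2)[of x] by simp
    show "p x + 1 \<le> p (x + 1)" for x
      using p_le[of "p (x + 1) - 1" x] shift[OF p_in(1), of "x + 1" "-1"] p_in(2)[of "x + 1"] by simp
  qed
  have p_hat: "p (hat [a] h) = hat [a] (p h)" if a: "a \<in> set_pmf \<mu>" for a h
  proof (rule antisym)
    show "p (hat [a] h) \<le> hat [a] (p h)"
      by (rule p_le[OF hatW[OF p_in(1) a]]) (use circle_fun_mono[OF circle_fun_hat[of "[a]"] p_in(2)] a in simp)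
    obtain w where w: "hat [a] w = p (hat [a] h)" using hat_surj[of "[a]"] a by auto
    have "w \<in> W" by (rule hatW_rev[OF _ a]) (simp add: w p_in(1))
    moreover have "h \<le> w"
      using hat_strict[OF a, of w h] p_in(2)[of "hat [a] h"] w by force
    ultimately have "p h \<le> w" by (rule p_le)
    then show "hat [a] (p h) \<le> p (hat [a] h)"
      unfolding w[symmetric] by (intro circle_fun_mono[OF circle_fun_hat]) (use a in auto)
  qed
  have pH: "circle_fun (p \<circ> H)" by (rule circle_fun_compose[OF p_fun H_fun])
  \<comment> \<open>The right-hand side involves \<open>H\<close> at the image of a point of height
    \<open>p (H t)\<close>; increments of \<open>p \<circ> H\<close> thus become heights of images
    of another arc, to which stationarity of \<open>H\<close> applies.\<close>
  have pH_phi: "(p \<circ> H) (\<phi> a t) = H (\<phi> a (sec (p (H t))))" if a: "a \<in> set_pmf \<mu>" for a t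
    using p_hat[OF a, of "H t"] hat_H[of "[a]"] a by (simp add: hat_def)
  have "E (\<lambda>a. (p \<circ> H) (\<phi> a t) - (p \<circ> H) (\<phi> a s)) = (p \<circ> H) t - (p \<circ> H) s" for s t
  proof -
    have "E (\<lambda>a. (p \<circ> H) (\<phi> a t) - (p \<circ> H) (\<phi> a s)) = E (\<lambda>a. H (\<phi> a (sec (p (H t)))) - H (\<phi> a (sec (p (H s)))))"
      by (rule integral_cong_AE) (use pH_phi in \<open>auto simp: AE_measure_pmf_iff\<close>)
    then show ?thesis using H_stationary by simp
  qed
  then have "continuous_on UNIV (p \<circ> H)" by (rule stationary_continuous[OF pH])
  then have "\<exists>x. (p \<circ> H) x = h" for h by (rule circle_fun_surj[OF pH])
  then have "h \<in> W" for h using p_in(1) by (metis comp_apply)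
  then show ?thesis by blast
qed

text \<open>The bound \<open>c \<le> 1\<close> serves later: an arc whose height is below
  \<open>c\<close> is shorter than a full turn, so such arcs stay in a compact set modulo integer
  translations.\<close>

lemma spectral_gap:
  obtains c where "0 < c" "c \<le> 1"
    "\<And>x y. 0 < H y - H x \<Longrightarrow> H y - H x < c \<Longrightarrow>
      \<exists>l. set l \<subseteq> set_pmf \<mu> \<and> H (word \<phi> l y) - H (word \<phi> l x) \<noteq> H y - H x"
proof -
  have "\<exists>c. 0 < c \<and> c \<le> 1 \<and> (\<forall>x y. 0 < H y - H x \<and> H y - H x < c \<longrightarrow>
      (\<exists>l. set l \<subseteq> set_pmf \<mu> \<and> H (word \<phi> l y) - H (word \<phi> l x) \<noteq> H y - H x))"
  proof (rule ccontr)
    assume neg: "\<not> ?thesis"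
    have small: "\<exists>d. 0 < d \<and> d < e \<and> (\<forall>l. set l \<subseteq> set_pmf \<mu> \<longrightarrow> (\<forall>h. hat l (h + d) = hat l h + d))"
      if "e > 0" for e
    proof -
      have "0 < min e 1" "min e 1 \<le> 1" using that by auto
      then obtain x y where xy: "0 < H y - H x" "H y - H x < min e 1"
        "\<And>l. set l \<subseteq> set_pmf \<mu> \<Longrightarrow> H (word \<phi> l y) - H (word \<phi> l x) = H y - H x"
        using neg[unfolded not_ex, rule_format, of "min e 1"] by blast
      define d where "d = H y - H x"
      have "H x \<in> {h. \<forall>l. set l \<subseteq> set_pmf \<mu> \<longrightarrow> hat l (h + d) = hat l h + d}"
      proof (intro CollectI allI impI)
        fix l assume l: "set l \<subseteq> set_pmf \<mu>"
        have "H x + d = H y" by (simp add: d_def)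
        then show "hat l (H x + d) = hat l (H x) + d"
          using xy(3)[OF l] hat_H[OF l] by (simp add: d_def)
      qed
      from commutation_dichotomy[OF this] show ?thesis
        using xy by (intro exI[of _ d]) (auto simp: d_def)
    qed
    have tr: "hat [a] h' - hat [a] h = h' - h" if a: "a \<in> set_pmf \<mu>" "h \<le> h'" for a h h'
    proof (rule mono_translation[OF _ _ a(2)])
      show "mono (hat [a])" using circle_fun_hat[of "[a]"] a by (simp add: circle_fun_def)
      show "\<exists>d>0. d < e \<and> (\<forall>h. hat [a] (h + d) = hat [a] h + d)" if "e > 0" for e
        using small[OF that] a(1) by (metis empty_set empty_subsetI insert_subset list.simps(15))
    qed
    have "H (\<phi> a t) - H (\<phi> a s) = H t - H s" if a: "a \<in> set_pmf \<mu>" for a s t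
      using tr[OF a, of "H s" "H t"] tr[OF a, of "H t" "H s"] hat_H[of "[a]" t] hat_H[of "[a]" s] a
      by (cases "H s \<le> H t") auto
    then show False using no_inv[OF H_fun] by blast
  qed
  then show ?thesis using that by blast
qed

end

section \<open>Random walks\<close>

text \<open>Position after exactly \<open>n\<close> letters, starting with the identity;
  \<open>rwalk \<omega> n\<close> in contrast has \<open>n + 1\<close> letters.\<close>

primrec wk :: "('a \<Rightarrow> real \<Rightarrow> real) \<Rightarrow> (nat \<Rightarrow> 'a) \<Rightarrow> nat \<Rightarrow> real \<Rightarrow> real" where
  "wk \<phi> \<omega> 0 x = x"
| "wk \<phi> \<omega> (Suc n) x = \<phi> (\<omega> n) (wk \<phi> \<omega> n x)"

lemma abs_diff_le_twice: "\<bar>a\<bar> \<le> c \<Longrightarrow> \<bar>b\<bar> \<le> c \<Longrightarrow> \<bar>a - b\<bar> \<le> 2 * (c::real)"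
  by linarith

lemma wk_cong: "(\<And>i. i < n \<Longrightarrow> \<omega> i = \<omega>' i) \<Longrightarrow> wk \<phi> \<omega> n x = wk \<phi> \<omega>' n x"
  by (induction n) auto

lemma wk_comb_seq: "wk \<phi> (comb_seq n \<omega> \<omega>') n x = wk \<phi> \<omega> n x"
  by (rule wk_cong) (simp add: comb_seq_less)

lemma wk_comb_seq_add: "wk \<phi> (comb_seq n \<omega> \<omega>') (n + m) x = wk \<phi> \<omega>' m (wk \<phi> \<omega> n x)"
proof (induction m)
  case (Suc m)
  then show ?case using comb_seq_add[of n \<omega> \<omega>' m] by (simp add: add.commute)
qed (simp add: wk_comb_seq)

lemma circle_homeo_wk:
  assumes "\<And>a. circle_homeo (\<phi> a)"
  shows "circle_homeo (wk \<phi> \<omega> n)"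
proof (induction n)
  case 0
  have "wk \<phi> \<omega> 0 = (\<lambda>x. x)" by auto
  then show ?case using circle_homeo_id by (simp only:)
next
  case (Suc n)
  have "wk \<phi> \<omega> (Suc n) = \<phi> (\<omega> n) \<circ> wk \<phi> \<omega> n" by auto
  then show ?case using circle_homeo_compose[OF assms Suc] by (simp only:)
qed

section \<open>Product measure on paths and its Markov property\<close>

locale iid_sequence =
  fixes \<mu> :: "'a::countable pmf"
begin

sublocale seq: sequence_space "measure_pmf \<mu>"
  by unfold_locales

abbreviation P :: "(nat \<Rightarrow> 'a) measure" where
  "P \<equiv> PiM UNIV (\<lambda>_. measure_pmf \<mu>)"

lemma space_P [simp]: "space P = UNIV"
  by (simp add: space_PiM)

lemma prob_UNIV: "measure P UNIV = 1"
  using seq.P.prob_space by simp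

lemma coord_measurable: "(\<lambda>\<omega>. \<omega> n) \<in> measurable P (count_space UNIV)"
  using measurable_component_singleton[of n UNIV "\<lambda>_. measure_pmf \<mu>"]
    measurable_cong_sets[OF refl sets_measure_pmf_count_space[of \<mu>], of P] by simp

text \<open>A countable alphabet allows the index of a measurable family to be random.\<close>

lemma measurable_coord_fun:
  assumes "\<And>a. (\<lambda>\<omega>. f a \<omega>) \<in> measurable P N"
  shows "(\<lambda>\<omega>. f (\<omega> n) \<omega>) \<in> measurable P N"
  by (rule measurable_compose_countable[OF assms coord_measurable])

lemma integrable_bounded:
  fixes f :: "(nat \<Rightarrow> 'a) \<Rightarrow> real"
  assumes "f \<in> borel_measurable P" "\<And>\<omega>. \<bar>f \<omega>\<bar> \<le> B"
  shows "integrable P f"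
  by (rule seq.P.integrable_const_bound[of _ B]) (use assms in auto)

lemma comb_seq_measurable: "(\<lambda>p. comb_seq n (fst p) (snd p)) \<in> measurable (P \<Otimes>\<^sub>M P) P"
  using measurable_comb_seq[of n "measure_pmf \<mu>"] by (simp add: case_prod_beta')

text \<open>The Markov property: the first \<open>n\<close> letters followed by an independent path
  have the law of a path.\<close>

lemma integral_comb_seq:
  fixes f :: "(nat \<Rightarrow> 'a) \<Rightarrow> real"
  assumes f: "f \<in> borel_measurable P" "\<And>\<omega>. \<bar>f \<omega>\<bar> \<le> B"
  shows "(\<integral>\<omega>. f \<omega> \<partial>P) = (\<integral>\<omega>. (\<integral>\<omega>'. f (comb_seq n \<omega> \<omega>') \<partial>P) \<partial>P)"
    and "(\<lambda>\<omega>. \<integral>\<omega>'. f (comb_seq n \<omega> \<omega>') \<partial>P) \<in> borel_measurable P"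
proof -
  interpret PP: pair_prob_space P P ..
  have m: "(\<lambda>p. f (comb_seq n (fst p) (snd p))) \<in> borel_measurable (P \<Otimes>\<^sub>M P)"
    by (rule measurable_compose[OF comb_seq_measurable f(1)])
  have int: "integrable (P \<Otimes>\<^sub>M P) (\<lambda>p. f (comb_seq n (fst p) (snd p)))"
    by (rule PP.integrable_const_bound[of _ B]) (use m f(2) in auto)
  have "(\<integral>\<omega>. f \<omega> \<partial>P) = (\<integral>\<omega>. f \<omega> \<partial>(distr (P \<Otimes>\<^sub>M P) P (\<lambda>(\<omega>, \<omega>'). comb_seq n \<omega> \<omega>')))"
    by (simp add: seq.PiM_comb_seq)
  also have "\<dots> = (\<integral>p. f (comb_seq n (fst p) (snd p)) \<partial>(P \<Otimes>\<^sub>M P))"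
    by (subst integral_distr[OF measurable_comb_seq f(1)]) (simp add: case_prod_beta')
  also have "\<dots> = (\<integral>\<omega>. (\<integral>\<omega>'. f (comb_seq n \<omega> \<omega>') \<partial>P) \<partial>P)"
    using PP.integral_fst'[OF int] by simp
  finally show "(\<integral>\<omega>. f \<omega> \<partial>P) = (\<integral>\<omega>. (\<integral>\<omega>'. f (comb_seq n \<omega> \<omega>') \<partial>P) \<partial>P)" .
  show "(\<lambda>\<omega>. \<integral>\<omega>'. f (comb_seq n \<omega> \<omega>') \<partial>P) \<in> borel_measurable P"
    using seq.P.borel_measurable_lebesgue_integral[of "\<lambda>\<omega> \<omega>'. f (comb_seq n \<omega> \<omega>')" P] m
    by (simp add: case_prod_beta')
qed

lemma integral_coord:
  fixes g :: "'a \<Rightarrow> real"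
  shows "(\<integral>\<omega>. g (\<omega> n) \<partial>P) = measure_pmf.expectation \<mu> g"
proof -
  have "measure_pmf.expectation \<mu> g = (\<integral>a. g a \<partial>(distr P (measure_pmf \<mu>) (\<lambda>\<omega>. \<omega> n)))"
    by (subst seq.PiM_component) auto
  also have "\<dots> = (\<integral>\<omega>. g (\<omega> n) \<partial>P)"
    by (rule integral_distr) (auto intro: measurable_component_singleton)
  finally show ?thesis ..
qed

text \<open>The letter at time \<open>n\<close> is independent of the earlier letters, on which
  alone \<open>F\<close> depends, so it can be averaged first.\<close>

lemma integral_step:
  fixes F :: "(nat \<Rightarrow> 'a) \<Rightarrow> 'a \<Rightarrow> real"
  assumes m: "\<And>a. (\<lambda>\<omega>. F \<omega> a) \<in> borel_measurable P" and bd: "\<And>\<omega> a. \<bar>F \<omega> a\<bar> \<le> B"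
    and past: "\<And>\<omega> \<omega>' a. (\<And>i. i < n \<Longrightarrow> \<omega> i = \<omega>' i) \<Longrightarrow> F \<omega> a = F \<omega>' a"
  shows "(\<integral>\<omega>. F \<omega> (\<omega> n) \<partial>P) = (\<integral>\<omega>. measure_pmf.expectation \<mu> (F \<omega>) \<partial>P)"
    and "(\<lambda>\<omega>. measure_pmf.expectation \<mu> (F \<omega>)) \<in> borel_measurable P"
proof -
  have m': "(\<lambda>\<omega>. F \<omega> (\<omega> n)) \<in> borel_measurable P"
    by (rule measurable_coord_fun[of "\<lambda>a \<omega>. F \<omega> a", OF m])
  have "(\<integral>\<omega>'. F (comb_seq n \<omega> \<omega>') (comb_seq n \<omega> \<omega>' n) \<partial>P) = measure_pmf.expectation \<mu> (F \<omega>)" for \<omega>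
  proof -
    have "F (comb_seq n \<omega> \<omega>') (comb_seq n \<omega> \<omega>' n) = F \<omega> (\<omega>' 0)" for \<omega>'
      using past[of "comb_seq n \<omega> \<omega>'" \<omega>] comb_seq_add[of n \<omega> \<omega>' 0] by (simp add: comb_seq_less)
    then show ?thesis by (simp add: integral_coord)
  qed
  then show "(\<integral>\<omega>. F \<omega> (\<omega> n) \<partial>P) = (\<integral>\<omega>. measure_pmf.expectation \<mu> (F \<omega>) \<partial>P)"
    "(\<lambda>\<omega>. measure_pmf.expectation \<mu> (F \<omega>)) \<in> borel_measurable P"
    using integral_comb_seq[OF m' bd, of n] by simp_all
qed

text \<open>The series of the \<open>f n\<close> has finite expectation, hence converges almost
  surely.\<close>

lemma AE_tendsto_zero:
  fixes f :: "nat \<Rightarrow> (nat \<Rightarrow> 'a) \<Rightarrow> real"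
  assumes m: "\<And>n. f n \<in> borel_measurable P" and nn: "\<And>n \<omega>. 0 \<le> f n \<omega>" and bd: "\<And>n \<omega>. f n \<omega> \<le> B"
    and s: "summable (\<lambda>n. \<integral>\<omega>. f n \<omega> \<partial>P)"
  shows "AE \<omega> in P. (\<lambda>n. f n \<omega>) \<longlonglongrightarrow> 0"
proof -
  have int: "integrable P (f n)" for n
    by (rule integrable_bounded[where B=B]) (use m nn bd in auto)
  have "(\<integral>\<^sup>+\<omega>. (\<Sum>n. ennreal (f n \<omega>)) \<partial>P) = (\<Sum>n. \<integral>\<^sup>+\<omega>. ennreal (f n \<omega>) \<partial>P)"
    using m by (intro nn_integral_suminf) auto
  also have "\<dots> = (\<Sum>n. ennreal (\<integral>\<omega>. f n \<omega> \<partial>P))"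
    using nn by (subst nn_integral_eq_integral[OF int]) auto
  also have "\<dots> \<noteq> \<infinity>"
    using s nn by (simp add: suminf_ennreal2)
  finally have "AE \<omega> in P. (\<Sum>n. ennreal (f n \<omega>)) \<noteq> \<infinity>"
    using m by (intro nn_integral_PInf_AE) auto
  then show ?thesis
  proof eventually_elim
    case (elim \<omega>)
    then have "summable (\<lambda>n. f n \<omega>)"
      by (intro summable_suminf_not_top) (use nn in auto)
    then show ?case by (rule summable_LIMSEQ_zero)
  qed
qed

end

lemma continuous_borel: "continuous_on UNIV f \<Longrightarrow> (f :: real \<Rightarrow> real) \<in> borel_measurable borel"
  by (rule borel_measurable_continuous_onI)

context circle_walk
begin

sublocale iid_sequence \<mu> .

abbreviation W :: "(nat \<Rightarrow> 'a) \<Rightarrow> nat \<Rightarrow> real \<Rightarrow> real" where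
  "W \<equiv> wk \<phi>"

lemma W_homeo: "circle_homeo (W \<omega> n)"
  by (rule circle_homeo_wk[OF homeo])

lemma phi_measurable: "\<phi> a \<in> borel_measurable borel"
  using homeo[of a] by (simp add: circle_homeo_def continuous_borel)

lemma H_measurable: "H \<in> borel_measurable borel"
  by (rule continuous_borel[OF H_cont])

lemma word_measurable: "word \<phi> l \<in> borel_measurable borel"
  using word_homeo[of l] by (simp add: circle_homeo_def continuous_borel)

lemma W_measurable: "(\<lambda>\<omega>. W \<omega> n x) \<in> borel_measurable P"
proof (induction n)
  case (Suc n)
  have "(\<lambda>\<omega>. \<phi> (\<omega> n) (W \<omega> n x)) \<in> borel_measurable P"
    by (rule measurable_coord_fun[of "\<lambda>a \<omega>. \<phi> a (W \<omega> n x)"]) (rule measurable_compose[OF Suc phi_measurable])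
  then show ?case by simp
qed simp

section \<open>The martingale of heights and its increments\<close>

definition M :: "real \<Rightarrow> real \<Rightarrow> nat \<Rightarrow> (nat \<Rightarrow> 'a) \<Rightarrow> real" where
  "M x y n \<omega> = H (W \<omega> n y) - H (W \<omega> n x)"

lemma M_measurable: "M x y n \<in> borel_measurable P"
  unfolding M_def by (intro borel_measurable_diff measurable_compose[OF W_measurable H_measurable])

lemma HF_bound:
  assumes "circle_homeo F"
  shows "\<bar>H (F y) - H (F x)\<bar> \<le> \<bar>y - x\<bar> + 2"
  using circle_fun_abs_bound[OF H_fun, of "F y" "F x"] circle_fun_abs_bound[OF circle_homeo_fun[OF assms], of y x]
  by linarith

lemma M_bound: "\<bar>M x y n \<omega>\<bar> \<le> \<bar>y - x\<bar> + 2"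
  unfolding M_def by (rule HF_bound[OF W_homeo])

text \<open>The change of height that the letter \<open>a\<close> would cause after the word
  \<open>l\<close>.\<close>

definition dH :: "'a list \<Rightarrow> 'a \<Rightarrow> real \<Rightarrow> real \<Rightarrow> real" where
  "dH l a x y = (H (\<phi> a (word \<phi> l y)) - H (\<phi> a (word \<phi> l x))) - (H (word \<phi> l y) - H (word \<phi> l x))"

lemma dH_Cons: "dH (b # l) a x y = dH l a (\<phi> b x) (\<phi> b y)"
  by (simp add: dH_def)

lemma dH_measurable:
  assumes "f \<in> borel_measurable N" "g \<in> borel_measurable N"
  shows "(\<lambda>\<omega>. dH l a (f \<omega>) (g \<omega>)) \<in> borel_measurable N"
  unfolding dH_def
  by (intro borel_measurable_diff measurable_compose[OF _ H_measurable] measurable_compose[OF _ phi_measurable]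
      measurable_compose[OF _ word_measurable] assms)

lemma dH_bound:
  assumes F: "circle_homeo F"
  shows "\<bar>dH l a (F x) (F y)\<bar> \<le> 2 * (\<bar>y - x\<bar> + 2)"
proof -
  have "circle_homeo (\<phi> a \<circ> (word \<phi> l \<circ> F))" "circle_homeo (word \<phi> l \<circ> F)"
    by (intro circle_homeo_compose homeo word_homeo F)+
  from abs_diff_le_twice[OF HF_bound[OF this(1), of y x] HF_bound[OF this(2), of y x]]
  show ?thesis unfolding dH_def comp_def .
qed

text \<open>Both parts express stationarity of \<open>H\<close>; the first is orthogonality of
  martingale increments, and its right-hand side telescopes when summed over
  \<open>n\<close>.\<close>

lemma martingale:
  "(\<integral>\<omega>. (M x y (Suc n) \<omega> - M x y n \<omega>)\<^sup>2 \<partial>P) = (\<integral>\<omega>. (M x y (Suc n) \<omega>)\<^sup>2 \<partial>P) - (\<integral>\<omega>. (M x y n \<omega>)\<^sup>2 \<partial>P)"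
  "(\<integral>\<omega>. M x y n \<omega> \<partial>P) = H y - H x"
proof -
  define B where "B = \<bar>y - x\<bar> + 2"
  have B: "\<bar>M x y n \<omega>\<bar> \<le> B" "B \<ge> 0" for n \<omega> unfolding B_def using M_bound by auto
  let ?F = "\<lambda>n \<omega> a. H (\<phi> a (W \<omega> n y)) - H (\<phi> a (W \<omega> n x))"
  have F: "M x y (Suc n) \<omega> = ?F n \<omega> (\<omega> n)" for n \<omega> by (simp add: M_def)
  have EF: "E (?F n \<omega>) = M x y n \<omega>" for n \<omega> unfolding M_def by (rule H_stationary)
  have Fm: "(\<lambda>\<omega>. ?F n \<omega> a) \<in> borel_measurable P" for n a
    by (intro borel_measurable_diff measurable_compose[OF _ H_measurable] measurable_compose[OF _ phi_measurable] W_measurable)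
  have Fb: "\<bar>?F n \<omega> a\<bar> \<le> B" for n \<omega> a
    unfolding B_def using HF_bound[OF circle_homeo_compose[OF homeo W_homeo], of a \<omega> n y x] by simp
  have past: "W \<omega> n z = W \<omega>' n z" if "\<And>i. i < n \<Longrightarrow> \<omega> i = \<omega>' i" for \<omega> \<omega>' n z
    by (rule wk_cong[OF that])
  have "(\<integral>\<omega>. M x y (Suc n) \<omega> \<partial>P) = (\<integral>\<omega>. M x y n \<omega> \<partial>P)" for n
  proof -
    have "(\<integral>\<omega>. M x y (Suc n) \<omega> \<partial>P) = (\<integral>\<omega>. (\<lambda>\<omega> a. ?F n \<omega> a) \<omega> (\<omega> n) \<partial>P)" by (simp only: F)
    also have "\<dots> = (\<integral>\<omega>. E (?F n \<omega>) \<partial>P)"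
    proof (rule integral_step(1)[OF Fm Fb])
      show "?F n \<omega> a = ?F n \<omega>' a" if "\<And>i. i < n \<Longrightarrow> \<omega> i = \<omega>' i" for \<omega> \<omega>' a
        using past[OF that] by (simp only:)
    qed
    finally show ?thesis by (simp only: EF)
  qed
  then show "(\<integral>\<omega>. M x y n \<omega> \<partial>P) = H y - H x"
  proof (induction n)
    case 0
    have "M x y 0 = (\<lambda>\<omega>. H y - H x)" by (rule ext) (simp add: M_def)
    then show ?case by (simp add: prob_UNIV)
  qed simp
  have int: "integrable P (\<lambda>\<omega>. M x y i \<omega> * M x y j \<omega>)" for i j
  proof (rule integrable_bounded)
    show "(\<lambda>\<omega>. M x y i \<omega> * M x y j \<omega>) \<in> borel_measurable P" by (intro borel_measurable_times M_measurable)
    show "\<bar>M x y i \<omega> * M x y j \<omega>\<bar> \<le> B * B" for \<omega>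
      unfolding abs_mult by (intro mult_mono B) auto
  qed
  have cross: "(\<integral>\<omega>. M x y (Suc n) \<omega> * M x y n \<omega> \<partial>P) = (\<integral>\<omega>. M x y n \<omega> * M x y n \<omega> \<partial>P)"
  proof -
    have "(\<integral>\<omega>. M x y (Suc n) \<omega> * M x y n \<omega> \<partial>P) = (\<integral>\<omega>. (\<lambda>\<omega> a. ?F n \<omega> a * M x y n \<omega>) \<omega> (\<omega> n) \<partial>P)"
      by (simp add: F)
    also have "\<dots> = (\<integral>\<omega>. E (\<lambda>a. ?F n \<omega> a * M x y n \<omega>) \<partial>P)"
    proof (rule integral_step(1))
      show "(\<lambda>\<omega>. ?F n \<omega> a * M x y n \<omega>) \<in> borel_measurable P" for a
        by (intro borel_measurable_times M_measurable Fm)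
      show "\<bar>?F n \<omega> a * M x y n \<omega>\<bar> \<le> B * B" for \<omega> a
        unfolding abs_mult by (intro mult_mono B Fb) auto
      show "?F n \<omega> a * M x y n \<omega> = ?F n \<omega>' a * M x y n \<omega>'" if "\<And>i. i < n \<Longrightarrow> \<omega> i = \<omega>' i" for \<omega> \<omega>' a
        using past[OF that] by (simp add: M_def)
    qed
    also have "\<dots> = (\<integral>\<omega>. M x y n \<omega> * M x y n \<omega> \<partial>P)"
      by (simp only: integral_mult_left_zero EF)
    finally show ?thesis .
  qed
  have "(\<integral>\<omega>. (M x y (Suc n) \<omega> - M x y n \<omega>)\<^sup>2 \<partial>P)
      = (\<integral>\<omega>. M x y (Suc n) \<omega> * M x y (Suc n) \<omega> - 2 * (M x y (Suc n) \<omega> * M x y n \<omega>) + M x y n \<omega> * M x y n \<omega> \<partial>P)"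
    by (rule Bochner_Integration.integral_cong) (auto simp: power2_eq_square algebra_simps)
  also have "\<dots> = (\<integral>\<omega>. M x y (Suc n) \<omega> * M x y (Suc n) \<omega> \<partial>P) - 2 * (\<integral>\<omega>. M x y (Suc n) \<omega> * M x y n \<omega> \<partial>P)
       + (\<integral>\<omega>. M x y n \<omega> * M x y n \<omega> \<partial>P)"
    using int by simp
  finally show "(\<integral>\<omega>. (M x y (Suc n) \<omega> - M x y n \<omega>)\<^sup>2 \<partial>P) = (\<integral>\<omega>. (M x y (Suc n) \<omega>)\<^sup>2 \<partial>P) - (\<integral>\<omega>. (M x y n \<omega>)\<^sup>2 \<partial>P)"
    unfolding cross power2_eq_square by simp
qed

lemma summable_increments: "summable (\<lambda>n. \<integral>\<omega>. (M x y (Suc n) \<omega> - M x y n \<omega>)\<^sup>2 \<partial>P)"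
proof (rule summableI_nonneg_bounded)
  show "0 \<le> (\<integral>\<omega>. (M x y (Suc n) \<omega> - M x y n \<omega>)\<^sup>2 \<partial>P)" for n by simp
  fix n
  have "(\<Sum>i<n. \<integral>\<omega>. (M x y (Suc i) \<omega> - M x y i \<omega>)\<^sup>2 \<partial>P) = (\<integral>\<omega>. (M x y n \<omega>)\<^sup>2 \<partial>P) - (\<integral>\<omega>. (M x y 0 \<omega>)\<^sup>2 \<partial>P)"
    unfolding martingale by (rule sum_lessThan_telescope)
  also have "\<dots> \<le> (\<integral>\<omega>. (M x y n \<omega>)\<^sup>2 \<partial>P)" by simp
  also have "\<dots> \<le> (\<integral>\<omega>. (\<bar>y - x\<bar> + 2)\<^sup>2 \<partial>P)"
  proof (rule integral_mono)
    have b: "(M x y n \<omega>)\<^sup>2 \<le> (\<bar>y - x\<bar> + 2)\<^sup>2" for \<omega>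
      using M_bound[of x y n \<omega>] by (intro abs_le_square_iff[THEN iffD1]) simp
    then show "(M x y n \<omega>)\<^sup>2 \<le> (\<bar>y - x\<bar> + 2)\<^sup>2" for \<omega> .
    show "integrable P (\<lambda>\<omega>. (M x y n \<omega>)\<^sup>2)"
      by (rule integrable_bounded[where B="(\<bar>y - x\<bar> + 2)\<^sup>2"]) (use b in \<open>auto intro: borel_measurable_power M_measurable\<close>)
  qed simp
  also have "\<dots> = (\<bar>y - x\<bar> + 2)\<^sup>2" by (simp add: prob_UNIV)
  finally show "(\<Sum>i<n. \<integral>\<omega>. (M x y (Suc i) \<omega> - M x y i \<omega>)\<^sup>2 \<partial>P) \<le> (\<bar>y - x\<bar> + 2)\<^sup>2" .
qed

lemma integral_step_ge:
  assumes m: "\<And>b. (\<lambda>\<omega>. F \<omega> b) \<in> borel_measurable P" and bd: "\<And>\<omega> b. F \<omega> b \<le> B"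
    and nn: "\<And>\<omega> b. 0 \<le> F \<omega> b"
    and past: "\<And>\<omega> \<omega>' b. (\<And>i. i < n \<Longrightarrow> \<omega> i = \<omega>' i) \<Longrightarrow> F \<omega> b = F \<omega>' b"
  shows "pmf \<mu> a * (\<integral>\<omega>. F \<omega> a \<partial>P) \<le> (\<integral>\<omega>. F \<omega> (\<omega> n) \<partial>P)"
proof -
  have bd': "\<bar>F \<omega> b\<bar> \<le> B" for \<omega> b using nn bd by simp
  have "pmf \<mu> a * (\<integral>\<omega>. F \<omega> a \<partial>P) = (\<integral>\<omega>. pmf \<mu> a * F \<omega> a \<partial>P)" by simp
  also have "\<dots> \<le> (\<integral>\<omega>. E (F \<omega>) \<partial>P)"
  proof (rule integral_mono)
    show "integrable P (\<lambda>\<omega>. pmf \<mu> a * F \<omega> a)"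
      by (intro integrable_mult_right integrable_bounded[OF m bd'])
    show "integrable P (\<lambda>\<omega>. E (F \<omega>))"
    proof (rule integrable_bounded[OF integral_step(2)[OF m bd' past]])
      show "\<bar>E (F \<omega>)\<bar> \<le> B" for \<omega>
        using bd nn by (subst abs_of_nonneg) (auto intro!: measure_pmf.integral_le_const integrable_pmf_bounded[OF bd'])
    qed
    show "pmf \<mu> a * F \<omega> a \<le> E (F \<omega>)" for \<omega>
    proof -
      have "pmf \<mu> a * F \<omega> a = E (\<lambda>b. indicator {a} b * F \<omega> a)"
        by (simp add: pmf.rep_eq)
      also have "\<dots> \<le> E (F \<omega>)"
      proof (rule integral_mono)
        show "integrable (measure_pmf \<mu>) (F \<omega>)" by (rule integrable_pmf_bounded[OF bd'])
        show "integrable (measure_pmf \<mu>) (\<lambda>b. indicator {a} b * F \<omega> a)"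
          by (rule integrable_pmf_bounded[where B="F \<omega> a"]) (use nn in \<open>auto simp: indicator_def\<close>)
        show "indicator {a} b * F \<omega> a \<le> F \<omega> b" for b
          using nn by (auto simp: indicator_def)
      qed
      finally show ?thesis .
    qed
  qed
  also have "\<dots> = (\<integral>\<omega>. F \<omega> (\<omega> n) \<partial>P)" by (rule integral_step(1)[OF m bd' past, symmetric])
  finally show ?thesis .
qed

text \<open>The walk follows \<open>l\<close> and then \<open>a\<close> with a fixed positive
  probability, so these hypothetical increments are controlled by actual later ones. The induction
  removes the first letter of \<open>l\<close> and advances the time by one.\<close>

lemma summable_dH:
  assumes "set l \<subseteq> set_pmf \<mu>" "a \<in> set_pmf \<mu>"
  shows "summable (\<lambda>n. \<integral>\<omega>. (dH l a (W \<omega> n x) (W \<omega> n y))\<^sup>2 \<partial>P)"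
proof -
  define B where "B = (2 * (\<bar>y - x\<bar> + 2))\<^sup>2"
  have bd: "(dH l a (W \<omega> n x) (W \<omega> n y))\<^sup>2 \<le> B" for l a \<omega> n
    using dH_bound[OF W_homeo, of l a \<omega> n x y] unfolding B_def by (intro abs_le_square_iff[THEN iffD1]) simp
  have bd': "(dH l a (\<phi> b (W \<omega> n x)) (\<phi> b (W \<omega> n y)))\<^sup>2 \<le> B" for l a b \<omega> n
    using dH_bound[OF circle_homeo_compose[OF homeo W_homeo], of l a b \<omega> n x y] unfolding B_def
    by (intro abs_le_square_iff[THEN iffD1]) simp
  have meas: "(\<lambda>\<omega>. (dH l a (W \<omega> n x) (W \<omega> n y))\<^sup>2) \<in> borel_measurable P" for l a n
    by (intro borel_measurable_power dH_measurable W_measurable)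
  have meas': "(\<lambda>\<omega>. (dH l a (\<phi> b (W \<omega> n x)) (\<phi> b (W \<omega> n y)))\<^sup>2) \<in> borel_measurable P" for l a b n
    by (intro borel_measurable_power dH_measurable measurable_compose[OF W_measurable phi_measurable])
  have past: "W \<omega> n z = W \<omega>' n z" if "\<And>i. i < n \<Longrightarrow> \<omega> i = \<omega>' i" for \<omega> \<omega>' n z
    by (rule wk_cong[OF that])
  show ?thesis
    using assms
  proof (induction l)
    case Nil
    then have pos: "pmf \<mu> a > 0" by (simp add: pmf_positive)
    have "pmf \<mu> a * (\<integral>\<omega>. (dH [] a (W \<omega> n x) (W \<omega> n y))\<^sup>2 \<partial>P) \<le> (\<integral>\<omega>. (M x y (Suc n) \<omega> - M x y n \<omega>)\<^sup>2 \<partial>P)" for n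
    proof -
      have "(M x y (Suc n) \<omega> - M x y n \<omega>)\<^sup>2 = (\<lambda>\<omega> b. (dH [] b (W \<omega> n x) (W \<omega> n y))\<^sup>2) \<omega> (\<omega> n)" for \<omega>
        by (simp add: M_def dH_def)
      moreover have "pmf \<mu> a * (\<integral>\<omega>. (\<lambda>\<omega> b. (dH [] b (W \<omega> n x) (W \<omega> n y))\<^sup>2) \<omega> a \<partial>P)
          \<le> (\<integral>\<omega>. (\<lambda>\<omega> b. (dH [] b (W \<omega> n x) (W \<omega> n y))\<^sup>2) \<omega> (\<omega> n) \<partial>P)"
      proof (rule integral_step_ge[OF meas bd])
        show "(dH [] b (W \<omega> n x) (W \<omega> n y))\<^sup>2 = (dH [] b (W \<omega>' n x) (W \<omega>' n y))\<^sup>2"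
          if "\<And>i. i < n \<Longrightarrow> \<omega> i = \<omega>' i" for \<omega> \<omega>' b
          using past[OF that] by (simp only:)
      qed simp
      ultimately show ?thesis by (simp only:)
    qed
    then have "summable (\<lambda>n. pmf \<mu> a * (\<integral>\<omega>. (dH [] a (W \<omega> n x) (W \<omega> n y))\<^sup>2 \<partial>P))"
      by (intro summable_comparison_test'[OF summable_increments[of x y]]) auto
    then show ?case using pos by (elim summable_mult_D) simp
  next
    case (Cons b l)
    then have pos: "pmf \<mu> b > 0" by (simp add: pmf_positive)
    have "pmf \<mu> b * (\<integral>\<omega>. (dH (b # l) a (W \<omega> n x) (W \<omega> n y))\<^sup>2 \<partial>P) \<le> (\<integral>\<omega>. (dH l a (W \<omega> (Suc n) x) (W \<omega> (Suc n) y))\<^sup>2 \<partial>P)" for n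
    proof -
      have "pmf \<mu> b * (\<integral>\<omega>. (\<lambda>\<omega> b. (dH l a (\<phi> b (W \<omega> n x)) (\<phi> b (W \<omega> n y)))\<^sup>2) \<omega> b \<partial>P)
          \<le> (\<integral>\<omega>. (\<lambda>\<omega> b. (dH l a (\<phi> b (W \<omega> n x)) (\<phi> b (W \<omega> n y)))\<^sup>2) \<omega> (\<omega> n) \<partial>P)"
      proof (rule integral_step_ge[OF meas' bd'])
        show "(dH l a (\<phi> b (W \<omega> n x)) (\<phi> b (W \<omega> n y)))\<^sup>2 = (dH l a (\<phi> b (W \<omega>' n x)) (\<phi> b (W \<omega>' n y)))\<^sup>2"
          if "\<And>i. i < n \<Longrightarrow> \<omega> i = \<omega>' i" for \<omega> \<omega>' b
          using past[OF that] by (simp only:)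
      qed simp
      then show ?thesis unfolding dH_Cons wk.simps .
    qed
    moreover have "summable (\<lambda>n. \<integral>\<omega>. (dH l a (W \<omega> (Suc n) x) (W \<omega> (Suc n) y))\<^sup>2 \<partial>P)"
      using Cons by (subst summable_Suc_iff) simp
    ultimately have "summable (\<lambda>n. pmf \<mu> b * (\<integral>\<omega>. (dH (b # l) a (W \<omega> n x) (W \<omega> n y))\<^sup>2 \<partial>P))"
      by (intro summable_comparison_test'[OF \<open>summable (\<lambda>n. \<integral>\<omega>. (dH l a (W \<omega> (Suc n) x) (W \<omega> (Suc n) y))\<^sup>2 \<partial>P)\<close>]) auto
    then show ?case using pos by (elim summable_mult_D) simp
  qed
qed

lemma AE_dH:
  "AE \<omega> in P. \<forall>l a. set l \<subseteq> set_pmf \<mu> \<longrightarrow> a \<in> set_pmf \<mu> \<longrightarrow> (\<lambda>n. dH l a (W \<omega> n x) (W \<omega> n y)) \<longlonglongrightarrow> 0"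
proof (unfold AE_all_countable, intro allI)
  fix l a
  show "AE \<omega> in P. set l \<subseteq> set_pmf \<mu> \<longrightarrow> a \<in> set_pmf \<mu> \<longrightarrow> (\<lambda>n. dH l a (W \<omega> n x) (W \<omega> n y)) \<longlonglongrightarrow> 0"
  proof (cases "set l \<subseteq> set_pmf \<mu> \<and> a \<in> set_pmf \<mu>")
    case True
    have "AE \<omega> in P. (\<lambda>n. (dH l a (W \<omega> n x) (W \<omega> n y))\<^sup>2) \<longlonglongrightarrow> 0"
    proof (rule AE_tendsto_zero[where B="(2 * (\<bar>y - x\<bar> + 2))\<^sup>2"])
      show "(dH l a (W \<omega> n x) (W \<omega> n y))\<^sup>2 \<le> (2 * (\<bar>y - x\<bar> + 2))\<^sup>2" for \<omega> n
        using dH_bound[OF W_homeo, of l a \<omega> n x y] by (intro abs_le_square_iff[THEN iffD1]) simp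
      show "summable (\<lambda>n. \<integral>\<omega>. (dH l a (W \<omega> n x) (W \<omega> n y))\<^sup>2 \<partial>P)"
        using True by (intro summable_dH) auto
    qed (auto intro!: borel_measurable_power dH_measurable W_measurable)
    then show ?thesis
      by eventually_elim (auto dest!: tendsto_real_sqrt intro: tendsto_rabs_zero_cancel)
  qed auto
qed

lemma AE_increments: "AE \<omega> in P. (\<lambda>n. M x y (Suc n) \<omega> - M x y n \<omega>) \<longlonglongrightarrow> 0"
proof -
  have "AE \<omega> in P. (\<lambda>n. (M x y (Suc n) \<omega> - M x y n \<omega>)\<^sup>2) \<longlonglongrightarrow> 0"
  proof (rule AE_tendsto_zero[where B="(2 * (\<bar>y - x\<bar> + 2))\<^sup>2"])
    show "(M x y (Suc n) \<omega> - M x y n \<omega>)\<^sup>2 \<le> (2 * (\<bar>y - x\<bar> + 2))\<^sup>2" for \<omega> n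
    proof -
      have "\<bar>M x y (Suc n) \<omega> - M x y n \<omega>\<bar> \<le> \<bar>2 * (\<bar>y - x\<bar> + 2)\<bar>"
        using abs_diff_le_twice[OF M_bound M_bound] by simp
      then show ?thesis by (rule abs_le_square_iff[THEN iffD1])
    qed
    show "summable (\<lambda>n. \<integral>\<omega>. (M x y (Suc n) \<omega> - M x y n \<omega>)\<^sup>2 \<partial>P)" by (rule summable_increments)
  qed (auto intro!: borel_measurable_power borel_measurable_diff M_measurable)
  then show ?thesis
    by eventually_elim (auto dest!: tendsto_real_sqrt intro: tendsto_rabs_zero_cancel)
qed

end

section \<open>Contracted and expanded arcs\<close>

text \<open>Distance less than \<open>r\<close> between the projections of two points to the circle
  of length 1.\<close>

definition near :: "real \<Rightarrow> real \<Rightarrow> real \<Rightarrow> bool" where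
  "near x z r \<longleftrightarrow> (\<exists>k::int. \<bar>x - z - of_int k\<bar> < r)"

lemma near_mono: "near x z r \<Longrightarrow> r \<le> r' \<Longrightarrow> near x z r'"
  unfolding near_def by (meson less_le_trans)

text \<open>Steps shorter than \<open>g / 2\<close> cannot cross the band from \<open>g / 2\<close>
  to \<open>g\<close>, which is eventually avoided. A sequence that stays below it is pushed to 0 by
  the bands with smaller \<open>\<eta>\<close>.\<close>

lemma zero_or_large:
  fixes m :: "nat \<Rightarrow> real"
  assumes g: "0 < g" and nn: "\<And>n. 0 \<le> m n" and inc: "(\<lambda>n. m (Suc n) - m n) \<longlonglongrightarrow> 0"
    and av: "\<And>\<eta>. 0 < \<eta> \<Longrightarrow> eventually (\<lambda>n. \<not> (\<eta> \<le> m n \<and> m n \<le> g)) sequentially"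
  shows "m \<longlonglongrightarrow> 0 \<or> (\<exists>N. \<forall>n\<ge>N. g \<le> m n)"
proof -
  have "eventually (\<lambda>n. \<bar>m (Suc n) - m n\<bar> < g / 2) sequentially"
    using tendstoD[OF inc, of "g / 2"] g by (simp add: dist_real_def)
  moreover have "eventually (\<lambda>n. \<not> (g / 2 \<le> m n \<and> m n \<le> g)) sequentially" using av[of "g / 2"] g by simp
  ultimately have "eventually (\<lambda>n. \<bar>m (Suc n) - m n\<bar> < g / 2 \<and> \<not> (g / 2 \<le> m n \<and> m n \<le> g)) sequentially"
    by (rule eventually_conj)
  then obtain N where N: "\<And>n. n \<ge> N \<Longrightarrow> \<bar>m (Suc n) - m n\<bar> < g / 2" "\<And>n. n \<ge> N \<Longrightarrow> m n < g / 2 \<or> g < m n"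
    unfolding eventually_sequentially by force
  show ?thesis
  proof (cases "\<exists>n\<ge>N. g < m n")
    case True
    then obtain n0 where n0: "n0 \<ge> N" "g < m n0" by blast
    have "g < m (n0 + k)" for k
    proof (induction k)
      case (Suc k)
      have "\<bar>m (Suc (n0 + k)) - m (n0 + k)\<bar> < g / 2" "m (Suc (n0 + k)) < g / 2 \<or> g < m (Suc (n0 + k))"
        using N n0 by auto
      then show ?case using Suc by (simp only: add_Suc_right) linarith
    qed (use n0 in simp)
    then have "\<forall>n\<ge>n0. g \<le> m n" by (metis le_Suc_ex less_imp_le)
    then show ?thesis by blast
  next
    case False
    then have small: "m n < g / 2" if "n \<ge> N" for n using N(2) that by blast
    have "m \<longlonglongrightarrow> 0"
    proof (rule tendstoI)
      fix e :: real assume "e > 0"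
      show "eventually (\<lambda>n. dist (m n) 0 < e) sequentially"
        using av[OF \<open>e > 0\<close>] eventually_ge_at_top[of N]
      proof eventually_elim
        case (elim n)
        then show ?case using small[of n] nn[of n] g by auto
      qed
    qed
    then show ?thesis ..
  qed
qed

context circle_walk
begin

section \<open>The dichotomy for the height of an arc\<close>

definition gap :: real where
  "gap = (SOME c. 0 < c \<and> c \<le> 1 \<and> (\<forall>x y. 0 < H y - H x \<longrightarrow> H y - H x < c \<longrightarrow>
      (\<exists>l. set l \<subseteq> set_pmf \<mu> \<and> H (word \<phi> l y) - H (word \<phi> l x) \<noteq> H y - H x)))"

lemma gap_props: "0 < gap \<and> gap \<le> 1 \<and> (\<forall>x y. 0 < H y - H x \<longrightarrow> H y - H x < gap \<longrightarrow>
      (\<exists>l. set l \<subseteq> set_pmf \<mu> \<and> H (word \<phi> l y) - H (word \<phi> l x) \<noteq> H y - H x))"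
  unfolding gap_def
proof (rule someI_ex, rule spectral_gap)
  fix c :: real assume "0 < c" "c \<le> 1" "\<And>x y. 0 < H y - H x \<Longrightarrow> H y - H x < c \<Longrightarrow>
      \<exists>l. set l \<subseteq> set_pmf \<mu> \<and> H (word \<phi> l y) - H (word \<phi> l x) \<noteq> H y - H x"
  then show "\<exists>c>0. c \<le> 1 \<and> (\<forall>x y. 0 < H y - H x \<longrightarrow> H y - H x < c \<longrightarrow>
      (\<exists>l. set l \<subseteq> set_pmf \<mu> \<and> H (word \<phi> l y) - H (word \<phi> l x) \<noteq> H y - H x))"
    by (intro exI[of _ c] conjI allI impI)
qed

lemma gap_pos: "0 < gap" and gap_le_1: "gap \<le> 1"
  using gap_props by blast+

lemma dH_shift: "dH l a (x + of_int k) (y + of_int k) = dH l a x y"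
  unfolding dH_def circle_fun_add_int[OF circle_homeo_fun[OF word_homeo]] circle_fun_add_int[OF phi_fun] H_add_int
  by simp

lemma H_isCont: "isCont H x"
  using H_cont by (simp add: continuous_on_eq_continuous_at)

lemma dH_tendsto:
  assumes "(f \<longlongrightarrow> x) F" "(g \<longlongrightarrow> y) F"
  shows "((\<lambda>n. dH l a (f n) (g n)) \<longlongrightarrow> dH l a x y) F"
  unfolding dH_def
  by (intro tendsto_diff isCont_tendsto_compose[OF H_isCont] isCont_tendsto_compose[OF circle_homeo_isCont[OF homeo]]
      isCont_tendsto_compose[OF circle_homeo_isCont[OF word_homeo]] assms)

lemma word_invariant_height:
  assumes "\<And>l a. set l \<subseteq> set_pmf \<mu> \<Longrightarrow> a \<in> set_pmf \<mu> \<Longrightarrow> dH l a x y = 0" "set l \<subseteq> set_pmf \<mu>"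
  shows "H (word \<phi> l y) - H (word \<phi> l x) = H y - H x"
  using assms(2)
proof (induction l rule: rev_induct)
  case (snoc a l)
  then show ?case using assms(1)[of l a] by (simp add: word_append dH_def)
qed simp

text \<open>An accumulation point of the arcs, modulo integer translations, would contradict the choice of \<open>gap\<close>.\<close>

lemma eventually_avoid:
  fixes X Y :: "nat \<Rightarrow> real"
  assumes XY: "\<And>n. X n \<le> Y n" and \<eta>: "0 < \<eta>"
    and d: "\<And>l a. set l \<subseteq> set_pmf \<mu> \<Longrightarrow> a \<in> set_pmf \<mu> \<Longrightarrow> (\<lambda>n. dH l a (X n) (Y n)) \<longlonglongrightarrow> 0"
  shows "eventually (\<lambda>n. \<not> (\<eta> \<le> H (Y n) - H (X n) \<and> H (Y n) - H (X n) \<le> gap / 2)) sequentially"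
proof (rule ccontr)
  let ?S = "{n. \<eta> \<le> H (Y n) - H (X n) \<and> H (Y n) - H (X n) \<le> gap / 2}"
  assume "\<not> ?thesis"
  then have "infinite ?S"
    unfolding cofinite_eq_sequentially[symmetric] eventually_cofinite by simp
  then obtain r :: "nat \<Rightarrow> nat" where r: "strict_mono r" "\<And>n. r n \<in> ?S"
    using infinite_enumerate by blast
  define k where "k n = \<lfloor>X (r n)\<rfloor>" for n
  define x where "x n = X (r n) - of_int (k n)" for n
  define y where "y n = Y (r n) - of_int (k n)" for n
  have Hxy: "H (y n) - H (x n) = H (Y (r n)) - H (X (r n))" for n
    using H_add_int[of "x n" "k n"] H_add_int[of "y n" "k n"] by (simp add: x_def y_def)
  have YX: "Y (r n) < X (r n) + 1" for n
  proof (rule ccontr)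
    assume "\<not> Y (r n) < X (r n) + 1"
    then have "H (X (r n) + 1) \<le> H (Y (r n))" by (intro H_mono) simp
    then show False using r(2)[of n] H_add_int[of "X (r n)" 1] gap_le_1 by simp
  qed
  then have box: "(x n, y n) \<in> {0..1} \<times> {0..2}" for n
  proof -
    have "0 \<le> x n" "x n \<le> 1" "0 \<le> y n" "y n \<le> 2"
      using XY[of "r n"] YX[of n] unfolding x_def y_def k_def by linarith+
    then show ?thesis by simp
  qed
  have "compact ({0..1} \<times> {0..2::real} :: (real \<times> real) set)" by (intro compact_Times compact_Icc)
  then obtain l s where l: "strict_mono s" "((\<lambda>n. (x n, y n)) \<circ> s) \<longlonglongrightarrow> l"
    using box unfolding compact_eq_seq_compact_metric seq_compact_def by meson
  obtain a b where ab: "l = (a, b)" by (cases l)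
  have xl: "(\<lambda>n. x (s n)) \<longlonglongrightarrow> a" and yl: "(\<lambda>n. y (s n)) \<longlonglongrightarrow> b"
    using tendsto_fst[OF l(2)] tendsto_snd[OF l(2)] by (simp_all add: ab comp_def)
  have "dH w c a b = 0" if w: "set w \<subseteq> set_pmf \<mu>" "c \<in> set_pmf \<mu>" for w c
  proof -
    have "(\<lambda>n. dH w c (x (s n)) (y (s n))) \<longlonglongrightarrow> dH w c a b" by (rule dH_tendsto[OF xl yl])
    moreover have "dH w c (x n) (y n) = dH w c (X (r n)) (Y (r n))" for n
      using dH_shift[of w c "x n" "k n" "y n"] by (simp add: x_def y_def)
    moreover have "(\<lambda>n. dH w c (X (r (s n))) (Y (r (s n)))) \<longlonglongrightarrow> 0"
      using LIMSEQ_subseq_LIMSEQ[OF LIMSEQ_subseq_LIMSEQ[OF d[OF w] r(1)] l(1)] by (simp add: comp_def)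
    ultimately show ?thesis using LIMSEQ_unique by simp
  qed
  then have const: "H (word \<phi> w b) - H (word \<phi> w a) = H b - H a" if "set w \<subseteq> set_pmf \<mu>" for w
    using word_invariant_height[OF _ that] by blast
  have lim: "(\<lambda>n. H (y (s n)) - H (x (s n))) \<longlonglongrightarrow> H b - H a"
    by (intro tendsto_diff isCont_tendsto_compose[OF H_isCont] xl yl)
  have "\<eta> \<le> H b - H a"
    by (rule tendsto_lowerbound[OF lim]) (use r(2) Hxy in auto)
  moreover have "H b - H a \<le> gap / 2"
    by (rule tendsto_upperbound[OF lim]) (use r(2) Hxy in auto)
  \<comment> \<open>The limit preserves only the weak bound; working with \<open>gap / 2\<close>
    leaves room for the strict one.\<close>
  ultimately have "0 < H b - H a" "H b - H a < gap" using \<eta> gap_pos by linarith+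
  then obtain w where "set w \<subseteq> set_pmf \<mu>" "H (word \<phi> w b) - H (word \<phi> w a) \<noteq> H b - H a"
    using gap_props by blast
  with const show False by blast
qed

text \<open>These are the repelling arcs: their images keep a definite share of the total height
  1.\<close>

definition bad :: "real \<Rightarrow> real \<Rightarrow> (nat \<Rightarrow> 'a) \<Rightarrow> bool" where
  "bad x y \<omega> \<longleftrightarrow> (\<exists>N. \<forall>n\<ge>N. gap / 2 \<le> M x y n \<omega>)"

lemma W_mono: "x \<le> y \<Longrightarrow> W \<omega> n x \<le> W \<omega> n y"
  by (simp add: circle_homeo_le[OF W_homeo])

lemma M_nonneg: "x \<le> y \<Longrightarrow> 0 \<le> M x y n \<omega>"
  unfolding M_def using H_mono[OF W_mono] by simp

lemma M_mono: "x' \<le> x \<Longrightarrow> y \<le> y' \<Longrightarrow> M x y n \<omega> \<le> M x' y' n \<omega>"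
  unfolding M_def using H_mono[OF W_mono, of x' x \<omega> n] H_mono[OF W_mono, of y y' \<omega> n] by simp

lemma bad_mono: "bad x y \<omega> \<Longrightarrow> x' \<le> x \<Longrightarrow> y \<le> y' \<Longrightarrow> bad x' y' \<omega>"
  unfolding bad_def using M_mono by (meson order_trans)

lemma W_add_int: "W \<omega> n (x + of_int k) = W \<omega> n x + of_int k"
  by (rule circle_fun_add_int[OF circle_homeo_fun[OF W_homeo]])

lemma M_shift: "M (x + of_int k) (y + of_int k) n \<omega> = M x y n \<omega>"
  unfolding M_def W_add_int H_add_int by simp

lemma bad_shift: "bad (x + of_int k) (y + of_int k) \<omega> \<longleftrightarrow> bad x y \<omega>"
  unfolding bad_def M_shift ..

lemma AE_good:
  assumes "x \<le> y"
  shows "AE \<omega> in P. \<not> bad x y \<omega> \<longrightarrow> (\<lambda>n. M x y n \<omega>) \<longlonglongrightarrow> 0"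
  using AE_dH[of x y] AE_increments[of x y]
proof eventually_elim
  case (elim \<omega>)
  have "(\<lambda>n. M x y n \<omega>) \<longlonglongrightarrow> 0 \<or> (\<exists>N. \<forall>n\<ge>N. gap / 2 \<le> M x y n \<omega>)"
  proof (rule zero_or_large)
    fix \<eta> :: real assume "0 < \<eta>"
    then show "eventually (\<lambda>n. \<not> (\<eta> \<le> M x y n \<omega> \<and> M x y n \<omega> \<le> gap / 2)) sequentially"
      unfolding M_def by (intro eventually_avoid W_mono assms) (use elim in blast)+
  qed (use elim gap_pos M_nonneg[OF assms] in auto)
  then show ?case unfolding bad_def by blast
qed

lemma bad_sets: "{\<omega>. bad x y \<omega>} \<in> sets P"
proof -
  have "{\<omega>\<in>space P. \<exists>N. \<forall>n\<ge>N. gap / 2 \<le> M x y n \<omega>} \<in> sets P"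
    using M_measurable[of x y] by measurable
  then show ?thesis by (simp add: bad_def)
qed

text \<open>Markov's inequality at time \<open>N\<close>, where the martingale still has mean
  \<open>H y - H x\<close>; the events \<open>A N\<close> increase to the event in question.\<close>

lemma prob_bad:
  assumes "x \<le> y"
  shows "measure P {\<omega>. bad x y \<omega>} \<le> 2 / gap * (H y - H x)"
proof -
  define A where "A N = {\<omega>\<in>space P. \<forall>n\<ge>N. gap / 2 \<le> M x y n \<omega>}" for N
  have A: "A N \<in> sets P" for N
    unfolding A_def using M_measurable[of x y] by measurable
  have int: "integrable P (\<lambda>\<omega>. 2 / gap * M x y N \<omega>)" for N
    by (intro integrable_mult_right integrable_bounded[OF M_measurable M_bound])
  have "measure P (A N) \<le> 2 / gap * (H y - H x)" for N
  proof -
    have "measure P (A N) = (\<integral>\<omega>. indicator (A N) \<omega> \<partial>P)" using A by simp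
    also have "\<dots> \<le> (\<integral>\<omega>. 2 / gap * M x y N \<omega> \<partial>P)"
    proof (rule integral_mono)
      show "indicator (A N) \<omega> \<le> 2 / gap * M x y N \<omega>" for \<omega>
        using gap_pos M_nonneg[OF assms, of N \<omega>] by (auto simp: A_def indicator_def field_simps)
      show "integrable P (indicator (A N) :: _ \<Rightarrow> real)"
        by (rule integrable_bounded[where B=1]) (use A in \<open>auto simp: indicator_def\<close>)
    qed (rule int)
    also have "\<dots> = 2 / gap * (H y - H x)" by (simp add: martingale(2))
    finally show ?thesis .
  qed
  moreover have "(\<lambda>N. measure P (A N)) \<longlonglongrightarrow> measure P (\<Union>N. A N)"
    by (rule seq.P.finite_Lim_measure_incseq) (use A in \<open>auto simp: A_def incseq_def\<close>)
  moreover have "(\<Union>N. A N) = {\<omega>. bad x y \<omega>}" by (auto simp: A_def bad_def)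
  ultimately show ?thesis by (metis LIMSEQ_le_const2)
qed

end

section \<open>Sets of small upper density\<close>

text \<open>Upper density at most \<open>\<delta>\<close>. Only slopes \<open>e > \<delta>\<close>
  are tested, which absorbs bounded errors in the count.\<close>

definition rare :: "nat set \<Rightarrow> real \<Rightarrow> bool" where
  "rare A \<delta> \<longleftrightarrow> (\<forall>e>\<delta>. eventually (\<lambda>N. real (card (A \<inter> {..N})) \<le> e * real N) sequentially)"

lemma rare_mono:
  assumes "rare A \<delta>" "B \<subseteq> A" "\<delta> \<le> \<delta>'"
  shows "rare B \<delta>'"
  unfolding rare_def
proof (intro allI impI)
  fix e assume "\<delta>' < e"
  then have "eventually (\<lambda>N. real (card (A \<inter> {..N})) \<le> e * real N) sequentially"
    using assms by (simp add: rare_def)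
  then show "eventually (\<lambda>N. real (card (B \<inter> {..N})) \<le> e * real N) sequentially"
  proof eventually_elim
    case (elim N)
    have "card (B \<inter> {..N}) \<le> card (A \<inter> {..N})" using assms(2) by (intro card_mono) auto
    with elim show ?case by linarith
  qed
qed

lemma rare_Un:
  assumes "rare A a" "rare B b"
  shows "rare (A \<union> B) (a + b)"
  unfolding rare_def
proof (intro allI impI)
  fix e assume e: "a + b < e"
  define d where "d = (e - a - b) / 2"
  have "a < a + d" "b < b + d" using e by (auto simp: d_def)
  then have "eventually (\<lambda>N. real (card (A \<inter> {..N})) \<le> (a + d) * real N) sequentially"
    "eventually (\<lambda>N. real (card (B \<inter> {..N})) \<le> (b + d) * real N) sequentially"
    using assms unfolding rare_def by blast+
  then show "eventually (\<lambda>N. real (card ((A \<union> B) \<inter> {..N})) \<le> e * real N) sequentially"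
  proof eventually_elim
    case (elim N)
    have "real (card ((A \<union> B) \<inter> {..N})) \<le> real (card (A \<inter> {..N})) + real (card (B \<inter> {..N}))"
      unfolding Int_Un_distrib2 of_nat_add[symmetric] of_nat_le_iff by (rule card_Un_le)
    also have "\<dots> \<le> (a + d) * real N + (b + d) * real N" using elim by simp
    also have "\<dots> = e * real N" by (simp add: d_def field_simps)
    finally show ?case .
  qed
qed

lemma rare_empty: "rare {} 0"
  by (simp add: rare_def)

lemma rare_UN:
  assumes "finite I" "\<And>i. i \<in> I \<Longrightarrow> rare (A i) \<delta>"
  shows "rare (\<Union>i\<in>I. A i) (real (card I) * \<delta>)"
  using assms
proof (induction I)
  case (insert i I)
  have "rare (A i \<union> (\<Union>i\<in>I. A i)) (\<delta> + real (card I) * \<delta>)"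
    using insert by (intro rare_Un) auto
  then show ?case using insert by (simp add: algebra_simps)
qed (simp add: rare_empty)

lemma rare_eventually_not:
  assumes "eventually (\<lambda>n. n \<notin> A) sequentially"
  shows "rare A 0"
  unfolding rare_def
proof (intro allI impI)
  fix e :: real assume e: "0 < e"
  obtain K where K: "\<And>n. n \<ge> K \<Longrightarrow> n \<notin> A" using assms unfolding eventually_sequentially by blast
  have "eventually (\<lambda>N. N \<ge> nat \<lceil>real K / e\<rceil>) sequentially" by (rule eventually_ge_at_top)
  then show "eventually (\<lambda>N. real (card (A \<inter> {..N})) \<le> e * real N) sequentially"
  proof eventually_elim
    case (elim N)
    have "A \<inter> {..N} \<subseteq> {..<K}" using K by (meson IntD1 lessThan_iff not_le subsetI)
    then have "card (A \<inter> {..N}) \<le> K" using card_mono[of "{..<K}"] by fastforce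
    moreover have "real K / e \<le> real N" using elim by linarith
    ultimately show ?case using e by (simp add: field_simps)
  qed
qed

lemma rare_all_pos:
  assumes "\<And>d. \<delta> < d \<Longrightarrow> rare A d"
  shows "rare A \<delta>"
  unfolding rare_def
proof (intro allI impI)
  fix e assume "\<delta> < e"
  then obtain d where "\<delta> < d" "d < e" using dense by blast
  then show "eventually (\<lambda>N. real (card (A \<inter> {..N})) \<le> e * real N) sequentially"
    using assms[of d] unfolding rare_def by blast
qed

lemma rareI_affine:
  assumes "eventually (\<lambda>N. real (card (A \<inter> {..N})) \<le> C + \<delta> * real N) sequentially"
  shows "rare A \<delta>"
  unfolding rare_def
proof (intro allI impI)
  fix e assume e: "\<delta> < e"
  have "eventually (\<lambda>N. N \<ge> nat \<lceil>C / (e - \<delta>)\<rceil>) sequentially" by (rule eventually_ge_at_top)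
  with assms show "eventually (\<lambda>N. real (card (A \<inter> {..N})) \<le> e * real N) sequentially"
  proof eventually_elim
    case (elim N)
    have "C / (e - \<delta>) \<le> real N" using elim by linarith
    then have "C \<le> (e - \<delta>) * real N" using e by (simp add: field_simps)
    then show ?case using elim by (simp add: algebra_simps)
  qed
qed

lemma rare_Suc:
  assumes "rare A \<delta>" "0 \<le> \<delta>"
  shows "rare {n. Suc n \<in> A} \<delta>"
proof (rule rare_all_pos)
  fix d assume d: "\<delta> < d"
  have "eventually (\<lambda>N. real (card (A \<inter> {..Suc N})) \<le> d * real (Suc N)) sequentially"
    using assms d unfolding rare_def eventually_sequentially_Suc[of "\<lambda>N. real (card (A \<inter> {..N})) \<le> d * real N"] by blast
  then have "eventually (\<lambda>N. real (card ({n. Suc n \<in> A} \<inter> {..N})) \<le> d + d * real N) sequentially"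
  proof eventually_elim
    case (elim N)
    have "card ({n. Suc n \<in> A} \<inter> {..N}) \<le> card (A \<inter> {..Suc N})"
      by (rule card_inj_on_le[of Suc]) auto
    with elim show ?case by (simp add: algebra_simps)
  qed
  then show "rare {n. Suc n \<in> A} d" by (rule rareI_affine)
qed

lemma rare_imp_density_one:
  assumes "\<And>\<delta>. \<delta> > 0 \<Longrightarrow> rare (- A) \<delta>"
  shows "(\<lambda>N. real (card {n. n \<le> N \<and> n \<in> A}) / real N) \<longlonglongrightarrow> 1"
proof (rule tendstoI)
  fix e :: real assume e: "0 < e"
  have "eventually (\<lambda>N. real (card (- A \<inter> {..N})) \<le> e / 2 * real N) sequentially"
    using assms[of "e / 4", unfolded rare_def, rule_format, of "e / 2"] e by simp
  moreover have "eventually (\<lambda>N. N > nat \<lceil>1 / e\<rceil>) sequentially" by (rule eventually_gt_at_top)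
  ultimately show "eventually (\<lambda>N. dist (real (card {n. n \<le> N \<and> n \<in> A}) / real N) 1 < e) sequentially"
  proof eventually_elim
    case (elim N)
    have N: "1 / e < real N" "0 < N" using elim e by linarith+
    have "{..N} = {n. n \<le> N \<and> n \<in> A} \<union> (- A \<inter> {..N})" by auto
    then have "card {..N} = card {n. n \<le> N \<and> n \<in> A} + card (- A \<inter> {..N})"
      by (metis (no_types, lifting) card_Un_disjoint ComplD IntD1 disjoint_iff finite_Un finite_atMost mem_Collect_eq)
    \<comment> \<open>There are \<open>N + 1\<close> numbers up to \<open>N\<close>; the surplus 1
      is less than \<open>e * real N\<close> by the choice of \<open>N\<close>.\<close>
    then have "real (card {n. n \<le> N \<and> n \<in> A}) - real N = 1 - real (card (- A \<inter> {..N}))" by simp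
    moreover have "0 \<le> real (card (- A \<inter> {..N}))" by simp
    moreover have "1 < e * real N" using N e by (simp add: field_simps)
    ultimately have "\<bar>real (card {n. n \<le> N \<and> n \<in> A}) - real N\<bar> < e * real N"
      using elim(1) by (simp add: abs_less_iff)
    then have "\<bar>(real (card {n. n \<le> N \<and> n \<in> A}) - real N) / real N\<bar> < e"
      using N by (simp add: abs_divide divide_less_eq)
    then show ?case using N by (simp add: dist_real_def diff_divide_distrib)
  qed
qed

section \<open>Equidistribution of the walk\<close>

lemma (in iid_sequence) integral_expectation_swap:
  fixes F :: "(nat \<Rightarrow> 'a) \<Rightarrow> 'a \<Rightarrow> real"
  assumes m: "\<And>a. (\<lambda>\<omega>. F \<omega> a) \<in> borel_measurable P" and bd: "\<And>\<omega> a. \<bar>F \<omega> a\<bar> \<le> B"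
  shows "(\<integral>\<omega>. measure_pmf.expectation \<mu> (F \<omega>) \<partial>P) = measure_pmf.expectation \<mu> (\<lambda>a. \<integral>\<omega>. F \<omega> a \<partial>P)"
proof -
  interpret PM: pair_prob_space P "measure_pmf \<mu>" ..
  have s: "snd \<in> measurable (P \<Otimes>\<^sub>M measure_pmf \<mu>) (count_space UNIV)"
    using measurable_snd[of P "measure_pmf \<mu>"] measurable_cong_sets[OF refl sets_measure_pmf_count_space[of \<mu>]] by blast
  have "(\<lambda>p. F (fst p) (snd p)) \<in> borel_measurable (P \<Otimes>\<^sub>M measure_pmf \<mu>)"
    by (rule measurable_compose_countable[OF measurable_compose[OF measurable_fst m] s])
  then have "integrable (P \<Otimes>\<^sub>M measure_pmf \<mu>) (\<lambda>(\<omega>, a). F \<omega> a)"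
    by (intro PM.integrable_const_bound[of _ B]) (use bd in \<open>auto simp: case_prod_beta'\<close>)
  from PM.Fubini_integral[OF this] show ?thesis by simp
qed

text \<open>Laws of positions of the forward walk evolve under the transfer operator of the inverse
  maps, so concentration is needed for that system too.\<close>

lemma (in circle_system) inverse_system: "circle_system \<mu> (\<lambda>a. inv (\<phi> a))"
proof
  show "circle_homeo (inv (\<phi> a))" for a by (rule circle_homeo_inv[OF homeo])
  fix K assume K: "circle_fun K"
  show "\<exists>a\<in>set_pmf \<mu>. \<exists>s t. K (inv (\<phi> a) t) - K (inv (\<phi> a) s) \<noteq> K t - K s"
  proof (rule ccontr)
    assume neg: "\<not> ?thesis"
    have "K (\<phi> a t) - K (\<phi> a s) = K t - K s" if "a \<in> set_pmf \<mu>" for a s t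
    proof -
      have "K (inv (\<phi> a) (\<phi> a t)) - K (inv (\<phi> a) (\<phi> a s)) = K (\<phi> a t) - K (\<phi> a s)"
        using neg that by blast
      then show ?thesis by (simp add: homeo)
    qed
    with no_inv[OF K] show False by blast
  qed
qed

lemma circle_fun_floor: "circle_fun (\<lambda>t. real_of_int \<lfloor>t - x\<rfloor>)"
  unfolding circle_fun_def
proof (intro conjI monoI allI)
  show "real_of_int \<lfloor>s - x\<rfloor> \<le> real_of_int \<lfloor>t - x\<rfloor>" if "s \<le> t" for s t
    using that by (simp add: floor_mono)
  have "\<lfloor>t + 1 - x\<rfloor> = \<lfloor>t - x\<rfloor> + 1" for t by linarith
  then show "real_of_int \<lfloor>t + 1 - x\<rfloor> = real_of_int \<lfloor>t - x\<rfloor> + 1" for t by simp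
qed

lemma near_sets: 
  assumes "f \<in> borel_measurable N"
  shows "{\<omega>\<in>space N. near (f \<omega>) z r} \<in> sets N"
  unfolding near_def using assms by measurable

lemma of_bool_near_measurable:
  "f \<in> borel_measurable N \<Longrightarrow> (\<lambda>\<omega>. of_bool (near (f \<omega>) z r) :: real) \<in> borel_measurable N"
proof -
  assume f: "f \<in> borel_measurable N"
  have "(\<lambda>\<omega>. indicator {\<omega>\<in>space N. near (f \<omega>) z r} \<omega> :: real) \<in> borel_measurable N"
    using near_sets[OF f] by (intro borel_measurable_indicator)
  then show ?thesis by (rule measurable_cong[THEN iffD1, rotated]) (simp add: indicator_def)
qed

context circle_walk
begin

text \<open>Both sides are the mass that the law of \<open>W \<omega> n x\<close> gives to the arc
  from \<open>s\<close> to \<open>t\<close>: the floors represent a point mass, and moving the point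
  by a letter amounts to moving \<open>t\<close> by the inverse letter.\<close>

lemma law_transfer:
  "(\<integral>\<omega>. (real_of_int \<lfloor>t - W \<omega> n x\<rfloor> - real_of_int \<lfloor>s - W \<omega> n x\<rfloor>) \<partial>P)
     = (circle_system.T \<mu> (\<lambda>a. inv (\<phi> a)) ^^ n) (\<lambda>t. real_of_int \<lfloor>t - x\<rfloor>) t
     - (circle_system.T \<mu> (\<lambda>a. inv (\<phi> a)) ^^ n) (\<lambda>t. real_of_int \<lfloor>t - x\<rfloor>) s"
proof (induction n arbitrary: s t)
  case 0
  then show ?case by (simp add: prob_UNIV)
next
  case (Suc n)
  interpret inv: circle_system \<mu> "\<lambda>a. inv (\<phi> a)" by (rule inverse_system)
  let ?F = "\<lambda>\<omega> a. real_of_int \<lfloor>inv (\<phi> a) t - W \<omega> n x\<rfloor> - real_of_int \<lfloor>inv (\<phi> a) s - W \<omega> n x\<rfloor>"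
  have fl: "\<lfloor>r - \<phi> a z\<rfloor> = \<lfloor>inv (\<phi> a) r - z\<rfloor>" for r a z
    using floor_circle_homeo[OF homeo, of a "inv (\<phi> a) r" z] by (simp add: homeo)
  have m: "(\<lambda>\<omega>. ?F \<omega> a) \<in> borel_measurable P" for a
    using W_measurable[of n x] by measurable
  have bd: "\<bar>?F \<omega> a\<bar> \<le> \<bar>t - s\<bar> + 2" for \<omega> a
    using inv.phi_diff_bound[OF circle_fun_floor] by blast
  have past: "?F \<omega> a = ?F \<omega>' a" if "\<And>i. i < n \<Longrightarrow> \<omega> i = \<omega>' i" for \<omega> \<omega>' a
    using wk_cong[OF that] by (simp only:)
  have "(\<integral>\<omega>. (real_of_int \<lfloor>t - W \<omega> (Suc n) x\<rfloor> - real_of_int \<lfloor>s - W \<omega> (Suc n) x\<rfloor>) \<partial>P) = (\<integral>\<omega>. ?F \<omega> (\<omega> n) \<partial>P)"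
    by (simp add: fl)
  also have "\<dots> = (\<integral>\<omega>. E (?F \<omega>) \<partial>P)" by (rule integral_step(1)[OF m bd past])
  also have "\<dots> = E (\<lambda>a. \<integral>\<omega>. ?F \<omega> a \<partial>P)" by (rule integral_expectation_swap[OF m bd])
  also have "\<dots> = E (\<lambda>a. (inv.T ^^ n) (\<lambda>t. real_of_int \<lfloor>t - x\<rfloor>) (inv (\<phi> a) t)
      - (inv.T ^^ n) (\<lambda>t. real_of_int \<lfloor>t - x\<rfloor>) (inv (\<phi> a) s))"
    by (simp only: Suc)
  also have "\<dots> = (inv.T ^^ Suc n) (\<lambda>t. real_of_int \<lfloor>t - x\<rfloor>) t - (inv.T ^^ Suc n) (\<lambda>t. real_of_int \<lfloor>t - x\<rfloor>) s"
    using inv.T_diff[OF inv.circle_fun_Titer[OF circle_fun_floor]] by simp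
  finally show ?case .
qed

text \<open>One radius serves all starting points and centres, because \<open>concentration\<close>
  is uniform over all functions, in particular over all point masses.\<close>

lemma law_concentration:
  assumes "\<delta> > 0"
  obtains N r where "r > 0" "N > 0"
    "\<And>n x z. n \<ge> N \<Longrightarrow> measure P {\<omega>. near (W \<omega> n x) z r} \<le> \<delta>"
proof -
  interpret inv: circle_system \<mu> "\<lambda>a. inv (\<phi> a)" by (rule inverse_system)
  obtain N where N: "\<And>K t. circle_fun K \<Longrightarrow> (inv.T ^^ N) K (t + 1 / real (Suc N)) - (inv.T ^^ N) K (t - 1 / real (Suc N)) < \<delta>"
    using inv.concentration[OF assms] by metis
  define r where "r = 1 / real (Suc N)"
  have "measure P {\<omega>. near (W \<omega> n x) z r} \<le> \<delta>" if n: "n \<ge> N" for n x z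
  proof -
    let ?A = "{\<omega>. near (W \<omega> n x) z r}"
    let ?f = "\<lambda>\<omega>. real_of_int \<lfloor>(z + r) - W \<omega> n x\<rfloor> - real_of_int \<lfloor>(z - r) - W \<omega> n x\<rfloor>"
    have A: "?A \<in> sets P" using near_sets[OF W_measurable] by simp
    have r0: "r > 0" by (simp add: r_def)
    have "indicator ?A \<omega> \<le> ?f \<omega>" for \<omega>
    proof (cases "near (W \<omega> n x) z r")
      case True
      then obtain k :: int where "\<bar>W \<omega> n x - z - of_int k\<bar> < r" unfolding near_def by blast
      then have "\<lfloor>(z - r) - W \<omega> n x\<rfloor> < \<lfloor>(z + r) - W \<omega> n x\<rfloor>"
      proof -
        assume "\<bar>W \<omega> n x - z - of_int k\<bar> < r"
        then have "\<lfloor>(z - r) - W \<omega> n x\<rfloor> < - k" "- k \<le> \<lfloor>(z + r) - W \<omega> n x\<rfloor>"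
          by (auto simp: floor_less_iff le_floor_iff)
        then show ?thesis by linarith
      qed
      then have "\<lfloor>(z - r) - W \<omega> n x\<rfloor> + 1 \<le> \<lfloor>(z + r) - W \<omega> n x\<rfloor>" by simp
      then have "real_of_int \<lfloor>(z - r) - W \<omega> n x\<rfloor> + 1 \<le> real_of_int \<lfloor>(z + r) - W \<omega> n x\<rfloor>"
        by (metis of_int_1 of_int_add of_int_le_iff)
      then show ?thesis by (simp add: indicator_def)
    next
      case False
      have "\<lfloor>(z - r) - W \<omega> n x\<rfloor> \<le> \<lfloor>(z + r) - W \<omega> n x\<rfloor>" using r0 by (intro floor_mono) simp
      then show ?thesis using False by (simp add: indicator_def)
    qed
    then have "(\<integral>\<omega>. indicator ?A \<omega> \<partial>P) \<le> (\<integral>\<omega>. ?f \<omega> \<partial>P)"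
    proof (intro integral_mono)
      show "integrable P (indicator ?A :: _ \<Rightarrow> real)"
        by (rule integrable_bounded[where B=1]) (use A in \<open>auto simp: indicator_def\<close>)
      have fb: "\<bar>?f \<omega>\<bar> \<le> \<bar>(z + r) - (z - r)\<bar> + 1" for \<omega>
        by (rule circle_fun_abs_bound[OF circle_fun_floor])
      show "integrable P ?f"
        by (rule integrable_bounded[OF _ fb]) (use W_measurable[of n x] in measurable)
    qed
    also have "\<dots> = (inv.T ^^ n) (\<lambda>t. real_of_int \<lfloor>t - x\<rfloor>) (z + r) - (inv.T ^^ n) (\<lambda>t. real_of_int \<lfloor>t - x\<rfloor>) (z - r)"
      by (rule law_transfer)
    also have "\<dots> < \<delta>"
    proof -
      have "(inv.T ^^ n) K = (inv.T ^^ N) ((inv.T ^^ (n - N)) K)" for K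
        using funpow_add[of N "n - N" inv.T] n by simp
      then show ?thesis
        using N[OF inv.circle_fun_Titer[OF circle_fun_floor[of x], of "n - N"], of z]
        unfolding r_def[symmetric] by (simp only:)
    qed
    finally show ?thesis using A by simp
  qed
  then have "measure P {\<omega>. near (W \<omega> n x) z r} \<le> \<delta>" if "n \<ge> Suc N" for n x z
    using that by simp
  then show ?thesis using that[of r "Suc N"] by (simp add: r_def)
qed

section \<open>Counting visits to short arcs\<close>

definition visits :: "nat \<Rightarrow> real \<Rightarrow> nat \<Rightarrow> (nat \<Rightarrow> real) \<Rightarrow> real \<Rightarrow> (nat \<Rightarrow> 'a) \<Rightarrow> real" where
  "visits N r J z x \<omega> = (\<Sum>j<J. of_bool (near (W \<omega> (N * Suc j) x) (z j) r))"

lemma visits_measurable: "visits N r J z x \<in> borel_measurable P"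
  unfolding visits_def by (intro borel_measurable_sum of_bool_near_measurable W_measurable)

lemma visits_bound: "0 \<le> visits N r J z x \<omega>" "visits N r J z x \<omega> \<le> real J"
proof -
  show "0 \<le> visits N r J z x \<omega>" unfolding visits_def by (intro sum_nonneg) auto
  have "visits N r J z x \<omega> \<le> (\<Sum>j<J. 1)" unfolding visits_def by (intro sum_mono) auto
  then show "visits N r J z x \<omega> \<le> real J" by simp
qed

text \<open>The Markov property at time \<open>N\<close> splits off the first visit, and the
  hypothesis bounds the rest uniformly in the new starting point. For \<open>b\<close> equal to 0 or
  1 one has \<open>exp b \<le> 1 + 2 * b\<close>, since \<open>exp 1 \<le> 3\<close>.\<close>

lemma exp_visits:
  assumes c: "\<And>x z. measure P {\<omega>. near (W \<omega> N x) z r} \<le> \<delta>" and d: "\<delta> > 0"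
  shows "(\<integral>\<omega>. exp (visits N r J z x \<omega>) \<partial>P) \<le> (1 + 2 * \<delta>) ^ J"
proof (induction J arbitrary: z x)
  case 0
  then show ?case by (simp add: visits_def prob_UNIV)
next
  case (Suc J)
  let ?b = "\<lambda>\<omega>. of_bool (near (W \<omega> N x) (z 0) r) :: real"
  have split: "visits N r (Suc J) z x (comb_seq N \<omega> \<omega>') = ?b \<omega> + visits N r J (\<lambda>j. z (Suc j)) (W \<omega> N x) \<omega>'" for \<omega> \<omega>'
  proof -
    have "W (comb_seq N \<omega> \<omega>') (N * Suc (Suc j)) x = W \<omega>' (N * Suc j) (W \<omega> N x)" for j
      using wk_comb_seq_add[of \<phi> N \<omega> \<omega>' "N * Suc j" x] by simp
    moreover have "W (comb_seq N \<omega> \<omega>') (N * Suc 0) x = W \<omega> N x" by (simp add: wk_comb_seq)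
    ultimately show ?thesis unfolding visits_def sum.lessThan_Suc_shift by simp
  qed
  have bm: "?b \<in> borel_measurable P" by (rule of_bool_near_measurable[OF W_measurable])
  have "(\<integral>\<omega>. exp (visits N r (Suc J) z x \<omega>) \<partial>P)
      = (\<integral>\<omega>. (\<integral>\<omega>'. exp (visits N r (Suc J) z x (comb_seq N \<omega> \<omega>')) \<partial>P) \<partial>P)"
    by (rule integral_comb_seq(1)[where B="exp (real (Suc J))"])
       (use visits_bound(2)[of N r "Suc J"] measurable_compose[OF visits_measurable borel_measurable_exp] in \<open>simp_all del: of_nat_Suc\<close>)
  also have "\<dots> = (\<integral>\<omega>. exp (?b \<omega>) * (\<integral>\<omega>'. exp (visits N r J (\<lambda>j. z (Suc j)) (W \<omega> N x) \<omega>') \<partial>P) \<partial>P)"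
    by (simp only: split exp_add integral_mult_right_zero)
  also have "\<dots> \<le> (\<integral>\<omega>. (1 + 2 * ?b \<omega>) * (1 + 2 * \<delta>) ^ J \<partial>P)"
  proof (rule integral_mono')
    show "integrable P (\<lambda>\<omega>. (1 + 2 * ?b \<omega>) * (1 + 2 * \<delta>) ^ J)"
      using d by (intro integrable_mult_left integrable_bounded[where B=3]) (use bm in auto)
    show "exp (?b \<omega>) * (\<integral>\<omega>'. exp (visits N r J (\<lambda>j. z (Suc j)) (W \<omega> N x) \<omega>') \<partial>P) \<le> (1 + 2 * ?b \<omega>) * (1 + 2 * \<delta>) ^ J" for \<omega>
    proof (rule mult_mono[OF _ Suc.IH])
      show "exp (?b \<omega>) \<le> 1 + 2 * ?b \<omega>" using exp_le by simp
    qed auto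
    show "0 \<le> (1 + 2 * ?b \<omega>) * (1 + 2 * \<delta>) ^ J" for \<omega> using d by simp
  qed
  also have "\<dots> = (1 + 2 * measure P {\<omega>. near (W \<omega> N x) (z 0) r}) * (1 + 2 * \<delta>) ^ J"
  proof -
    have "?b = indicator {\<omega>. near (W \<omega> N x) (z 0) r}" by (auto simp: indicator_def)
    moreover have "{\<omega>. near (W \<omega> N x) (z 0) r} \<in> sets P" using near_sets[OF W_measurable] by simp
    ultimately have "(\<integral>\<omega>. ?b \<omega> \<partial>P) = measure P {\<omega>. near (W \<omega> N x) (z 0) r}" by simp
    moreover have "integrable P ?b" by (rule integrable_bounded[where B=1]) (use bm in auto)
    ultimately show ?thesis by (simp add: prob_UNIV)
  qed
  also have "\<dots> \<le> (1 + 2 * \<delta>) * (1 + 2 * \<delta>) ^ J"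
    using c[of x "z 0"] d by (intro mult_right_mono) auto
  finally show ?case by simp
qed

text \<open>Chernoff's bound for the events at times \<open>r0 + N (j + 1)\<close>: conditionally on the walk up to the
  previous such time, each of them has probability at most \<open>\<delta>\<close>.\<close>

lemma AE_few_visits:
  assumes c: "\<And>x z. measure P {\<omega>. near (W \<omega> N x) z r} \<le> \<delta>" and d: "\<delta> > 0"
  shows "AE \<omega> in P. eventually (\<lambda>J. (\<Sum>j<J. of_bool (near (W \<omega> (r0 + N * Suc j) x) (z j) r)) < 3 * \<delta> * real J) sequentially"
proof -
  define S where "S J \<omega> = (\<Sum>j<J. of_bool (near (W \<omega> (r0 + N * Suc j) x) (z j) r) :: real)" for J \<omega>
  have Sm: "S J \<in> borel_measurable P" for J
    unfolding S_def by (intro borel_measurable_sum of_bool_near_measurable W_measurable)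
  have Sb: "S J \<omega> \<le> real J" for J \<omega>
  proof -
    have "S J \<omega> \<le> (\<Sum>j<J. 1)" unfolding S_def by (intro sum_mono) auto
    then show ?thesis by simp
  qed
  have em: "(\<lambda>\<omega>. exp (S J \<omega>)) \<in> borel_measurable P" for J using Sm[of J] by measurable
  have eb: "\<bar>exp (S J \<omega>)\<bar> \<le> exp (real J)" for J \<omega> using Sb by simp
  have E: "(\<integral>\<omega>. exp (S J \<omega>) \<partial>P) \<le> (1 + 2 * \<delta>) ^ J" for J
  proof -
    have split: "S J (comb_seq r0 \<omega> \<omega>') = visits N r J z (W \<omega> r0 x) \<omega>'" for \<omega> \<omega>'
      unfolding S_def visits_def by (simp only: wk_comb_seq_add)
    have "(\<integral>\<omega>. exp (S J \<omega>) \<partial>P) = (\<integral>\<omega>. (\<integral>\<omega>'. exp (visits N r J z (W \<omega> r0 x) \<omega>') \<partial>P) \<partial>P)"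
      using integral_comb_seq(1)[where n=r0, OF em[of J] eb[of J]] by (simp only: split)
    also have "\<dots> \<le> (\<integral>\<omega>. (1 + 2 * \<delta>) ^ J \<partial>P)"
      by (rule integral_mono') (use exp_visits[OF c d] d in auto)
    finally show ?thesis by (simp add: prob_UNIV)
  qed
  define A where "A J = {\<omega>\<in>space P. 3 * \<delta> * real J \<le> S J \<omega>}" for J
  have A: "A J \<in> sets P" for J unfolding A_def using Sm[of J] by measurable
  \<comment> \<open>The threshold \<open>3 * \<delta> * J\<close> exceeds the exponent
    \<open>2 * \<delta> * J\<close> of the moment bound by \<open>\<delta> * J\<close>, which gives
    summable probabilities.\<close>
  have PA: "measure P (A J) \<le> exp (- \<delta>) ^ J" for J
  proof -
    have "exp (3 * \<delta> * real J) * measure P (A J) = (\<integral>\<omega>. exp (3 * \<delta> * real J) * indicator (A J) \<omega> \<partial>P)"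
      using A by simp
    also have "\<dots> \<le> (\<integral>\<omega>. exp (S J \<omega>) \<partial>P)"
      by (rule integral_mono'[OF integrable_bounded[OF em eb]]) (auto simp: A_def indicator_def)
    also have "\<dots> \<le> (1 + 2 * \<delta>) ^ J" by (rule E)
    also have "\<dots> \<le> exp (2 * \<delta>) ^ J" using d exp_ge_add_one_self[of "2 * \<delta>"] by (intro power_mono) auto
    also have "\<dots> = exp (3 * \<delta> * real J) * exp (- \<delta>) ^ J"
      by (simp add: exp_of_nat2_mult[symmetric] exp_add[symmetric] algebra_simps)
    finally show ?thesis by simp
  qed
  have "AE \<omega> in P. eventually (\<lambda>J. \<omega> \<in> space P - A J) sequentially"
  proof (rule borel_cantelli_AE1[OF A])
    show "summable (\<lambda>J. measure P (A J))"
    proof (rule summable_comparison_test'[where g="\<lambda>J. exp (- \<delta>) ^ J"])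
      show "summable (\<lambda>J. exp (- \<delta>) ^ J)" using d by (intro summable_geometric) simp
      show "norm (measure P (A J)) \<le> exp (- \<delta>) ^ J" if "0 \<le> J" for J using PA by simp
    qed
  qed (simp add: seq.P.emeasure_eq_measure)
  then show ?thesis
  proof eventually_elim
    case (elim \<omega>)
    then show ?case by eventually_elim (simp add: A_def S_def not_le)
  qed
qed

text \<open>The times are split into residue classes modulo \<open>N\<close>, and
  \<open>AE_few_visits\<close> applies to each. The target \<open>z\<close> may move with time,
  while \<open>r\<close> depends neither on it nor on \<open>x\<close>.\<close>

lemma AE_rare_near:
  assumes "\<delta> > 0"
  obtains r where "r > 0" "\<And>x z. AE \<omega> in P. rare {n. near (W \<omega> n x) (z n) r} \<delta>"
proof -
  \<comment> \<open>This compensates the factor 3 in \<open>AE_few_visits\<close>.\<close>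
  define d where "d = \<delta> / 3"
  have d: "d > 0" using assms by (simp add: d_def)
  obtain N r where Nr: "r > 0" "N > 0" "\<And>n x z. n \<ge> N \<Longrightarrow> measure P {\<omega>. near (W \<omega> n x) z r} \<le> d"
    using law_concentration[OF d] by metis
  have "AE \<omega> in P. rare {n. near (W \<omega> n x) (z n) r} \<delta>" for x and z :: "nat \<Rightarrow> real"
  proof -
    have "AE \<omega> in P. \<forall>r0. eventually (\<lambda>J. (\<Sum>j<J. of_bool (near (W \<omega> (r0 + N * Suc j) x) (z (r0 + N * Suc j)) r)) < 3 * d * real J) sequentially"
      unfolding AE_all_countable
      by (intro allI AE_few_visits[where z="\<lambda>j. z (r0 + N * Suc j)" for r0]) (use Nr d in auto)
    then show ?thesis
    proof eventually_elim
      case (elim \<omega>)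
      define A where "A = {n. near (W \<omega> n x) (z n) r}"
      have "eventually (\<lambda>J. \<forall>r0\<in>{..<N}. (\<Sum>j<J. of_bool (near (W \<omega> (r0 + N * Suc j) x) (z (r0 + N * Suc j)) r)) < 3 * d * real J) sequentially"
        using elim by (intro eventually_ball_finite) auto
      then obtain J0 where J0: "\<And>J r0. J \<ge> J0 \<Longrightarrow> r0 < N \<Longrightarrow>
          (\<Sum>j<J. of_bool (near (W \<omega> (r0 + N * Suc j) x) (z (r0 + N * Suc j)) r)) < 3 * d * real J"
        unfolding eventually_sequentially by blast
      have "eventually (\<lambda>T. T \<ge> N * J0) sequentially" by (rule eventually_ge_at_top)
      then have "eventually (\<lambda>T. real (card (A \<inter> {..T})) \<le> (real N + \<delta> * real N) + \<delta> * real T) sequentially"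
      proof eventually_elim
        case (elim T)
        define J where "J = Suc (T div N)"
        have "J0 \<le> T div N" using elim Nr(2) by (simp add: less_eq_div_iff_mult_less_eq mult.commute)
        then have J: "J \<ge> J0" by (simp add: J_def)
        \<comment> \<open>Within each class, visits are counted only from time \<open>r0 + N\<close>
          on; the first \<open>N\<close> times are added separately as a bounded error.\<close>
        have sub: "A \<inter> {..T} \<subseteq> {..<N} \<union> (\<Union>r0<N. (\<lambda>j. r0 + N * Suc j) ` {j. j < J \<and> r0 + N * Suc j \<in> A})"
        proof
          fix n assume n: "n \<in> A \<inter> {..T}"
          show "n \<in> {..<N} \<union> (\<Union>r0<N. (\<lambda>j. r0 + N * Suc j) ` {j. j < J \<and> r0 + N * Suc j \<in> A})"
          proof (cases "n < N")
            case False
            then have q: "n div N \<ge> 1" using Nr(2) by (simp add: Suc_leI div_greater_zero_iff)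
            define j where "j = n div N - 1"
            have nj: "n = n mod N + N * Suc j" using q by (simp add: j_def)
            have "n div N \<le> T div N" using n by (intro div_le_mono) simp
            then have "j < J" using q by (simp add: j_def J_def)
            have "n mod N + N * Suc j \<in> A" using n by (simp only: nj[symmetric] Int_iff)
            then have "n \<in> (\<lambda>j. n mod N + N * Suc j) ` {j. j < J \<and> n mod N + N * Suc j \<in> A}"
              by (intro image_eqI[where x=j] nj CollectI conjI \<open>j < J\<close>)
            moreover have "n mod N \<in> {..<N}" using Nr(2) by simp
            ultimately show ?thesis by (intro UnI2 UN_I)
          qed simp
        qed
        have "card (A \<inter> {..T}) \<le> card {..<N} + card (\<Union>r0<N. (\<lambda>j. r0 + N * Suc j) ` {j. j < J \<and> r0 + N * Suc j \<in> A})"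
          by (rule order_trans[OF card_mono[OF _ sub] card_Un_le]) auto
        also have "card (\<Union>r0<N. (\<lambda>j. r0 + N * Suc j) ` {j. j < J \<and> r0 + N * Suc j \<in> A})
            \<le> (\<Sum>r0<N. card ((\<lambda>j. r0 + N * Suc j) ` {j. j < J \<and> r0 + N * Suc j \<in> A}))"
          by (rule card_UN_le) simp
        also have "\<dots> \<le> (\<Sum>r0<N. card {j. j < J \<and> r0 + N * Suc j \<in> A})"
          by (intro sum_mono card_image_le) simp
        finally have "real (card (A \<inter> {..T})) \<le> real N + (\<Sum>r0<N. real (card {j. j < J \<and> r0 + N * Suc j \<in> A}))"
          by (simp flip: of_nat_sum of_nat_add)
        also have "(\<Sum>r0<N. real (card {j. j < J \<and> r0 + N * Suc j \<in> A})) \<le> (\<Sum>r0<N. 3 * d * real J)"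
        proof (rule sum_mono)
          fix r0 assume r0: "r0 \<in> {..<N}"
          have "{j. j < J \<and> r0 + N * Suc j \<in> A} = {..<J} \<inter> {j. r0 + N * Suc j \<in> A}" by auto
          then have "real (card {j. j < J \<and> r0 + N * Suc j \<in> A}) = (\<Sum>j<J. of_bool (near (W \<omega> (r0 + N * Suc j) x) (z (r0 + N * Suc j)) r))"
            by (simp add: A_def)
          then show "real (card {j. j < J \<and> r0 + N * Suc j \<in> A}) \<le> 3 * d * real J"
            using J0[OF J, of r0] r0 by simp
        qed
        also have "(\<Sum>r0<N. 3 * d * real J) = \<delta> * (real N * real J)" by (simp add: d_def)
        also have "real N * real J \<le> real N + real T"
        proof -
          have "N * J \<le> N + T" by (simp add: J_def)
          then show ?thesis by (simp flip: of_nat_mult of_nat_add)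
        qed
        finally show ?case using assms by (simp add: algebra_simps)
      qed
      then show ?case unfolding A_def by (rule rareI_affine)
    qed
  qed
  then show ?thesis using that Nr(1) by blast
qed

end

section \<open>Contraction in length\<close>

context circle_walk
begin

text \<open>The leftmost points of level sets of \<open>H\<close>. Moving the start of an arc to
  such a point changes no height and only lengthens the arc, and the letters preserve this
  property.\<close>

definition lend :: "real \<Rightarrow> bool" where
  "lend a \<longleftrightarrow> (\<forall>t<a. H t < H a)"

definition left :: "real \<Rightarrow> real" where
  "left x = Inf {t. H t = H x}"

lemma left: "H (left x) = H x" "left x \<le> x" "lend (left x)"
proof -
  let ?L = "{t. H t = H x}"
  have bd: "bdd_below ?L"
  proof (rule bdd_belowI)
    fix t assume t: "t \<in> ?L"
    show "x - 1 \<le> t"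
    proof (rule ccontr)
      assume "\<not> x - 1 \<le> t"
      then have "H (t + of_int 1) \<le> H x" by (intro H_mono) simp
      then show False using t H_add_int[of t 1] by simp
    qed
  qed
  have "closed ?L" by (intro closed_Collect_eq H_cont continuous_on_const)
  then have "left x \<in> ?L" unfolding left_def by (intro closed_contains_Inf bd) auto
  then show 1: "H (left x) = H x" by simp
  show "left x \<le> x" unfolding left_def by (rule cInf_lower[OF _ bd]) simp
  show "lend (left x)"
    unfolding lend_def
  proof (intro allI impI)
    fix t assume t: "t < left x"
    then have "H t \<noteq> H x"
      unfolding left_def using cInf_lower[OF _ bd, of t] by auto
    then show "H t < H (left x)" using H_mono[of t "left x"] t 1 by simp
  qed
qed

lemma lend_phi:
  assumes a: "a \<in> set_pmf \<mu>" and x: "lend x"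
  shows "lend (\<phi> a x)"
  unfolding lend_def
proof (intro allI impI)
  fix t assume t: "t < \<phi> a x"
  define t' where "t' = inv (\<phi> a) t"
  have t': "t = \<phi> a t'" by (simp add: t'_def homeo)
  have "t' < x" using t circle_homeo_strict[OF homeo[of a]] by (simp add: t')
  then have "H t' < H x" using x by (simp add: lend_def)
  then have "hat [a] (H t') < hat [a] (H x)" by (rule hat_strict[OF a])
  then show "H t < H (\<phi> a x)" using hat_H[of "[a]"] a by (simp add: t')
qed

lemma lend_W: "(\<And>i. \<omega> i \<in> set_pmf \<mu>) \<Longrightarrow> lend x \<Longrightarrow> lend (W \<omega> n x)"
  by (induction n) (auto intro: lend_phi)

lemma H_level_W:
  assumes "\<And>i. \<omega> i \<in> set_pmf \<mu>" "H s = H t"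
  shows "H (W \<omega> n s) = H (W \<omega> n t)"
proof (induction n)
  case (Suc n)
  show ?case unfolding wk.simps by (rule H_level[OF assms(1) Suc])
qed (simp add: assms)

lemma lend_shift: "lend x \<Longrightarrow> lend (x + of_int k)"
  unfolding lend_def
proof (intro allI impI)
  fix t assume x: "\<forall>t<x. H t < H x" and "t < x + of_int k"
  then have "t - of_int k < x" by simp
  then have "H (t - of_int k) < H x" using x by blast
  then show "H t < H (x + of_int k)" using H_add_int[of "t - of_int k" k] H_add_int[of x k] by simp
qed

text \<open>Flat stretches of \<open>H\<close> of length at least \<open>e\<close>, recorded by
  their left ends modulo 1. They are the arcs of height 0 that are not short.\<close>

definition gaps :: "real \<Rightarrow> real set" where
  "gaps e = {s\<in>{0..<1}. lend s \<and> H (s + e) = H s}"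

lemma finite_gaps:
  assumes e: "e > 0"
  shows "finite (gaps e)"
proof -
  have sep: "s + e \<le> s'" if "s \<in> gaps e" "s' \<in> gaps e" "s < s'" for s s'
  proof (rule ccontr)
    assume "\<not> s + e \<le> s'"
    then have "H s' \<le> H (s + e)" by (intro H_mono) simp
    moreover have "H s < H s'" using that by (simp add: gaps_def lend_def)
    ultimately show False using that by (simp add: gaps_def)
  qed
  have "inj_on (\<lambda>s. \<lfloor>s / e\<rfloor>) (gaps e)"
  proof (rule inj_onI)
    fix s s' assume s: "s \<in> gaps e" "s' \<in> gaps e" "\<lfloor>s / e\<rfloor> = \<lfloor>s' / e\<rfloor>"
    have *: False if "u \<in> gaps e" "v \<in> gaps e" "\<lfloor>u / e\<rfloor> = \<lfloor>v / e\<rfloor>" "u < v" for u v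
    proof -
      have "u / e + 1 \<le> v / e"
        using divide_right_mono[OF sep[OF that(1,2,4)], of e] e by (simp add: add_divide_distrib)
      then show False using that(3) by linarith
    qed
    show "s = s'" using *[OF s] *[OF s(2,1) s(3)[symmetric]] by (cases s s' rule: linorder_cases) auto
  qed
  moreover have "(\<lambda>s. \<lfloor>s / e\<rfloor>) ` gaps e \<subseteq> {0..\<lfloor>1 / e\<rfloor>}"
    using e by (auto simp: gaps_def intro!: floor_mono divide_right_mono)
  ultimately show ?thesis by (meson finite_atLeastAtMost_int finite_imageD finite_subset)
qed

text \<open>By compactness, arcs of length at least \<open>e\<close> whose heights tend to 0
  accumulate at a flat stretch of that length.\<close>

lemma long_arc_near_gap:
  assumes e: "e > 0" and r: "r > 0"
  obtains \<eta> where "\<eta> > 0" "\<And>a b. lend a \<Longrightarrow> a + e \<le> b \<Longrightarrow> H b - H a < \<eta> \<Longrightarrow> \<exists>s\<in>gaps e. near a s r"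
proof -
  have "\<exists>\<eta>>0. \<forall>a b. lend a \<and> a + e \<le> b \<and> H b - H a < \<eta> \<longrightarrow> (\<exists>s\<in>gaps e. near a s r)"
  proof (rule ccontr)
    assume neg: "\<not> ?thesis"
    have "\<exists>a. lend a \<and> a \<in> {0..1} \<and> H (a + e) - H a < 1 / real (Suc n) \<and> \<not> (\<exists>s\<in>gaps e. near a s r)" for n
    proof -
      have "0 < 1 / real (Suc n)" by simp
      then obtain a b where ab: "lend a" "a + e \<le> b" "H b - H a < 1 / real (Suc n)" "\<not> (\<exists>s\<in>gaps e. near a s r)"
        using neg by blast
      let ?k = "- \<lfloor>a\<rfloor>"
      have "H (a + e) \<le> H b" by (rule H_mono[OF ab(2)])
      moreover have "H (a + of_int ?k + e) - H (a + of_int ?k) = H (a + e) - H a"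
        using H_add_int[of a ?k] H_add_int[of "a + e" ?k] by (simp add: algebra_simps)
      ultimately have "H (a + of_int ?k + e) - H (a + of_int ?k) < 1 / real (Suc n)" using ab(3) by linarith
      moreover have "\<not> (\<exists>s\<in>gaps e. near (a + of_int ?k) s r)"
      proof
        assume "\<exists>s\<in>gaps e. near (a + of_int ?k) s r"
        then obtain s j where "s \<in> gaps e" "\<bar>a + of_int ?k - s - of_int j\<bar> < r" unfolding near_def by blast
        then have "\<bar>a - s - of_int (j - ?k)\<bar> < r" by (simp add: algebra_simps)
        then have "near a s r" unfolding near_def by blast
        with \<open>s \<in> gaps e\<close> ab(4) show False by blast
      qed
      moreover have "a + of_int ?k \<in> {0..1}" by simp linarith
      ultimately show ?thesis using lend_shift[OF ab(1), of ?k] by blast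
    qed
    then obtain a where a: "\<And>n. lend (a n)" "\<And>n. a n \<in> {0..1}" "\<And>n. H (a n + e) - H (a n) < 1 / real (Suc n)"
      "\<And>n. \<not> (\<exists>s\<in>gaps e. near (a n) s r)" by metis
    obtain \<alpha> q where q: "\<alpha> \<in> {0..1}" "strict_mono q" "(a \<circ> q) \<longlonglongrightarrow> \<alpha>"
      using compact_Icc[of "0::real" 1] a(2) unfolding compact_eq_seq_compact_metric seq_compact_def by meson
    have ql: "(\<lambda>n. a (q n)) \<longlonglongrightarrow> \<alpha>" using q(3) by (simp add: comp_def)
    have lim: "(\<lambda>n. H (a (q n) + e) - H (a (q n))) \<longlonglongrightarrow> H (\<alpha> + e) - H \<alpha>"
      by (intro tendsto_diff isCont_tendsto_compose[OF H_isCont] tendsto_add ql tendsto_const)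
    have "(\<lambda>n. 1 / real (Suc (q n))) \<longlonglongrightarrow> 0"
      using LIMSEQ_subseq_LIMSEQ[OF lim_const_over_Suc[of 1] q(2)] by (simp add: comp_def)
    then have "H (\<alpha> + e) - H \<alpha> \<le> 0"
      by (intro tendsto_le[OF _ _ lim]) (use a(3) in \<open>auto intro!: always_eventually less_imp_le\<close>)
    then have flat: "H (\<alpha> + e) = H \<alpha>" using H_mono[of \<alpha> "\<alpha> + e"] e by simp
    \<comment> \<open>Otherwise the flat stretch would begin at some \<open>t\<close> before
      \<open>\<alpha>\<close>, and some \<open>a (q n)\<close> would lie in its interior, although
      it is the leftmost point of its own level.\<close>
    have "lend \<alpha>"
      unfolding lend_def
    proof (intro allI impI, rule ccontr)
      fix t assume t: "t < \<alpha>" "\<not> H t < H \<alpha>"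
      then have Ht: "H t = H \<alpha>" using H_mono[of t \<alpha>] by simp
      have "eventually (\<lambda>n. t < a (q n)) sequentially" "eventually (\<lambda>n. a (q n) < \<alpha> + e) sequentially"
        using ql t(1) e by (auto intro: order_tendstoD)
      from eventually_happens'[OF sequentially_bot eventually_conj[OF this]]
      obtain n where n: "t < a (q n)" "a (q n) < \<alpha> + e" by blast
      have "H t < H (a (q n))" using a(1) n by (simp add: lend_def)
      moreover have "H (a (q n)) \<le> H (\<alpha> + e)" using n by (intro H_mono) simp
      ultimately show False using Ht flat by simp
    qed
    define s where "s = \<alpha> + of_int (- \<lfloor>\<alpha>\<rfloor>)"
    have "s \<in> gaps e"
    proof -
      have "lend s" unfolding s_def by (rule lend_shift[OF \<open>lend \<alpha>\<close>])
      moreover have "H (s + e) = H s"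
        using flat H_add_int[of "\<alpha> + e" "- \<lfloor>\<alpha>\<rfloor>"] H_add_int[of \<alpha> "- \<lfloor>\<alpha>\<rfloor>"]
        by (simp add: s_def algebra_simps)
      moreover have "0 \<le> s" "s < 1" unfolding s_def by (simp_all, linarith)
      ultimately show ?thesis by (simp add: gaps_def)
    qed
    obtain n where n: "dist (a (q n)) \<alpha> < r"
      using eventually_happens'[OF sequentially_bot tendstoD[OF ql r]] by blast
    then have "\<bar>a (q n) - s - of_int \<lfloor>\<alpha>\<rfloor>\<bar> < r" by (simp add: s_def dist_real_def)
    then have "near (a (q n)) s r" unfolding near_def by blast
    with \<open>s \<in> gaps e\<close> a(4) show False by blast
  qed
  then show ?thesis using that by blast
qed

lemma AE_supp: "AE \<omega> in P. \<forall>i. \<omega> i \<in> set_pmf \<mu>"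
  unfolding AE_all_countable
  by (intro allI AE_PiM_component) (auto simp: AE_measure_pmf measure_pmf.prob_space_axioms)

text \<open>One radius for each density \<open>1 / Suc i\<close> leaves only countably many almost
  sure events to intersect.\<close>

lemma near_scales:
  obtains r :: "nat \<Rightarrow> real" where "\<And>i. r i > 0"
    "\<And>i x z. AE \<omega> in P. rare {n. near (W \<omega> n x) (z n) (r i)} (1 / real (Suc i))"
proof -
  have "\<exists>r>0. \<forall>x z. AE \<omega> in P. rare {n. near (W \<omega> n x) (z n) r} (1 / real (Suc i))" for i
    by (rule AE_rare_near[of "1 / real (Suc i)"]) auto
  then have "\<exists>r. \<forall>i. r i > 0 \<and> (\<forall>x z. AE \<omega> in P. rare {n. near (W \<omega> n x) (z n) (r i)} (1 / real (Suc i)))"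
    by (intro choice allI)
  then show ?thesis using that by blast
qed

text \<open>Once the height of the arc is small, the arc can only be long when the left end point of its
  (saturated) image comes close to one of finitely many points.\<close>

lemma AE_contraction:
  "AE \<omega> in P. (\<lambda>n. M x y n \<omega>) \<longlonglongrightarrow> 0 \<longrightarrow> (\<forall>e>0. rare {n. e \<le> W \<omega> n y - W \<omega> n x} 0)"
proof -
  obtain r where r: "\<And>i. r i > 0"
    "\<And>i x z. AE \<omega> in P. rare {n. near (W \<omega> n x) (z n) (r i)} (1 / real (Suc i))"
    by (rule near_scales) blast
  have "AE \<omega> in P. \<forall>i j. \<forall>s\<in>gaps (1 / real (Suc j)). rare {n. near (W \<omega> n (left x)) s (r i)} (1 / real (Suc i))"
    unfolding AE_all_countable
    by (intro allI AE_finite_allI finite_gaps r(2)) simp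
  with AE_supp show ?thesis
  proof eventually_elim
    case (elim \<omega>)
    show ?case
    proof (intro impI allI, rule rare_all_pos)
      fix e d :: real assume lim: "(\<lambda>n. M x y n \<omega>) \<longlonglongrightarrow> 0" and e: "0 < e" and d: "0 < d"
      \<comment> \<open>The length is rounded down to a reciprocal, so that the almost sure event
        involves only countably many sets \<open>gaps\<close>.\<close>
      obtain j where j: "1 / real (Suc j) < e" using e nat_approx_posE by blast
      define e' where "e' = 1 / real (Suc j)"
      have e': "e' > 0" by (simp add: e'_def)
      define m where "m = real (card (gaps e'))"
      obtain i where "1 / real (Suc i) < d / (m + 1)" using d nat_approx_posE[of "d / (m + 1)"] unfolding m_def by (metis divide_pos_pos of_nat_0_le_iff add_nonneg_pos zero_less_one)
      then have i: "m * (1 / real (Suc i)) \<le> d"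
      proof -
        assume *: "1 / real (Suc i) < d / (m + 1)"
        have m0: "0 \<le> m" by (simp add: m_def)
        have "m * (1 / real (Suc i)) \<le> (m + 1) * (1 / real (Suc i))" by (intro mult_right_mono) auto
        also have "\<dots> \<le> (m + 1) * (d / (m + 1))" using * m0 by (intro mult_left_mono) auto
        also have "\<dots> = d" using m0 by simp
        finally show ?thesis .
      qed
      obtain \<eta> where \<eta>: "\<eta> > 0" "\<And>a b. lend a \<Longrightarrow> a + e' \<le> b \<Longrightarrow> H b - H a < \<eta> \<Longrightarrow> \<exists>s\<in>gaps e'. near a s (r i)"
        by (rule long_arc_near_gap[OF e' r(1)]) blast
      have "eventually (\<lambda>n. n \<notin> {n. \<not> M x y n \<omega> < \<eta>}) sequentially"
        using order_tendstoD(2)[OF lim \<eta>(1)] by simp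
      then have "rare {n. \<not> M x y n \<omega> < \<eta>} 0" by (rule rare_eventually_not)
      moreover have "rare (\<Union>s\<in>gaps e'. {n. near (W \<omega> n (left x)) s (r i)}) (m * (1 / real (Suc i)))"
        unfolding m_def using elim(2) by (intro rare_UN finite_gaps[OF e']) (simp add: e'_def)
      ultimately have "rare ({n. \<not> M x y n \<omega> < \<eta>} \<union> (\<Union>s\<in>gaps e'. {n. near (W \<omega> n (left x)) s (r i)})) (0 + m * (1 / real (Suc i)))"
        by (rule rare_Un)
      moreover have "{n. e \<le> W \<omega> n y - W \<omega> n x} \<subseteq> {n. \<not> M x y n \<omega> < \<eta>} \<union> (\<Union>s\<in>gaps e'. {n. near (W \<omega> n (left x)) s (r i)})"
      proof
        fix n assume n: "n \<in> {n. e \<le> W \<omega> n y - W \<omega> n x}"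
        show "n \<in> {n. \<not> M x y n \<omega> < \<eta>} \<union> (\<Union>s\<in>gaps e'. {n. near (W \<omega> n (left x)) s (r i)})"
        proof (cases "M x y n \<omega> < \<eta>")
          case True
          have "lend (W \<omega> n (left x))" using elim(1) left(3) by (intro lend_W) auto
          moreover have "W \<omega> n (left x) + e' \<le> W \<omega> n y"
            using n j W_mono[OF left(2), of \<omega> n x] by (simp add: e'_def)
          moreover have "H (W \<omega> n y) - H (W \<omega> n (left x)) < \<eta>"
            using True H_level_W[of \<omega> "left x" x n] elim(1) left(1) by (simp add: M_def)
          ultimately show ?thesis using \<eta>(2) by blast
        qed simp
      qed
      ultimately show "rare {n. e \<le> W \<omega> n y - W \<omega> n x} d"
        using i by (elim rare_mono) auto
    qed
  qed
qed

end

section \<open>North-south dynamics of one walk\<close>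

lemma near_shift: "near (x + of_int k) z r \<longleftrightarrow> near x z r"
proof -
  have *: "near (x + of_int k) z r" if n: "near x z r" for x and k :: int
  proof -
    obtain j :: int where "\<bar>x - z - of_int j\<bar> < r" using n unfolding near_def by blast
    then have "\<bar>x + of_int k - z - of_int (j + k)\<bar> < r" by simp
    then show ?thesis unfolding near_def by blast
  qed
  from *[of x k] *[of "x + of_int k" "- k"] show ?thesis by auto
qed

lemma near_sym: "near x z r \<Longrightarrow> near z x r"
proof -
  assume "near x z r"
  then obtain j :: int where "\<bar>x - z - of_int j\<bar> < r" unfolding near_def by blast
  then have "\<bar>z - x - of_int (- j)\<bar> < r" by simp
  then show ?thesis unfolding near_def by blast
qed

lemma near_triangle: "near x y r \<Longrightarrow> near y z s \<Longrightarrow> near x z (r + s)"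
proof -
  assume "near x y r" "near y z s"
  then obtain i j :: int where "\<bar>x - y - of_int i\<bar> < r" "\<bar>y - z - of_int j\<bar> < s" unfolding near_def by blast
  then have "\<bar>x - z - of_int (i + j)\<bar> < r + s" by simp
  then show ?thesis unfolding near_def by blast
qed

lemma near_close: "\<bar>x - z\<bar> < r \<Longrightarrow> near x z r"
  unfolding near_def by (rule exI[of _ 0]) simp

lemma of_rat_grid: "(of_rat (of_int j / of_int m) :: real) = of_int j / of_int m"
  by (simp add: of_rat_divide)

lemma grid_shift: "m > 0 \<Longrightarrow> (of_int (j + k * m) / of_int m :: real) = of_int j / of_int m + of_int k"
  by (simp add: field_simps)

context circle_walk
begin

definition badj :: "int \<Rightarrow> (nat \<Rightarrow> 'a) \<Rightarrow> int \<Rightarrow> bool" where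
  "badj m \<omega> j \<longleftrightarrow> bad (of_int j / of_int m) (of_int (j + 1) / of_int m) \<omega>"

definition badset :: "int \<Rightarrow> (nat \<Rightarrow> 'a) \<Rightarrow> int set" where
  "badset m \<omega> = {j\<in>{0..<m}. badj m \<omega> j}"

text \<open>Rational end points cover all grids at once while keeping a single null set.\<close>

definition regular :: "(nat \<Rightarrow> 'a) \<Rightarrow> bool" where
  "regular \<omega> \<longleftrightarrow> (\<forall>x y::rat. of_rat x \<le> (of_rat y :: real) \<longrightarrow>
     (\<not> bad (of_rat x) (of_rat y) \<omega> \<longrightarrow> (\<lambda>n. M (of_rat x) (of_rat y) n \<omega>) \<longlonglongrightarrow> 0) \<and>
     ((\<lambda>n. M (of_rat x) (of_rat y) n \<omega>) \<longlonglongrightarrow> 0 \<longrightarrow>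
        (\<forall>e>0. rare {n. e \<le> W \<omega> n (of_rat y) - W \<omega> n (of_rat x)} 0)))"

lemma AE_regular: "AE \<omega> in P. regular \<omega>"
  unfolding regular_def AE_all_countable
proof (intro allI)
  fix x y :: rat
  show "AE \<omega> in P. of_rat x \<le> (of_rat y :: real) \<longrightarrow>
     (\<not> bad (of_rat x) (of_rat y) \<omega> \<longrightarrow> (\<lambda>n. M (of_rat x) (of_rat y) n \<omega>) \<longlonglongrightarrow> 0) \<and>
     ((\<lambda>n. M (of_rat x) (of_rat y) n \<omega>) \<longlonglongrightarrow> 0 \<longrightarrow>
        (\<forall>e>0. rare {n. e \<le> W \<omega> n (of_rat y) - W \<omega> n (of_rat x)} 0))"
  proof (cases "of_rat x \<le> (of_rat y :: real)")
    case True
    show ?thesis using AE_good[OF True] AE_contraction[of "of_rat x" "of_rat y"]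
      by eventually_elim blast
  qed simp
qed

lemma regular_good:
  assumes "regular \<omega>" "m > 0" "\<not> badj m \<omega> j"
  shows "(\<lambda>n. M (of_int j / of_int m) (of_int (j + 1) / of_int m) n \<omega>) \<longlonglongrightarrow> 0"
proof -
  have "of_rat (of_int j / of_int m) \<le> (of_rat (of_int (j + 1) / of_int m) :: real)"
    unfolding of_rat_grid using assms(2) by (simp add: divide_right_mono)
  then show ?thesis
    using assms(1)[unfolded regular_def, rule_format, of "of_int j / of_int m" "of_int (j + 1) / of_int m"] assms(3)
    unfolding of_rat_grid badj_def by blast
qed

lemma regular_contracts:
  assumes "regular \<omega>" "m > 0" "p \<le> q" "(\<lambda>n. M (of_int p / of_int m) (of_int q / of_int m) n \<omega>) \<longlonglongrightarrow> 0" "e > 0"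
  shows "rare {n. e \<le> W \<omega> n (of_int q / of_int m) - W \<omega> n (of_int p / of_int m)} 0"
proof -
  have "of_rat (of_int p / of_int m) \<le> (of_rat (of_int q / of_int m) :: real)"
    unfolding of_rat_grid using assms(2,3) by (simp add: divide_right_mono)
  then show ?thesis
    using assms(1)[unfolded regular_def, rule_format, of "of_int p / of_int m" "of_int q / of_int m"] assms(4,5)
    unfolding of_rat_grid by blast
qed

lemma M_chain: "M x y n \<omega> + M y z n \<omega> = M x z n \<omega>"
  by (simp add: M_def)

lemma good_run:
  assumes "regular \<omega>" "m > 0" "\<And>i. p \<le> i \<Longrightarrow> i < p + int k \<Longrightarrow> \<not> badj m \<omega> i"
  shows "(\<lambda>n. M (of_int p / of_int m) (of_int (p + int k) / of_int m) n \<omega>) \<longlonglongrightarrow> 0"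
  using assms(3)
proof (induction k)
  case 0
  then show ?case by (simp add: M_def)
next
  case (Suc k)
  have "(\<lambda>n. M (of_int p / of_int m) (of_int (p + int k) / of_int m) n \<omega>
      + M (of_int (p + int k) / of_int m) (of_int (p + int k + 1) / of_int m) n \<omega>) \<longlonglongrightarrow> 0 + 0"
    by (intro tendsto_add Suc.IH regular_good assms(1,2)) (use Suc.prems in auto)
  then show ?case unfolding M_chain by (simp add: algebra_simps)
qed

lemma M_unit: "M 0 1 n \<omega> = 1"
  using W_add_int[of \<omega> n 0 1] H_add_int[of "W \<omega> n 0" 1] by (simp add: M_def)

lemma finite_badset: "finite (badset m \<omega>)"
  by (rule finite_subset[of _ "{0..<m}"]) (auto simp: badset_def)

text \<open>Otherwise the heights of all arcs of the grid would tend to 0, although a full turn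
  always has height 1.\<close>

lemma badset_nonempty:
  assumes "regular \<omega>" "m > 0"
  shows "badset m \<omega> \<noteq> {}"
proof
  assume "badset m \<omega> = {}"
  then have "(\<lambda>n. M (of_int 0 / of_int m) (of_int (0 + int (nat m)) / of_int m) n \<omega>) \<longlonglongrightarrow> 0"
    using assms by (intro good_run) (auto simp: badset_def)
  then have "(\<lambda>n. 1 :: real) \<longlonglongrightarrow> 0" using assms(2) by (simp add: M_unit)
  then show False by (simp add: LIMSEQ_const_iff)
qed

lemma sum_M_grid:
  assumes "m > 0"
  shows "(\<Sum>j\<in>{0..<m}. M (of_int j / of_int m) (of_int (j + 1) / of_int m) n \<omega>) = 1"
proof -
  have "(\<Sum>j\<in>{0..<m}. M (of_int j / of_int m) (of_int (j + 1) / of_int m) n \<omega>)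
      = (\<Sum>j<nat m. M (of_int (int j) / of_int m) (of_int (int j + 1) / of_int m) n \<omega>)"
    by (rule sum.reindex_bij_witness[of _ int nat]) auto
  also have "\<dots> = M 0 (of_int (int (nat m)) / of_int m) n \<omega>"
  proof -
    have "(\<Sum>j<k. M (of_int (int j) / of_int m) (of_int (int j + 1) / of_int m) n \<omega>) = M 0 (of_int (int k) / of_int m) n \<omega>" for k
    proof (induction k)
      case (Suc k)
      then show ?case using M_chain[of 0 "of_int (int k) / of_int m" n \<omega> "of_int (int k + 1) / of_int m"]
        by (simp add: algebra_simps)
    qed (simp add: M_def)
    then show ?thesis .
  qed
  also have "\<dots> = 1" using assms by (simp add: M_unit)
  finally show ?thesis .
qed

text \<open>At a late time every bad arc carries height at least \<open>gap / 2\<close> out of a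
  total of 1. The bound is the same for every \<open>m\<close>.\<close>

lemma card_badset:
  assumes "m > 0"
  shows "real (card (badset m \<omega>)) \<le> 2 / gap"
proof -
  have "\<exists>N. \<forall>n\<ge>N. gap / 2 \<le> M (of_int j / of_int m) (of_int (j + 1) / of_int m) n \<omega>" if "j \<in> badset m \<omega>" for j
    using that by (simp add: badset_def badj_def bad_def)
  then have "eventually (\<lambda>n. \<forall>j\<in>badset m \<omega>. gap / 2 \<le> M (of_int j / of_int m) (of_int (j + 1) / of_int m) n \<omega>) sequentially"
    by (intro eventually_ball_finite finite_badset) (simp add: eventually_sequentially)
  then obtain n where n: "\<And>j. j \<in> badset m \<omega> \<Longrightarrow> gap / 2 \<le> M (of_int j / of_int m) (of_int (j + 1) / of_int m) n \<omega>"
    unfolding eventually_sequentially by blast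
  have "real (card (badset m \<omega>)) * (gap / 2) = (\<Sum>j\<in>badset m \<omega>. gap / 2)" by simp
  also have "\<dots> \<le> (\<Sum>j\<in>badset m \<omega>. M (of_int j / of_int m) (of_int (j + 1) / of_int m) n \<omega>)"
    by (intro sum_mono n)
  also have "\<dots> \<le> (\<Sum>j\<in>{0..<m}. M (of_int j / of_int m) (of_int (j + 1) / of_int m) n \<omega>)"
    by (rule sum_mono2) (use assms in \<open>auto simp: badset_def intro!: M_nonneg divide_right_mono\<close>)
  also have "\<dots> = 1" by (rule sum_M_grid[OF assms])
  finally show ?thesis using gap_pos by (simp add: field_simps)
qed

lemma badj_periodic: 
  assumes "m > 0" shows "badj m \<omega> (j + k * m) \<longleftrightarrow> badj m \<omega> j"
proof -
  have "(of_int (j + k * m + 1) / of_int m :: real) = of_int (j + 1) / of_int m + of_int k"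
    using grid_shift[OF assms, of "j + 1" k] by (simp add: algebra_simps)
  then show ?thesis unfolding badj_def grid_shift[OF assms] by (simp only: bad_shift)
qed

lemma badj_mod: "m > 0 \<Longrightarrow> badj m \<omega> j \<longleftrightarrow> j mod m \<in> badset m \<omega>"
  using badj_periodic[of m \<omega> "j mod m" "j div m"] by (simp add: badset_def)

text \<open>A point \<open>x\<close> far from the bad arcs lies in a good arc of the grid. Going
  left from there to the last bad arc, one crosses only good arcs; their union is contracted at most
  times, so the image of \<open>x\<close> is close to that of the right end point of this bad
  arc.\<close>

lemma north_south:
  assumes \<omega>: "regular \<omega>" and m: "m > 0"
  shows "rare {n. \<not> (\<forall>x. (\<forall>j\<in>badset m \<omega>. \<not> near x (of_int j / of_int m) (2 / of_int m)) \<longrightarrow>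
     (\<exists>j\<in>badset m \<omega>. near (W \<omega> n x) (W \<omega> n (of_int (j + 1) / of_int m)) (2 / of_int m)))} 0"
proof -
  \<comment> \<open>Up to integer translation a run of good arcs starts in \<open>{0..m}\<close>; it
    has fewer than \<open>m\<close> arcs because a bad one occurs in every period. Hence finitely
    many pairs suffice.\<close>
  define I where "I = {(p, q). p \<in> {0..m} \<and> q \<in> {0..2 * m} \<and> p \<le> q \<and> (\<forall>i. p \<le> i \<longrightarrow> i < q \<longrightarrow> \<not> badj m \<omega> i)}"
  have "I \<subseteq> {0..m} \<times> {0..2 * m}" by (auto simp: I_def)
  then have fin: "finite I" by (rule finite_subset) simp
  define A where "A = (\<lambda>(p, q). {n. 2 / of_int m \<le> W \<omega> n (of_int q / of_int m) - W \<omega> n (of_int p / of_int m)})"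
  have "rare (A pq) 0" if "pq \<in> I" for pq
  proof -
    obtain p q where pq: "pq = (p, q)" by (cases pq)
    then have *: "p \<le> q" "\<And>i. p \<le> i \<Longrightarrow> i < q \<Longrightarrow> \<not> badj m \<omega> i" using that by (auto simp: I_def)
    have "(\<lambda>n. M (of_int p / of_int m) (of_int (p + int (nat (q - p))) / of_int m) n \<omega>) \<longlonglongrightarrow> 0"
      by (rule good_run[OF \<omega> m]) (use * in auto)
    then have "(\<lambda>n. M (of_int p / of_int m) (of_int q / of_int m) n \<omega>) \<longlonglongrightarrow> 0" using * by simp
    then show ?thesis unfolding A_def pq using m by (simp add: regular_contracts[OF \<omega> m *(1)])
  qed
  then have "rare (\<Union>pq\<in>I. A pq) (real (card I) * 0)" by (intro rare_UN fin)
  then show ?thesis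
  proof (rule rare_mono)
    show "{n. \<not> (\<forall>x. (\<forall>j\<in>badset m \<omega>. \<not> near x (of_int j / of_int m) (2 / of_int m)) \<longrightarrow>
     (\<exists>j\<in>badset m \<omega>. near (W \<omega> n x) (W \<omega> n (of_int (j + 1) / of_int m)) (2 / of_int m)))} \<subseteq> (\<Union>pq\<in>I. A pq)"
    proof (rule subsetI, rule ccontr)
      fix n assume n: "n \<in> {n. \<not> (\<forall>x. (\<forall>j\<in>badset m \<omega>. \<not> near x (of_int j / of_int m) (2 / of_int m)) \<longrightarrow>
        (\<exists>j\<in>badset m \<omega>. near (W \<omega> n x) (W \<omega> n (of_int (j + 1) / of_int m)) (2 / of_int m)))}"
      assume nA: "n \<notin> (\<Union>pq\<in>I. A pq)"
      obtain x where x: "\<And>j. j \<in> badset m \<omega> \<Longrightarrow> \<not> near x (of_int j / of_int m) (2 / of_int m)"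
        "\<And>j. j \<in> badset m \<omega> \<Longrightarrow> \<not> near (W \<omega> n x) (W \<omega> n (of_int (j + 1) / of_int m)) (2 / of_int m)"
        using n by blast
      have mr: "(0::real) < of_int m" using m by simp
      define i where "i = \<lfloor>of_int m * x\<rfloor>"
      have i: "of_int i / of_int m \<le> x" "x < of_int (i + 1) / of_int m"
        unfolding i_def using mr by (simp_all add: field_simps) linarith+
      have nbad: "\<not> badj m \<omega> i"
      proof
        assume "badj m \<omega> i"
        then have "i mod m \<in> badset m \<omega>" by (simp add: badj_mod[OF m])
        moreover have "near x (of_int (i mod m) / of_int m) (2 / of_int m)"
        proof -
          have "of_int i / of_int m = of_int (i mod m) / of_int m + (of_int (i div m) :: real)"
            using grid_shift[OF m, of "i mod m" "i div m"] by simp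
          moreover have "\<bar>x - of_int i / of_int m\<bar> < 2 / of_int m"
            using i mr by (simp add: add_divide_distrib) 
          ultimately have "\<bar>x - of_int (i mod m) / of_int m - of_int (i div m)\<bar> < 2 / of_int m" by (simp add: algebra_simps)
          then show ?thesis unfolding near_def by blast
        qed
        ultimately show False using x(1) by blast
      qed
      let ?S = "{j\<in>{i - m<..i}. badj m \<omega> j}"
      have finS: "finite ?S" by (rule finite_subset[of _ "{i - m<..i}"]) auto
      have "?S \<noteq> {}"
      proof -
        obtain b where b: "b \<in> badset m \<omega>" using badset_nonempty[OF \<omega> m] by blast
        \<comment> \<open>The last index up to \<open>i\<close> that is congruent to
          \<open>b\<close> modulo \<open>m\<close>.\<close>
        define j where "j = i - (i - b) mod m"
        have "j = b + ((i - b) div m) * m"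
          using div_mult_mod_eq[of "i - b" m] unfolding j_def by linarith
        then have "badj m \<omega> j" using badj_periodic[OF m] b by (simp add: badset_def)
        moreover have "j \<in> {i - m<..i}"
          using pos_mod_bound[OF m, of "i - b"] pos_mod_sign[OF m, of "i - b"] by (simp add: j_def)
        ultimately show ?thesis by blast
      qed
      define j where "j = Max ?S"
      have "j \<in> ?S" unfolding j_def by (rule Max_in[OF finS \<open>?S \<noteq> {}\<close>])
      then have j: "i - m < j" "j \<le> i" "badj m \<omega> j" by auto
      have jmax: "\<not> badj m \<omega> l" if "j < l" "l \<le> i" for l
      proof
        assume "badj m \<omega> l"
        then have "l \<le> j" unfolding j_def using that j by (intro Max_ge finS) auto
        with that show False by simp
      qed
      have ji: "j < i" using j nbad by (cases "j = i") auto
      define k where "k = j div m"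
      define j0 where "j0 = j mod m"
      have jk: "j = j0 + k * m" by (simp add: j0_def k_def)
      have j0: "j0 \<in> badset m \<omega>" "0 \<le> j0" "j0 < m" using j(3) m badj_mod[OF m] by (auto simp: j0_def)
      define q where "q = i + 1 - k * m"
      have I: "(j0 + 1, q) \<in> I"
      proof -
        have "\<not> badj m \<omega> l" if "j0 + 1 \<le> l" "l < q" for l
          using jmax[of "l + k * m"] that badj_periodic[OF m, of \<omega> l k] by (simp add: jk q_def)
        then show ?thesis using j0 ji j(1) by (auto simp: I_def q_def jk)
      qed
      then have small: "W \<omega> n (of_int q / of_int m) - W \<omega> n (of_int (j0 + 1) / of_int m) < 2 / of_int m"
        using nA by (force simp: A_def not_le)
      let ?x = "x + of_int (- k)"
      have "of_int (j0 + 1) / of_int m \<le> ?x" "?x \<le> of_int q / of_int m"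
      proof -
        have "of_int (j0 + 1) / of_int m + of_int k \<le> (of_int i / of_int m :: real)"
        proof -
          have "(of_int (j0 + 1 + k * m) :: real) \<le> of_int i" unfolding of_int_le_iff using ji by (simp add: jk)
          then show ?thesis unfolding grid_shift[OF m, symmetric] using mr by (intro divide_right_mono) auto
        qed
        then show "of_int (j0 + 1) / of_int m \<le> ?x" using i(1) by simp
        have "of_int q / of_int m + of_int k = (of_int (i + 1) / of_int m :: real)"
          unfolding grid_shift[OF m, symmetric] by (simp add: q_def)
        then show "?x \<le> of_int q / of_int m" using i(2) by simp
      qed
      then have "W \<omega> n (of_int (j0 + 1) / of_int m) \<le> W \<omega> n ?x" "W \<omega> n ?x \<le> W \<omega> n (of_int q / of_int m)"
        by (auto intro: W_mono)
      with small have "near (W \<omega> n ?x) (W \<omega> n (of_int (j0 + 1) / of_int m)) (2 / of_int m)"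
        by (intro near_close) linarith
      then have "near (W \<omega> n x) (W \<omega> n (of_int (j0 + 1) / of_int m)) (2 / of_int m)"
        unfolding W_add_int near_shift .
      with x(2)[OF j0(1)] show False by blast
    qed
  qed simp
qed

end

section \<open>Two independent walks\<close>

definition nbhd :: "real set \<Rightarrow> real \<Rightarrow> real set" where
  "nbhd A r = {x. \<exists>c\<in>A. near x c r}"

lemma nbhd_disjoint:
  assumes "\<And>a b. a \<in> A \<Longrightarrow> b \<in> B \<Longrightarrow> \<not> near a b (2 * r)"
  shows "nbhd A r \<inter> nbhd B r = {}"
proof (rule ccontr)
  assume "nbhd A r \<inter> nbhd B r \<noteq> {}"
  then obtain x a b where "a \<in> A" "b \<in> B" "near x a r" "near x b r" by (auto simp: nbhd_def)
  with near_triangle[OF near_sym, of x a r b r] assms show False by force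
qed

definition lifted_ping_pong :: "(real \<Rightarrow> real) \<Rightarrow> (real \<Rightarrow> real) \<Rightarrow> bool" where
  "lifted_ping_pong F G \<longleftrightarrow> (\<exists>A1 A2 B1 B2 r.
     nbhd A1 r \<inter> nbhd A2 r = {} \<and> nbhd A1 r \<inter> nbhd B1 r = {} \<and> nbhd A1 r \<inter> nbhd B2 r = {} \<and>
     nbhd A2 r \<inter> nbhd B1 r = {} \<and> nbhd A2 r \<inter> nbhd B2 r = {} \<and> nbhd B1 r \<inter> nbhd B2 r = {} \<and>
     (\<forall>x. x \<notin> nbhd A1 r \<longrightarrow> F x \<in> nbhd B1 r) \<and> (\<forall>x. x \<notin> nbhd A2 r \<longrightarrow> G x \<in> nbhd B2 r))"

text \<open>The set where \<open>Q\<close> holds may fail to be measurable; a measurable null set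
  containing the exceptions is multiplied by the whole second space.\<close>

lemma AE_pair_fst:
  assumes "prob_space A" "prob_space B" "AE x in A. Q x"
  shows "AE p in A \<Otimes>\<^sub>M B. Q (fst p)"
proof -
  interpret B: prob_space B by fact
  obtain N where N: "{x\<in>space A. \<not> Q x} \<subseteq> N" "emeasure A N = 0" "N \<in> sets A"
    using assms(3) by (rule AE_E)
  have "emeasure (A \<Otimes>\<^sub>M B) (N \<times> space B) = 0"
    using N by (subst B.emeasure_pair_measure_Times) auto
  then show ?thesis
    by (intro AE_I[of _ _ "N \<times> space B"]) (use N in \<open>auto simp: space_pair_measure\<close>)
qed

lemma AE_pair_snd:
  assumes "prob_space A" "prob_space B" "AE x in B. Q x"
  shows "AE p in A \<Otimes>\<^sub>M B. Q (snd p)"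
proof -
  interpret B: prob_space B by fact
  obtain N where N: "{x\<in>space B. \<not> Q x} \<subseteq> N" "emeasure B N = 0" "N \<in> sets B"
    using assms(3) by (rule AE_E)
  have "emeasure (A \<Otimes>\<^sub>M B) (space A \<times> N) = 0"
    using N by (subst B.emeasure_pair_measure_Times) auto
  then show ?thesis
    by (intro AE_I[of _ _ "space A \<times> N"]) (use N in \<open>auto simp: space_pair_measure\<close>)
qed

text \<open>Countably many slopes in place of all \<open>e > \<delta>\<close> exhibit rarity as a
  measurable event for \<open>AE_cross\<close>.\<close>

lemma rare_iff_countable:
  "rare {n. Q n} \<delta> \<longleftrightarrow> (\<forall>i::nat. \<exists>N0. \<forall>N\<ge>N0. (\<Sum>n\<le>N. of_bool (Q n)) \<le> (\<delta> + 1 / real (Suc i)) * real N)"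
proof -
  have card: "real (card ({n. Q n} \<inter> {..N})) = (\<Sum>n\<le>N. of_bool (Q n))" for N
    by (simp add: Int_commute)
  show ?thesis
  proof
    assume "rare {n. Q n} \<delta>"
    then show "\<forall>i::nat. \<exists>N0. \<forall>N\<ge>N0. (\<Sum>n\<le>N. of_bool (Q n)) \<le> (\<delta> + 1 / real (Suc i)) * real N"
      unfolding rare_def card eventually_sequentially by simp
  next
    assume *: "\<forall>i::nat. \<exists>N0. \<forall>N\<ge>N0. (\<Sum>n\<le>N. of_bool (Q n)) \<le> (\<delta> + 1 / real (Suc i)) * real N"
    show "rare {n. Q n} \<delta>"
      unfolding rare_def card
    proof (intro allI impI)
      fix e assume "\<delta> < e"
      then obtain i where i: "1 / real (Suc i) < e - \<delta>" using nat_approx_posE[of "e - \<delta>"] by auto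
      obtain N0 where N0: "\<And>N. N \<ge> N0 \<Longrightarrow> (\<Sum>n\<le>N. of_bool (Q n)) \<le> (\<delta> + 1 / real (Suc i)) * real N"
        using * by blast
      have "(\<delta> + 1 / real (Suc i)) * real N \<le> e * real N" for N
        using i by (intro mult_right_mono) auto
      with N0 show "eventually (\<lambda>N. (\<Sum>n\<le>N. of_bool (Q n)) \<le> e * real N) sequentially"
        unfolding eventually_sequentially by (meson order_trans)
    qed
  qed
qed

locale two_walks = w1: circle_walk \<mu>1 \<phi>1 + w2: circle_walk \<mu>2 \<phi>2
  for \<mu>1 :: "'a::countable pmf" and \<phi>1 and \<mu>2 :: "'b::countable pmf" and \<phi>2
begin

sublocale PP: pair_prob_space w1.P w2.P ..

abbreviation PQ :: "((nat \<Rightarrow> 'a) \<times> (nat \<Rightarrow> 'b)) measure" where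
  "PQ \<equiv> w1.P \<Otimes>\<^sub>M w2.P"

text \<open>The arc from \<open>(j - 4) / m\<close> to \<open>(j + 5) / m\<close> contains every arc of the grid whose left end point is at distance
  less than \<open>4 / m\<close> from \<open>j / m\<close>.\<close>

definition close_bad :: "nat \<Rightarrow> ((nat \<Rightarrow> 'a) \<times> (nat \<Rightarrow> 'b)) set" where
  "close_bad m = (\<Union>j\<in>{0..<int m}. {\<omega>. w1.badj (int m) \<omega> j} \<times>
     {\<omega>. w2.bad (of_int (j - 4) / of_int (int m)) (of_int (j + 5) / of_int (int m)) \<omega>})"

lemma close_bad_sets: "close_bad m \<in> sets PQ"
  unfolding close_bad_def w1.badj_def
  by (intro sets.finite_UN pair_measureI w1.bad_sets w2.bad_sets) simp

text \<open>Independence bounds the probability for each \<open>j\<close> by a product. The first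
  factors are increments of \<open>w1.H\<close>, which sum to 1 over the grid; the second ones are
  uniformly small by uniform continuity of \<open>w2.H\<close>.\<close>

lemma prob_close_bad:
  assumes e: "e > 0"
  obtains m0 where "\<And>m. m \<ge> m0 \<Longrightarrow> measure PQ (close_bad m) \<le> e"
proof -
  define C where "C = (2 / w1.gap) * (2 / w2.gap)"
  have C: "C > 0" using w1.gap_pos w2.gap_pos by (simp add: C_def)
  \<comment> \<open>For \<open>0 \<le> j < m\<close> this interval contains all the widened arcs,
    whose length is \<open>9 / m\<close>.\<close>
  have "uniformly_continuous_on {-5..7} w2.H"
    by (rule compact_uniformly_continuous[OF continuous_on_subset[OF w2.H_cont]]) auto
  moreover have "0 < e / C" using e C by simp
  ultimately obtain d where d: "d > 0" "\<And>x y. x \<in> {-5..7} \<Longrightarrow> y \<in> {-5..7} \<Longrightarrow> dist y x < d \<Longrightarrow> dist (w2.H y) (w2.H x) < e / C"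
    unfolding uniformly_continuous_on_def by blast
  have "measure PQ (close_bad m) \<le> e" if m: "m \<ge> nat \<lceil>9 / d\<rceil> + 1" for m
  proof -
    have mp: "0 < int m" "0 < real m" "1 \<le> real m" using m by simp_all
    have "9 / d < real m" using m by linarith
    then have md: "9 / real m < d" using d(1) mp by (simp add: field_simps)
    let ?X = "\<lambda>j. {\<omega>. w1.badj (int m) \<omega> j}"
    let ?Y = "\<lambda>j. {\<omega>. w2.bad (of_int (j - 4) / of_int (int m)) (of_int (j + 5) / of_int (int m)) \<omega>}"
    have X: "?X j \<in> sets w1.P" for j unfolding w1.badj_def by (rule w1.bad_sets)
    have Y: "?Y j \<in> sets w2.P" for j by (rule w2.bad_sets)
    have XY: "measure PQ (?X j \<times> ?Y j) = measure w1.P (?X j) * measure w2.P (?Y j)" for j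
      using w2.seq.P.emeasure_pair_measure_Times[OF X Y] by (simp add: measure_def enn2real_mult)
    let ?D = "\<lambda>j. w1.H (of_int (j + 1) / of_int (int m)) - w1.H (of_int j / of_int (int m))"
    have PX: "measure w1.P (?X j) \<le> 2 / w1.gap * ?D j" for j
      unfolding w1.badj_def by (intro w1.prob_bad divide_right_mono) (use mp in auto)
    have PY: "measure w2.P (?Y j) \<le> 2 / w2.gap * (e / C)" if j: "j \<in> {0..<int m}" for j
    proof -
      let ?a = "of_int (j - 4) / of_int (int m) :: real" and ?b = "of_int (j + 5) / of_int (int m) :: real"
      have ab: "?a \<le> ?b" using mp by (intro divide_right_mono) auto
      have diff: "?b - ?a = 9 / real m" unfolding diff_divide_distrib[symmetric] by simp
      have j': "0 \<le> real_of_int j" "real_of_int j \<le> real m" using j by auto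
      have "-5 \<le> ?a" using j' mp by (simp add: field_simps)
      moreover have "?b \<le> 7" using j' mp by (simp add: field_simps)
      ultimately have "dist (w2.H ?b) (w2.H ?a) < e / C"
        using ab md diff by (intro d(2)) (auto simp: dist_real_def)
      then have "w2.H ?b - w2.H ?a \<le> e / C" by (simp add: dist_real_def)
      then have "2 / w2.gap * (w2.H ?b - w2.H ?a) \<le> 2 / w2.gap * (e / C)"
        using w2.gap_pos by (intro mult_left_mono) auto
      with w2.prob_bad[OF ab] show ?thesis by linarith
    qed
    have "measure PQ (close_bad m) \<le> (\<Sum>j\<in>{0..<int m}. measure PQ (?X j \<times> ?Y j))"
      unfolding close_bad_def
      by (rule PP.finite_measure_subadditive_finite) (use X Y in \<open>auto intro!: pair_measureI\<close>)
    also have "\<dots> \<le> (\<Sum>j\<in>{0..<int m}. (2 / w1.gap * ?D j) * (2 / w2.gap * (e / C)))"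
      unfolding XY
    proof (intro sum_mono mult_mono PX PY)
      show "0 \<le> 2 / w1.gap * ?D j" for j
        using order_trans[OF measure_nonneg PX] .
    qed auto
    also have "\<dots> = (\<Sum>j\<in>{0..<int m}. ?D j) * e"
      using C w1.gap_pos w2.gap_pos unfolding sum_distrib_right C_def by (intro sum.cong) (auto simp: field_simps)
    also have "(\<Sum>j\<in>{0..<int m}. ?D j) = 1"
      using w1.sum_M_grid[OF mp(1), of 0 undefined] by (simp add: w1.M_def)
    finally show ?thesis by simp
  qed
  then show ?thesis by (rule that)
qed

text \<open>The probabilities tend to 0 without a known rate, so only infinitely many good grids are
  obtained: failure for every \<open>m \<ge> m0\<close> has probability at most each single
  bound.\<close>

lemma AE_not_close_bad: "AE p in PQ. \<forall>m0. \<exists>m\<ge>m0. p \<notin> close_bad m"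
  unfolding AE_all_countable
proof
  fix m0
  let ?N = "\<Inter>m\<in>{m0..}. close_bad m"
  have "UNIV \<in> sets PQ" using sets.top[of PQ] by (simp add: space_pair_measure)
  then have N: "?N \<in> sets PQ" by (intro sets.countable_INT'') (auto intro: close_bad_sets)
  have "measure PQ ?N \<le> e" if e: "e > 0" for e
  proof -
    obtain m1 where m1: "\<And>m. m \<ge> m1 \<Longrightarrow> measure PQ (close_bad m) \<le> e" using prob_close_bad[OF e] by blast
    have "measure PQ ?N \<le> measure PQ (close_bad (max m0 m1))"
      by (rule PP.finite_measure_mono) (auto intro: close_bad_sets)
    with m1[of "max m0 m1"] show ?thesis by simp
  qed
  then have "measure PQ ?N = 0"
    by (metis dense_ge measure_nonneg order_antisym)
  then have "?N \<in> null_sets PQ" using N by (simp add: null_sets_def PP.emeasure_eq_measure)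
  then have "AE p in PQ. p \<notin> ?N" by (rule AE_not_in)
  then show "AE p in PQ. \<exists>m\<ge>m0. p \<notin> close_bad m" by eventually_elim auto
qed

text \<open>For a fixed path of the first walk its positions form a deterministic moving target for
  the second walk; Fubini then combines the fibres, given measurability of the joint event.\<close>

lemma AE_cross:
  assumes "\<And>z. AE \<omega> in w2.P. rare {n. near (w2.W \<omega> n y) (z n) r} \<delta>"
  shows "AE p in PQ. rare {n. near (w2.W (snd p) n y) (w1.W (fst p) n x) r} \<delta>"
proof (rule PP.AE_pair_measure)
  have m1: "(\<lambda>p. w1.W (fst p) n x) \<in> borel_measurable PQ" for n
    by (rule measurable_compose[OF measurable_fst w1.W_measurable])
  have m2: "(\<lambda>p. w2.W (snd p) n y) \<in> borel_measurable PQ" for n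
    by (rule measurable_compose[OF measurable_snd w2.W_measurable])
  have near0: "near a b r \<longleftrightarrow> near (a - b) 0 r" for a b by (simp add: near_def)
  have [measurable]: "(\<lambda>p. of_bool (near (w2.W (snd p) n y) (w1.W (fst p) n x) r) :: real) \<in> borel_measurable PQ" for n
    by (subst near0) (intro of_bool_near_measurable borel_measurable_diff m1 m2)
  show "{p \<in> space PQ. rare {n. near (w2.W (snd p) n y) (w1.W (fst p) n x) r} \<delta>} \<in> sets PQ"
    unfolding rare_iff_countable by measurable
  show "AE a in w1.P. AE b in w2.P. rare {n. near (w2.W (snd (a, b)) n y) (w1.W (fst (a, b)) n x) r} \<delta>"
    using assms by simp
qed

theorem AE_lifted_ping_pong:
  "AE p in PQ. \<forall>\<delta>>0. rare {n. \<not> lifted_ping_pong (w1.W (fst p) n) (w2.W (snd p) n)} \<delta>"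
proof -
  obtain r1 where r1: "\<And>i. r1 i > 0"
    "\<And>i x z. AE \<omega> in w1.P. rare {n. near (w1.W \<omega> n x) (z n) (r1 i)} (1 / real (Suc i))"
    by (rule w1.near_scales) blast
  obtain r2 where r2: "\<And>i. r2 i > 0"
    "\<And>i x z. AE \<omega> in w2.P. rare {n. near (w2.W \<omega> n x) (z n) (r2 i)} (1 / real (Suc i))"
    by (rule w2.near_scales) blast
  have ps: "prob_space w1.P" "prob_space w2.P" by unfold_locales
  have "AE p in PQ. w1.regular (fst p)" by (rule AE_pair_fst[OF ps w1.AE_regular])
  moreover have "AE p in PQ. w2.regular (snd p)" by (rule AE_pair_snd[OF ps w2.AE_regular])
  moreover have "AE p in PQ. \<forall>i. \<forall>x z::rat. rare {n. near (w1.W (fst p) n (of_rat x)) (of_rat z) (r1 i)} (1 / real (Suc i))"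
    unfolding AE_all_countable by (intro allI AE_pair_fst[OF ps] r1(2))
  moreover have "AE p in PQ. \<forall>i. \<forall>x z::rat. rare {n. near (w2.W (snd p) n (of_rat x)) (of_rat z) (r2 i)} (1 / real (Suc i))"
    unfolding AE_all_countable by (intro allI AE_pair_snd[OF ps] r2(2))
  moreover have "AE p in PQ. \<forall>i. \<forall>x y::rat. rare {n. near (w2.W (snd p) n (of_rat y)) (w1.W (fst p) n (of_rat x)) (r2 i)} (1 / real (Suc i))"
    unfolding AE_all_countable by (intro allI AE_cross r2(2))
  moreover note AE_not_close_bad
  ultimately show ?thesis
  proof eventually_elim
    case (elim p)
    define \<omega> where "\<omega> = fst p"
    define \<omega>' where "\<omega>' = snd p"
    have reg: "w1.regular \<omega>" "w2.regular \<omega>'"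
      and n1: "\<And>i x z. rare {n. near (w1.W \<omega> n (of_rat x)) (of_rat z) (r1 i)} (1 / real (Suc i))"
      and n2: "\<And>i x z. rare {n. near (w2.W \<omega>' n (of_rat x)) (of_rat z) (r2 i)} (1 / real (Suc i))"
      and n12: "\<And>i x y. rare {n. near (w2.W \<omega>' n (of_rat y)) (w1.W \<omega> n (of_rat x)) (r2 i)} (1 / real (Suc i))"
      and sep: "\<And>m0. \<exists>m\<ge>m0. (\<omega>, \<omega>') \<notin> close_bad m"
      using elim by (simp_all add: \<omega>_def \<omega>'_def)
    show ?case
    proof (intro allI impI)
      fix \<delta> :: real assume \<delta>: "\<delta> > 0"
      \<comment> \<open>This bounds the number of repelling arcs of either walk on every grid, so it
        can be fixed before \<open>m\<close>. The 5 below counts the families of pairs collected in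
        \<open>Z\<close>, each with at most \<open>K\<^sup>2\<close> members.\<close>
      define K where "K = 2 / w1.gap + 2 / w2.gap"
      have K: "K > 0" using w1.gap_pos w2.gap_pos by (simp add: K_def add_pos_pos)
      have "0 < \<delta> / (5 * K\<^sup>2)" using K \<delta> by simp
      then obtain i where "1 / real (Suc i) < \<delta> / (5 * K\<^sup>2)" by (rule nat_approx_posE)
      define \<epsilon> where "\<epsilon> = 1 / real (Suc i)"
      have \<epsilon>: "0 \<le> \<epsilon>" "5 * (K\<^sup>2 * \<epsilon>) \<le> \<delta>"
        using \<open>1 / real (Suc i) < \<delta> / (5 * K\<^sup>2)\<close> K unfolding \<epsilon>_def by (simp_all add: field_simps)
      define \<rho> where "\<rho> = min (r1 i) (r2 i)"
      have \<rho>: "\<rho> > 0" using r1(1) r2(1) by (simp add: \<rho>_def)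
      obtain m' where m': "m' \<ge> nat \<lceil>4 / \<rho>\<rceil> + 1" "(\<omega>, \<omega>') \<notin> close_bad m'" using sep by blast
      define m where "m = int m'"
      have m: "m > 0" using m' by (simp add: m_def)
      have mr: "(0::real) < of_int m" using m by simp
      have "4 / \<rho> < of_int m" using m' unfolding m_def by linarith
      \<comment> \<open>Neighbourhoods of radius \<open>2 / m\<close> are disjoint once their
        centres are at distance at least \<open>4 / m\<close>.\<close>
      then have m4: "2 * (2 / of_int m) \<le> \<rho>" using \<rho> mr by (simp add: field_simps)
      define J1 where "J1 = w1.badset m \<omega>"
      define J2 where "J2 = w2.badset m \<omega>'"
      define c where "c j = (of_int j / of_int m :: real)" for j
      define q where "q j = (of_int (j + 1) / of_int m :: real)" for j
      have crat: "c j = of_rat (of_int j / of_int m)" and qrat: "q j = of_rat (of_int (j + 1) / of_int m)" for j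
        unfolding c_def q_def by (simp_all only: of_rat_grid)
      have fin: "finite J1" "finite J2" unfolding J1_def J2_def by (rule w1.finite_badset w2.finite_badset)+
      have J1K: "real (card J1) \<le> K" unfolding J1_def K_def using w1.card_badset[OF m, of \<omega>] w2.gap_pos
        by (simp add: add_increasing2)
      have J2K: "real (card J2) \<le> K" unfolding J2_def K_def using w2.card_badset[OF m, of \<omega>'] w1.gap_pos
        by (simp add: add_increasing)
      have U: "rare (\<Union>(j, k)\<in>I \<times> I'. A j k) (K\<^sup>2 * \<epsilon>)"
        if "\<And>j k. rare (A j k) \<epsilon>" "finite I" "finite I'" "real (card I) \<le> K" "real (card I') \<le> K" for A and I I' :: "int set"
      proof -
        have "rare (\<Union>jk\<in>I \<times> I'. (\<lambda>(j, k). A j k) jk) (real (card (I \<times> I')) * \<epsilon>)"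
          by (rule rare_UN) (use that in auto)
        moreover have "real (card (I \<times> I')) \<le> K\<^sup>2"
          using that K unfolding card_cartesian_product power2_eq_square of_nat_mult by (intro mult_mono) auto
        ultimately show ?thesis
          using \<epsilon>(1) by (elim rare_mono) (auto intro: mult_right_mono)
      qed
      have sm: "near a b (2 * (2 / of_int m)) \<Longrightarrow> near a b (r1 i)" "near a b (2 * (2 / of_int m)) \<Longrightarrow> near a b (r2 i)" for a b
        using m4 by (auto simp: \<rho>_def elim: near_mono)
      \<comment> \<open>\<open>D1\<close> and \<open>D2\<close> are the times at which an attracted
        point is close to a repelling arc, \<open>D3\<close> those at which attracted points of the
        two walks are close to each other.\<close>
      define D1 where "D1 j k = {n. near (w1.W \<omega> n (q j)) (c k) (2 * (2 / of_int m))}" for j k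
      define D2 where "D2 j k = {n. near (w2.W \<omega>' n (q j)) (c k) (2 * (2 / of_int m))}" for j k
      define D3 where "D3 j k = {n. near (w2.W \<omega>' n (q k)) (w1.W \<omega> n (q j)) (2 * (2 / of_int m))}" for j k
      have D1: "rare (D1 j k) \<epsilon>" for j k
        unfolding D1_def \<epsilon>_def crat qrat by (rule rare_mono[OF n1]) (use sm in auto)
      have D2: "rare (D2 j k) \<epsilon>" for j k
        unfolding D2_def \<epsilon>_def crat qrat by (rule rare_mono[OF n2]) (use sm in auto)
      have D3: "rare (D3 j k) \<epsilon>" for j k
        unfolding D3_def \<epsilon>_def qrat by (rule rare_mono[OF n12]) (use sm in auto)
      define N1 where "N1 = {n. \<not> (\<forall>x. (\<forall>j\<in>J1. \<not> near x (c j) (2 / of_int m)) \<longrightarrow>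
         (\<exists>j\<in>J1. near (w1.W \<omega> n x) (w1.W \<omega> n (q j)) (2 / of_int m)))}"
      define N2 where "N2 = {n. \<not> (\<forall>x. (\<forall>j\<in>J2. \<not> near x (c j) (2 / of_int m)) \<longrightarrow>
         (\<exists>j\<in>J2. near (w2.W \<omega>' n x) (w2.W \<omega>' n (q j)) (2 / of_int m)))}"
      have N: "rare N1 0" "rare N2 0"
        unfolding N1_def N2_def J1_def J2_def c_def q_def
        by (rule w1.north_south[OF reg(1) m] w2.north_south[OF reg(2) m])+
      define Z where "Z = (N1 \<union> N2) \<union> (\<Union>(j, k)\<in>J1 \<times> J1. D1 j k) \<union> (\<Union>(j, k)\<in>J1 \<times> J2. D1 j k)
         \<union> (\<Union>(j, k)\<in>J2 \<times> J1. D2 j k) \<union> (\<Union>(j, k)\<in>J2 \<times> J2. D2 j k) \<union> (\<Union>(j, k)\<in>J1 \<times> J2. D3 j k)"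
      have "rare Z ((0 + 0) + K\<^sup>2 * \<epsilon> + K\<^sup>2 * \<epsilon> + K\<^sup>2 * \<epsilon> + K\<^sup>2 * \<epsilon> + K\<^sup>2 * \<epsilon>)"
        unfolding Z_def by (intro rare_Un N U D1 D2 D3 fin J1K J2K)
      then have Z: "rare Z \<delta>" using \<epsilon>(2) by (elim rare_mono) (auto simp: mult.commute)
      have apart: "\<not> near (c j) (c k) (2 * (2 / of_int m))" if jk: "j \<in> J1" "k \<in> J2" for j k
      proof
        assume "near (c j) (c k) (2 * (2 / of_int m))"
        then obtain l :: int where "\<bar>c j - c k - of_int l\<bar> < 4 / of_int m" unfolding near_def by auto
        moreover have "c j - c k - of_int l = of_int (j - (k + l * m)) / of_int m"
          using mr by (simp add: c_def field_simps)
        ultimately have "\<bar>of_int (j - (k + l * m)) :: real\<bar> < 4"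
          using mr by (simp add: abs_divide divide_less_cancel)
        define h where "h = k + l * m"
        have "\<bar>j - h\<bar> < 4" using \<open>\<bar>of_int (j - (k + l * m)) :: real\<bar> < 4\<close> unfolding h_def by linarith
        then have "j - 4 \<le> h" "h + 1 \<le> j + 5" by linarith+
        then have "of_int (j - 4) / of_int m \<le> (of_int h / of_int m :: real)"
          "of_int (h + 1) / of_int m \<le> (of_int (j + 5) / of_int m :: real)"
          using mr by (intro divide_right_mono; simp only: of_int_le_iff less_imp_le)+
        moreover have "w2.badj m \<omega>' h"
          using jk w2.badj_periodic[OF m] by (simp add: J2_def w2.badset_def h_def)
        ultimately have "w2.bad (of_int (j - 4) / of_int m) (of_int (j + 5) / of_int m) \<omega>'"
          unfolding w2.badj_def by (elim w2.bad_mono)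
        then have "(\<omega>, \<omega>') \<in> close_bad m'"
          using jk by (auto simp: close_bad_def m_def[symmetric] J1_def w1.badset_def)
        with m'(2) show False by blast
      qed
      have "{n. \<not> lifted_ping_pong (w1.W \<omega> n) (w2.W \<omega>' n)} \<subseteq> Z"
      proof (rule subsetI, rule ccontr)
        fix n assume n: "n \<in> {n. \<not> lifted_ping_pong (w1.W \<omega> n) (w2.W \<omega>' n)}" and nZ: "n \<notin> Z"
        define B1 where "B1 = (\<lambda>j. w1.W \<omega> n (q j)) ` J1"
        define B2 where "B2 = (\<lambda>j. w2.W \<omega>' n (q j)) ` J2"
        have "nbhd (c ` J1) (2 / of_int m) \<inter> nbhd (c ` J2) (2 / of_int m) = {}"
          by (rule nbhd_disjoint) (use apart in auto)
        moreover have "nbhd (c ` J1) (2 / of_int m) \<inter> nbhd B1 (2 / of_int m) = {}"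
          by (rule nbhd_disjoint) (use nZ in \<open>auto simp: B1_def Z_def D1_def dest!: near_sym[of "c _"]\<close>)
        moreover have "nbhd (c ` J1) (2 / of_int m) \<inter> nbhd B2 (2 / of_int m) = {}"
          by (rule nbhd_disjoint) (use nZ in \<open>auto simp: B2_def Z_def D2_def dest!: near_sym[of "c _"]\<close>)
        moreover have "nbhd (c ` J2) (2 / of_int m) \<inter> nbhd B1 (2 / of_int m) = {}"
          by (rule nbhd_disjoint) (use nZ in \<open>auto simp: B1_def Z_def D1_def dest!: near_sym[of "c _"]\<close>)
        moreover have "nbhd (c ` J2) (2 / of_int m) \<inter> nbhd B2 (2 / of_int m) = {}"
          by (rule nbhd_disjoint) (use nZ in \<open>auto simp: B2_def Z_def D2_def dest!: near_sym[of "c _"]\<close>)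
        moreover have "nbhd B1 (2 / of_int m) \<inter> nbhd B2 (2 / of_int m) = {}"
          by (rule nbhd_disjoint) (use nZ in \<open>auto simp: B1_def B2_def Z_def D3_def dest!: near_sym[of "w1.W _ _ _"]\<close>)
        moreover have "w1.W \<omega> n x \<in> nbhd B1 (2 / of_int m)" if "x \<notin> nbhd (c ` J1) (2 / of_int m)" for x
        proof -
          have "n \<notin> N1" using nZ by (simp add: Z_def)
          then show ?thesis using that unfolding N1_def nbhd_def B1_def by auto
        qed
        moreover have "w2.W \<omega>' n x \<in> nbhd B2 (2 / of_int m)" if "x \<notin> nbhd (c ` J2) (2 / of_int m)" for x
        proof -
          have "n \<notin> N2" using nZ by (simp add: Z_def)
          then show ?thesis using that unfolding N2_def nbhd_def B2_def by auto
        qed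
        ultimately have "lifted_ping_pong (w1.W \<omega> n) (w2.W \<omega>' n)"
          unfolding lifted_ping_pong_def
          by (intro exI[of _ "c ` J1"] exI[of _ "c ` J2"] exI[of _ B1] exI[of _ B2] exI[of _ "2 / of_int m"] conjI allI impI)
        with n show False by simp
      qed
      from rare_mono[OF Z this]
      show "rare {n. \<not> lifted_ping_pong (w1.W (fst p) n) (w2.W (snd p) n)} \<delta>"
        by (simp add: \<omega>_def \<omega>'_def)
    qed
  qed
qed

end

section \<open>From the circle to the line\<close>

definition ecirc :: "real \<Rightarrow> complex" where
  "ecirc x = cis (2 * pi * x)"

lemma ecirc_in [simp]: "ecirc x \<in> S1"
  by (simp add: ecirc_def S1_def)

lemma ecirc_eq_iff: "ecirc x = ecirc y \<longleftrightarrow> (\<exists>k::int. x = y + of_int k)"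
proof -
  have "ecirc x = ecirc y \<longleftrightarrow> (\<exists>k::int. 2 * pi * x = 2 * pi * y + 2 * pi * k)"
    unfolding sin_cos_eq_iff[symmetric] ecirc_def by (auto simp: complex_eq_iff)
  also have "\<dots> \<longleftrightarrow> (\<exists>k::int. x = y + of_int k)"
    by (simp flip: distrib_left)
  finally show ?thesis .
qed

lemma ecirc_add_int [simp]: "ecirc (x + of_int k) = ecirc x"
  using ecirc_eq_iff by blast

lemma ecirc_surj: "z \<in> S1 \<Longrightarrow> \<exists>x\<in>{0..1}. z = ecirc x"
proof -
  assume "z \<in> S1"
  then have z: "cis (Arg2pi z) = z" using Arg2pi[of z] by (simp add: S1_def cis_conv_exp is_Arg_def)
  have "z = ecirc (Arg2pi z / (2 * pi))" using z by (simp add: ecirc_def)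
  moreover have "Arg2pi z / (2 * pi) \<in> {0..1}"
    using Arg2pi_ge_0[of z] Arg2pi_lt_2pi[of z] by simp
  ultimately show ?thesis by blast
qed

lemma continuous_on_ecirc: "continuous_on A ecirc"
  unfolding ecirc_def by (intro continuous_intros)

text \<open>Since \<open>nbhd A r\<close> is periodic, the complement of its image is the image of a
  compact part of one period.\<close>

lemma openin_ecirc_nbhd: "openin (top_of_set S1) (ecirc ` nbhd A r)"
proof -
  have "open {x. near x c r}" for c
  proof -
    have "{x. near x c r} = (\<Union>k::int. ball (c + of_int k) r)"
      by (auto simp: near_def dist_real_def abs_minus_commute algebra_simps)
    then show ?thesis by auto
  qed
  moreover have "nbhd A r = (\<Union>c\<in>A. {x. near x c r})" by (auto simp: nbhd_def)
  ultimately have "open (nbhd A r)" by auto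
  then have "compact ({0..1} - nbhd A r)" by (intro compact_diff compact_Icc)
  then have "compact (ecirc ` ({0..1} - nbhd A r))"
    by (intro compact_continuous_image continuous_on_ecirc)
  then have cl: "closed (ecirc ` ({0..1} - nbhd A r))" by (rule compact_imp_closed)
  have per: "x \<in> nbhd A r \<longleftrightarrow> y \<in> nbhd A r" if "ecirc x = ecirc y" for x y
    using that near_shift[of y] unfolding ecirc_eq_iff nbhd_def by auto
  have "ecirc ` nbhd A r = S1 \<inter> - ecirc ` ({0..1} - nbhd A r)"
  proof (intro equalityI subsetI)
    fix z assume "z \<in> ecirc ` nbhd A r"
    then obtain x where x: "x \<in> nbhd A r" "z = ecirc x" by blast
    have "z \<notin> ecirc ` ({0..1} - nbhd A r)"
    proof
      assume "z \<in> ecirc ` ({0..1} - nbhd A r)"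
      then obtain y where y: "y \<notin> nbhd A r" "ecirc x = ecirc y" by (auto simp: x(2))
      show False using per[OF y(2)] x(1) y(1) by simp
    qed
    then show "z \<in> S1 \<inter> - ecirc ` ({0..1} - nbhd A r)" by (simp add: x(2))
  next
    fix z assume z: "z \<in> S1 \<inter> - ecirc ` ({0..1} - nbhd A r)"
    then obtain x where "x \<in> {0..1}" "z = ecirc x" using ecirc_surj by blast
    with z show "z \<in> ecirc ` nbhd A r" by blast
  qed
  with cl show ?thesis by (metis open_Compl openin_open)
qed

lemma ping_pong_from_lifts:
  assumes f: "\<And>x. f (ecirc x) = ecirc (F x)" and g: "\<And>x. g (ecirc x) = ecirc (G x)"
    and "lifted_ping_pong F G"
  shows "ping_pong_pair f g"
proof -
  obtain A1 A2 B1 B2 r where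
    d: "nbhd A1 r \<inter> nbhd A2 r = {}" "nbhd A1 r \<inter> nbhd B1 r = {}" "nbhd A1 r \<inter> nbhd B2 r = {}"
      "nbhd A2 r \<inter> nbhd B1 r = {}" "nbhd A2 r \<inter> nbhd B2 r = {}" "nbhd B1 r \<inter> nbhd B2 r = {}"
    and m': "\<forall>x. x \<notin> nbhd A1 r \<longrightarrow> F x \<in> nbhd B1 r" "\<forall>x. x \<notin> nbhd A2 r \<longrightarrow> G x \<in> nbhd B2 r"
    using assms(3) unfolding lifted_ping_pong_def by (elim exE conjE) (rule that; assumption)
  note m = m'[rule_format]
  have disj: "ecirc ` nbhd A r \<inter> ecirc ` nbhd B r = {}" if AB: "nbhd A r \<inter> nbhd B r = {}" for A B
  proof (rule ccontr)
    assume "\<not> ?thesis"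
    then obtain x y where xy: "x \<in> nbhd A r" "y \<in> nbhd B r" "ecirc x = ecirc y" by auto
    then obtain k :: int where "x = y + of_int k" unfolding ecirc_eq_iff by blast
    then have "x \<in> nbhd B r" using xy(2) near_shift[of y k] by (auto simp: nbhd_def)
    with xy AB show False by blast
  qed
  have map: "h ` (S1 - ecirc ` nbhd A r) \<subseteq> ecirc ` nbhd B r"
    if "\<And>x. h (ecirc x) = ecirc (L x)" "\<And>x. x \<notin> nbhd A r \<Longrightarrow> L x \<in> nbhd B r" for h L A B
  proof
    fix w assume "w \<in> h ` (S1 - ecirc ` nbhd A r)"
    then obtain z where z: "z \<in> S1" "z \<notin> ecirc ` nbhd A r" "w = h z" by blast
    then obtain x where "z = ecirc x" using ecirc_surj by blast
    with z that show "w \<in> ecirc ` nbhd B r" by blast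
  qed
  have m1: "f ` (S1 - ecirc ` nbhd A1 r) \<subseteq> ecirc ` nbhd B1 r" by (rule map[of f F]) (use f m(1) in auto)
  have m2: "g ` (S1 - ecirc ` nbhd A2 r) \<subseteq> ecirc ` nbhd B2 r" by (rule map[of g G]) (use g m(2) in auto)
  show ?thesis
    unfolding ping_pong_pair_def
    by (intro exI[of _ "ecirc ` nbhd A1 r"] exI[of _ "ecirc ` nbhd A2 r"] exI[of _ "ecirc ` nbhd B1 r"]
        exI[of _ "ecirc ` nbhd B2 r"] conjI openin_ecirc_nbhd disj d m1 m2)
qed

subsection \<open>Invariant measures from invariant monotone functions\<close>

text \<open>Values of a \<open>circle_fun\<close> at jumps are arbitrary;
  \<open>interval_measure\<close> calls for the right-continuous version.\<close>

definition rlim :: "(real \<Rightarrow> real) \<Rightarrow> real \<Rightarrow> real" where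
  "rlim K x = Inf (K ` {x<..})"

lemma rlim_le:
  assumes "mono K" "x < y" shows "rlim K x \<le> K y"
  unfolding rlim_def
proof (rule cInf_lower)
  show "bdd_below (K ` {x<..})"
    by (rule bdd_belowI2[of _ "K x"]) (use monoD[OF assms(1), of x] in simp)
qed (use assms(2) in simp)

lemma rlim_ge:
  assumes "\<And>y. x < y \<Longrightarrow> c \<le> K y" shows "c \<le> rlim K x"
  unfolding rlim_def using assms by (intro cInf_greatest) auto

lemma mono_rlim:
  assumes "mono K" shows "mono (rlim K)"
proof (rule monoI, rule rlim_ge)
  fix x y z :: real assume "x \<le> y" "y < z"
  then show "rlim K x \<le> K z" by (intro rlim_le assms) simp
qed

lemma rlim_right_continuous:
  assumes K: "mono K" shows "continuous (at_right a) (rlim K)"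
  unfolding continuous_within
proof (rule order_tendstoI)
  fix c assume "c < rlim K a"
  then show "eventually (\<lambda>x. c < rlim K x) (at_right a)"
    unfolding eventually_at_right_field
  proof (intro exI[of _ "a + 1"] conjI allI impI)
    fix y assume "a < y"
    then have "rlim K a \<le> rlim K y" by (intro monoD[OF mono_rlim[OF K]]) simp
    with \<open>c < rlim K a\<close> show "c < rlim K y" by simp
  qed simp
next
  fix c assume "rlim K a < c"
  then obtain y where y: "a < y" "K y < c" using rlim_ge[of a c K] by (meson not_le)
  then show "eventually (\<lambda>x. rlim K x < c) (at_right a)"
    unfolding eventually_at_right_field using rlim_le[OF K] by (meson le_less_trans)
qed

lemma rlim_equivariant:
  assumes F: "circle_homeo F" and KF: "\<And>x. K (F x) = K x + c" and K: "mono K"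
  shows "rlim K (F x) = rlim K x + c"
proof (rule antisym)
  have "rlim K (F x) - c \<le> rlim K x"
  proof (rule rlim_ge)
    fix y assume "x < y"
    then have "rlim K (F x) \<le> K (F y)" by (intro rlim_le K) (simp add: circle_homeo_strict[OF F])
    then show "rlim K (F x) - c \<le> K y" by (simp add: KF)
  qed
  then show "rlim K (F x) \<le> rlim K x + c" by simp
  show "rlim K x + c \<le> rlim K (F x)"
  proof (rule rlim_ge)
    fix y assume "F x < y"
    then have "x < inv F y" using circle_homeo_strict[OF F, of x "inv F y"] F by simp
    then have "rlim K x \<le> K (inv F y)" by (rule rlim_le[OF K])
    then show "rlim K x + c \<le> K y" using KF[of "inv F y"] F by simp
  qed
qed

text \<open>\<open>R\<close> and \<open>R \<circ> F\<close> have the same increments, so a half-open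
  interval and its preimage have equal mass, and such intervals generate the Borel sets.\<close>

lemma interval_measure_invariant:
  assumes F: "circle_homeo F" and RF: "\<And>x. R (F x) = R x + c"
    and R: "mono R" "\<And>a. continuous (at_right a) R" and A: "A \<in> sets borel"
  shows "emeasure (interval_measure R) (F -` A) = emeasure (interval_measure R) A"
proof -
  let ?m = "interval_measure R"
  have Fm: "F \<in> measurable ?m borel"
    using F borel_measurable_continuous_onI[of F] measurable_cong_sets[OF sets_interval_measure refl, of R borel]
    by (simp add: circle_homeo_def)
  have Ioc: "emeasure ?m {a<..b} = (if a \<le> b then ennreal (R b - R a) else 0)" for a b
    using emeasure_interval_measure_Ioc[of a b R] R by (auto dest: monoD)
  have "distr ?m borel F = ?m"
  proof (rule measure_eqI_generator_eq[where E="range (\<lambda>(a, b). {a<..b::real})" and \<Omega>=UNIV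
        and A="\<lambda>i. {- real i<..real i}"])
    show "Int_stable (range (\<lambda>(a, b). {a<..b::real}))"
      by (rule Int_stableI) (auto simp: image_iff Int_greaterThanAtMost, blast)
    show "emeasure (distr ?m borel F) X = emeasure ?m X" if XE: "X \<in> range (\<lambda>(a, b). {a<..b})" for X
    proof -
      obtain a b where X: "X = {a<..b}" using XE by auto
      have pre: "F -` {a<..b} = {inv F a<..inv F b}"
        using circle_homeo_strict[OF F, of "inv F a"] circle_homeo_le[OF F, of _ "inv F b"] F by auto
      have "inv F a \<le> inv F b \<longleftrightarrow> a \<le> b" using circle_homeo_le[OF F, of "inv F a" "inv F b"] F by simp
      moreover have "R (inv F b) - R (inv F a) = R b - R a"
        using RF[of "inv F a"] RF[of "inv F b"] F by simp
      ultimately show ?thesis by (simp add: X emeasure_distr[OF Fm] pre Ioc)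
    qed
    show "sets (distr ?m borel F) = sigma_sets UNIV (range (\<lambda>(a, b). {a<..b}))"
      "sets ?m = sigma_sets UNIV (range (\<lambda>(a, b). {a<..b}))"
      by (simp_all add: borel_sigma_sets_Ioc)
    show "(\<Union>i. {- real i<..real i}) = UNIV"
    proof (intro equalityI subsetI UNIV_I)
      fix x :: real
      obtain n where "\<bar>x\<bar> < real n" using reals_Archimedean2 by blast
      then show "x \<in> (\<Union>i. {- real i<..real i})" by (intro UN_I[of n]) auto
    qed
    show "emeasure (distr ?m borel F) {- real i<..real i} \<noteq> \<infinity>" for i
    proof -
      have "F -` {- real i<..real i} = {inv F (- real i)<..inv F (real i)}"
        using circle_homeo_strict[OF F, of "inv F (- real i)"] circle_homeo_le[OF F, of _ "inv F (real i)"] F by auto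
      then show ?thesis by (simp add: emeasure_distr[OF Fm] Ioc)
    qed
  qed auto
  then have "emeasure ?m A = emeasure (distr ?m borel F) A" by simp
  also have "\<dots> = emeasure ?m (F -` A)" using emeasure_distr[OF Fm A] by simp
  finally show ?thesis ..
qed

lemma circle_homeo_shift: "circle_homeo (\<lambda>x. x + c)"
  by (auto simp: circle_homeo_def strict_mono_def intro!: continuous_intros)

text \<open>The measure of \<open>rlim K\<close> on the line is invariant under integer translations
  and under the given lifts; its restriction to one period is projected to the circle.\<close>

lemma has_invariant_prob_from_fun:
  assumes K: "circle_fun K" and G: "G \<subseteq> Homeo_plus"
    and inv: "\<And>f. f \<in> G \<Longrightarrow> \<exists>F. circle_homeo F \<and> (\<forall>x. f (ecirc x) = ecirc (F x)) \<and> (\<forall>s t. K (F t) - K (F s) = K t - K s)"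
  shows "has_invariant_prob G"
proof -
  define R where "R = rlim K"
  have Km: "mono K" using K by (simp add: circle_fun_def)
  have R: "mono R" "\<And>a. continuous (at_right a) R"
    unfolding R_def by (rule mono_rlim[OF Km], rule rlim_right_continuous[OF Km])
  have R1: "R (x + 1) = R x + 1" for x
    unfolding R_def by (rule rlim_equivariant[OF circle_homeo_shift]) (use K in \<open>auto simp: circle_fun_def\<close>)
  define m where "m = interval_measure R"
  have sm [simp]: "sets m = sets borel" "space m = UNIV" by (simp_all add: m_def)
  have shift1: "emeasure m ((\<lambda>x. x + 1) -` A) = emeasure m A" if "A \<in> sets borel" for A
    unfolding m_def by (rule interval_measure_invariant[OF circle_homeo_shift R1 R that])
  define I where "I = {0<..(1::real)}"
  have mI: "emeasure m I = 1"
    unfolding m_def I_def using R1[of 0]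
    by (subst emeasure_interval_measure_Ioc) (use R in \<open>auto dest: monoD\<close>)
  define \<nu> where "\<nu> = distr (restrict_space m I) (restrict_space borel S1) ecirc"
  have em: "ecirc \<in> borel_measurable borel" by (rule borel_measurable_continuous_onI[OF continuous_on_ecirc])
  have em': "ecirc \<in> measurable (restrict_space m I) (restrict_space borel S1)"
    by (intro measurable_restrict_space1 measurable_restrict_space2)
       (use em in \<open>auto simp: measurable_cong_sets[OF sm(1) refl]\<close>)
  have sets_nu: "sets \<nu> = sets (restrict_space borel S1)" by (simp add: \<nu>_def)
  have I_sets: "I \<in> sets m" by (simp add: I_def)
  have nu: "emeasure \<nu> A = emeasure m (ecirc -` A \<inter> I)" if "A \<in> sets \<nu>" for A
  proof -
    have A: "A \<in> sets (restrict_space borel S1)" using that sets_nu by simp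
    have "emeasure \<nu> A = emeasure (restrict_space m I) (ecirc -` A \<inter> I)"
      unfolding \<nu>_def using emeasure_distr[OF em' A] by (simp add: space_restrict_space)
    also have "\<dots> = emeasure m (ecirc -` A \<inter> I)"
      by (rule emeasure_restrict_space) (use I_sets in auto)
    finally show ?thesis .
  qed
  have S1b: "S1 \<in> sets borel" by (simp add: S1_def)
  have spnu: "space \<nu> = S1" by (simp add: \<nu>_def space_restrict_space)
  have "prob_space \<nu>"
  proof
    have "emeasure \<nu> (space \<nu>) = emeasure m (ecirc -` S1 \<inter> I)"
      using nu[OF sets.top] by (simp add: spnu)
    also have "ecirc -` S1 \<inter> I = I" by auto
    finally show "emeasure \<nu> (space \<nu>) = 1" by (simp add: mI)
  qed
  moreover have "emeasure \<nu> (f -` A \<inter> S1) = emeasure \<nu> A" if f: "f \<in> G" and A: "A \<in> sets \<nu>" for f A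
  proof -
    obtain F where F: "circle_homeo F" "\<And>x. f (ecirc x) = ecirc (F x)" "\<And>s t. K (F t) - K (F s) = K t - K s"
      using inv[OF f] by blast
    have KF: "K (F x) = K x + (K (F 0) - K 0)" for x using F(3)[of x 0] by simp
    have RF: "R (F x) = R x + (K (F 0) - K 0)" for x
      unfolding R_def by (rule rlim_equivariant[OF F(1) KF Km])
    have mF: "emeasure m (F -` B) = emeasure m B" if "B \<in> sets borel" for B
      unfolding m_def by (rule interval_measure_invariant[OF F(1) RF R that])
    define B where "B = ecirc -` A"
    obtain A' where A': "A' \<in> sets borel" "A = S1 \<inter> A'"
      using A unfolding sets_nu by (auto simp: sets_restrict_space)
    have Bb: "B \<in> sets borel"
    proof -
      have "B = ecirc -` A' \<inter> space borel" unfolding B_def A'(2) by auto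
      then show ?thesis using measurable_sets[OF em A'(1)] by simp
    qed
    have Bper: "x + of_int k \<in> B \<longleftrightarrow> x \<in> B" for x and k :: int by (simp add: B_def)
    have fA: "f -` A \<inter> S1 \<in> sets \<nu>"
    proof -
      have "\<exists>g. homeomorphism S1 S1 f g" using G f by (auto simp: Homeo_plus_def)
      then have "continuous_on S1 f" "f ` S1 = S1" by (auto simp: homeomorphism_def)
      then have "f \<in> borel_measurable (restrict_space borel S1)"
        by (intro borel_measurable_continuous_on_restrict)
      from measurable_sets[OF this A'(1)] \<open>f ` S1 = S1\<close> show ?thesis
        unfolding sets_nu A'(2) space_restrict_space by (simp add: vimage_Int) (metis (no_types, lifting) Int_assoc image_subset_iff_subset_vimage inf.absorb_iff2 inf_commute order_refl)
    qed
    \<comment> \<open>A lift moves the period from 0 to 1 to the one from \<open>F 0\<close> to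
      \<open>F 0 + 1\<close>, so a periodic set must have the same mass in every period.\<close>
    have domain: "emeasure m (B \<inter> {a<..a + 1}) = emeasure m (B \<inter> I)" for a
    proof -
      have shift_nat: "emeasure m (B \<inter> {b + of_int k<..b + of_int k + 1}) = emeasure m (B \<inter> {b<..b + 1})" for b and k :: int
      proof (induction k rule: int_induct[where k=0])
        case (step1 i)
        have "(\<lambda>x. x + 1) -` (B \<inter> {b + of_int (i + 1)<..b + of_int (i + 1) + 1}) = B \<inter> {b + of_int i<..b + of_int i + 1}"
          using Bper[of _ 1] by auto
        then show ?case using step1 shift1[of "B \<inter> {b + of_int (i + 1)<..b + of_int (i + 1) + 1}"] Bb by simp
      next
        case (step2 i)
        have "(\<lambda>x. x + 1) -` (B \<inter> {b + of_int i<..b + of_int i + 1}) = B \<inter> {b + of_int (i - 1)<..b + of_int (i - 1) + 1}"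
          using Bper[of _ 1] by auto
        then show ?case using step2 shift1[of "B \<inter> {b + of_int i<..b + of_int i + 1}"] Bb by simp
      qed simp
      define b where "b = frac a"
      have b: "0 \<le> b" "b < 1" "a = b + of_int \<lfloor>a\<rfloor>" using frac_lt_1[of a] by (auto simp: b_def frac_def)
      have "emeasure m (B \<inter> {a<..a + 1}) = emeasure m (B \<inter> {b<..b + 1})"
        using shift_nat[of b "\<lfloor>a\<rfloor>"] b(3) by simp
      also have "B \<inter> {b<..b + 1} = (B \<inter> {b<..1}) \<union> (B \<inter> {1<..b + 1})" using b by auto
      also have "emeasure m \<dots> = emeasure m (B \<inter> {b<..1}) + emeasure m (B \<inter> {1<..b + 1})"
        using Bb by (intro plus_emeasure[symmetric]) auto
      also have "emeasure m (B \<inter> {1<..b + 1}) = emeasure m (B \<inter> {0<..b})"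
      proof -
        have "(\<lambda>x. x + 1) -` (B \<inter> {1<..b + 1}) = B \<inter> {0<..b}" using Bper[of _ 1] by auto
        then show ?thesis using shift1[of "B \<inter> {1<..b + 1}"] Bb by simp
      qed
      also have "emeasure m (B \<inter> {b<..1}) + emeasure m (B \<inter> {0<..b}) = emeasure m ((B \<inter> {b<..1}) \<union> (B \<inter> {0<..b}))"
        using Bb by (intro plus_emeasure) auto
      also have "(B \<inter> {b<..1}) \<union> (B \<inter> {0<..b}) = B \<inter> I" using b by (auto simp: I_def)
      finally show ?thesis .
    qed
    have "F 1 = F 0 + 1" using F(1) unfolding circle_homeo_def by (metis add_0)
    have "emeasure \<nu> (f -` A \<inter> S1) = emeasure m (ecirc -` (f -` A \<inter> S1) \<inter> I)" by (rule nu[OF fA])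
    also have "ecirc -` (f -` A \<inter> S1) \<inter> I = F -` (B \<inter> {F 0<..F 0 + 1})"
      using F(2) circle_homeo_strict[OF F(1), of 0] circle_homeo_le[OF F(1), of _ 1] \<open>F 1 = F 0 + 1\<close>
      by (auto simp: B_def I_def)
    also have "emeasure m \<dots> = emeasure m (B \<inter> {F 0<..F 0 + 1})" using Bb by (intro mF) auto
    also have "\<dots> = emeasure m (B \<inter> I)" by (rule domain)
    also have "\<dots> = emeasure \<nu> A" using nu[OF A] by (simp add: B_def)
    finally show ?thesis .
  qed
  ultimately show ?thesis unfolding has_invariant_prob_def using sets_nu by blast
qed

subsection \<open>Encoding a countable group\<close>

definition lift :: "(complex \<Rightarrow> complex) \<Rightarrow> real \<Rightarrow> real" where
  "lift f = (SOME F. circle_homeo F \<and> (\<forall>x. f (ecirc x) = ecirc (F x)))"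

lemma lift:
  assumes "f \<in> Homeo_plus"
  shows "circle_homeo (lift f)" "f (ecirc x) = ecirc (lift f x)"
proof -
  have "\<exists>F. circle_homeo F \<and> (\<forall>x. f (ecirc x) = ecirc (F x))"
    using assms unfolding Homeo_plus_def circle_homeo_def ecirc_def by blast
  then have "circle_homeo (lift f) \<and> (\<forall>x. f (ecirc x) = ecirc (lift f x))"
    unfolding lift_def by (rule someI_ex)
  then show "circle_homeo (lift f)" "f (ecirc x) = ecirc (lift f x)" by auto
qed

lemma continuous_int_translation:
  fixes F :: "real \<Rightarrow> real"
  assumes c: "continuous_on UNIV F" and i: "\<And>x. \<exists>k::int. F x = x + of_int k"
  shows "\<exists>k::int. \<forall>x. F x = x + of_int k"
proof -
  have "(\<lambda>x. F x - x) constant_on UNIV"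
  proof (rule continuous_discrete_range_constant)
    show "continuous_on UNIV (\<lambda>x. F x - x)" by (intro continuous_intros c)
    show "\<exists>e>0. \<forall>y. y \<in> UNIV \<and> F y - y \<noteq> F x - x \<longrightarrow> e \<le> norm ((F y - y) - (F x - x))" for x
    proof (intro exI[of _ 1] conjI allI impI)
      fix y assume y: "y \<in> UNIV \<and> F y - y \<noteq> F x - x"
      obtain k l :: int where "F x = x + of_int k" "F y = y + of_int l" using i by meson
      with y have "(F y - y) - (F x - x) = of_int (l - k)" "l - k \<noteq> 0" by auto
      then show "1 \<le> norm ((F y - y) - (F x - x))" by simp
    qed simp
  qed simp
  then obtain c where c: "\<And>x. F x - x = c" unfolding constant_on_def by blast
  obtain k :: int where "F 0 = 0 + of_int k" using i by blast
  with c[of 0] have "c = of_int k" by simp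
  then have "F x = x + of_int k" for x using c[of x] by simp
  then show ?thesis by blast
qed

text \<open>The type of all maps of the plane has more than continuum many elements, so its discrete sigma-algebra does not respect
  products: the position of the walk is a measurable function of the path only after restriction to a
  countable set of maps. Hence the support of \<open>\<mu>\<close> is replaced by a set of natural numbers.\<close>

definition codes :: "(complex \<Rightarrow> complex) pmf \<Rightarrow> nat pmf" where
  "codes \<mu> = map_pmf (to_nat_on (set_pmf \<mu>)) \<mu>"

definition decode :: "(complex \<Rightarrow> complex) pmf \<Rightarrow> nat \<Rightarrow> complex \<Rightarrow> complex" where
  "decode \<mu> = from_nat_into (set_pmf \<mu>)"

definition lifts :: "(complex \<Rightarrow> complex) pmf \<Rightarrow> nat \<Rightarrow> real \<Rightarrow> real" where
  "lifts \<mu> n = lift (decode \<mu> n)"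

lemma decode_in: "decode \<mu> n \<in> set_pmf \<mu>"
  unfolding decode_def by (rule from_nat_into[OF set_pmf_not_empty])

lemma decode_code: "f \<in> set_pmf \<mu> \<Longrightarrow> decode \<mu> (to_nat_on (set_pmf \<mu>) f) = f"
  unfolding decode_def by (simp add: from_nat_into_to_nat_on)

lemma set_codes: "set_pmf (codes \<mu>) = to_nat_on (set_pmf \<mu>) ` set_pmf \<mu>"
  by (simp add: codes_def)

context
  fixes G :: "(complex \<Rightarrow> complex) set" and \<mu> :: "(complex \<Rightarrow> complex) pmf"
  assumes G: "subgroup_Homeo_plus G" and ni: "\<not> has_invariant_prob G" and nd: "nondegenerate G \<mu>"
begin

lemma supp_homeo: "f \<in> set_pmf \<mu> \<Longrightarrow> f \<in> Homeo_plus"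
  using G nd by (auto simp: subgroup_Homeo_plus_def nondegenerate_def)

lemma lifts_homeo: "circle_homeo (lifts \<mu> n)"
  unfolding lifts_def by (rule lift(1)[OF supp_homeo[OF decode_in]])

lemma lifts_ecirc: "ecirc (lifts \<mu> n x) = decode \<mu> n (ecirc x)"
  unfolding lifts_def by (rule lift(2)[OF supp_homeo[OF decode_in], symmetric])

lemma word_in_group:
  assumes "g \<in> gen_semigroup (set_pmf \<mu>)"
  shows "\<exists>l. set l \<subseteq> set_pmf (codes \<mu>) \<and> (\<forall>x. ecirc (word (lifts \<mu>) l x) = g (ecirc x))"
  using assms
proof induction
  case (base s)
  have "ecirc (word (lifts \<mu>) [to_nat_on (set_pmf \<mu>) s] x) = s (ecirc x)" for x
    using base by (simp add: lifts_ecirc decode_code)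
  then show ?case using base by (intro exI[of _ "[to_nat_on (set_pmf \<mu>) s]"]) (simp add: set_codes)
next
  case (comp a b)
  then obtain l m where "set l \<subseteq> set_pmf (codes \<mu>)" "\<And>x. ecirc (word (lifts \<mu>) l x) = a (ecirc x)"
    "set m \<subseteq> set_pmf (codes \<mu>)" "\<And>x. ecirc (word (lifts \<mu>) m x) = b (ecirc x)" by blast
  \<comment> \<open>In \<open>a \<circ> b\<close> the factor \<open>b\<close> acts first, so its
    word comes first.\<close>
  then show ?case by (intro exI[of _ "m @ l"]) (simp add: word_append)
qed

lemma group_circle_walk: "circle_walk (codes \<mu>) (lifts \<mu>)"
proof
  show "circle_homeo (lifts \<mu> a)" for a by (rule lifts_homeo)
  show "\<exists>a\<in>set_pmf (codes \<mu>). \<exists>s t. K (lifts \<mu> a t) - K (lifts \<mu> a s) \<noteq> K t - K s" if K: "circle_fun K" for K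
  proof (rule ccontr)
    assume neg: "\<not> ?thesis"
    have "has_invariant_prob G"
    proof (rule has_invariant_prob_from_fun[OF K])
      show "G \<subseteq> Homeo_plus" using G by (simp add: subgroup_Homeo_plus_def)
      fix f assume "f \<in> G"
      then have "f \<in> gen_semigroup (set_pmf \<mu>)" using nd by (simp add: nondegenerate_def)
      then obtain l where l: "set l \<subseteq> set_pmf (codes \<mu>)" "\<And>x. ecirc (word (lifts \<mu>) l x) = f (ecirc x)"
        using word_in_group by blast
      have "K (word (lifts \<mu>) l t) - K (word (lifts \<mu>) l s) = K t - K s" for s t
        using l(1)
      proof (induction l arbitrary: s t)
        case (Cons a l)
        then have "K (word (lifts \<mu>) l (lifts \<mu> a t)) - K (word (lifts \<mu>) l (lifts \<mu> a s)) = K (lifts \<mu> a t) - K (lifts \<mu> a s)"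
          by simp
        also have "\<dots> = K t - K s" using neg Cons.prems by simp
        finally show ?case by simp
      qed simp
      then show "\<exists>F. circle_homeo F \<and> (\<forall>x. f (ecirc x) = ecirc (F x)) \<and> (\<forall>s t. K (F t) - K (F s) = K t - K s)"
        using l(2) by (intro exI[of _ "word (lifts \<mu>) l"]) (simp add: circle_homeo_word lifts_homeo)
    qed
    with ni show False by blast
  qed
  show "\<exists>l k. set l \<subseteq> set_pmf (codes \<mu>) \<and> (\<forall>x. word (lifts \<mu>) l (lifts \<mu> a x) = x + of_int k)"
    if "a \<in> set_pmf (codes \<mu>)" for a
  proof -
    let ?f = "decode \<mu> a"
    have f: "?f \<in> Homeo_plus" "?f \<in> G"
      using supp_homeo[OF decode_in] decode_in[of \<mu> a] nd by (auto simp: nondegenerate_def)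
    then have "inv ?f \<in> gen_semigroup (set_pmf \<mu>)"
      using G nd by (auto simp: subgroup_Homeo_plus_def nondegenerate_def)
    then obtain l where l: "set l \<subseteq> set_pmf (codes \<mu>)" "\<And>x. ecirc (word (lifts \<mu>) l x) = inv ?f (ecirc x)"
      using word_in_group by blast
    \<comment> \<open>\<open>inv\<close> refers to \<open>?f\<close> as a map of the whole plane, so
      injectivity must combine the homeomorphism of the circle with the identity off it.\<close>
    have "inj ?f"
    proof (rule injI)
      fix x y assume xy: "?f x = ?f y"
      obtain g where g: "homeomorphism S1 S1 ?f g" using f by (auto simp: Homeo_plus_def)
      have off: "z \<notin> S1 \<Longrightarrow> ?f z = z" for z using f by (auto simp: Homeo_plus_def)
      have on: "z \<in> S1 \<Longrightarrow> ?f z \<in> S1" "z \<in> S1 \<Longrightarrow> g (?f z) = z" for z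
        using g by (auto simp: homeomorphism_def)
      show "x = y" using xy on off by (metis)
    qed
    then have "ecirc (word (lifts \<mu>) l (lifts \<mu> a x)) = ecirc x" for x
      by (simp add: l(2) lifts_ecirc)
    then have "\<exists>k::int. word (lifts \<mu>) l (lifts \<mu> a x) = x + of_int k" for x
      unfolding ecirc_eq_iff .
    moreover have "continuous_on UNIV (\<lambda>x. word (lifts \<mu>) l (lifts \<mu> a x))"
      using circle_homeo_word[of "lifts \<mu>" "a # l", OF lifts_homeo] by (simp add: circle_homeo_def)
    ultimately obtain k :: int where "\<And>x. word (lifts \<mu>) l (lifts \<mu> a x) = x + of_int k"
      using continuous_int_translation[of "\<lambda>x. word (lifts \<mu>) l (lifts \<mu> a x)"] by blast
    with l(1) show ?thesis by blast
  qed
qed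

lemma rwalk_ecirc:
  assumes "\<And>i. \<omega> i \<in> set_pmf \<mu>"
  shows "rwalk \<omega> n (ecirc x) = ecirc (wk (lifts \<mu>) (\<lambda>i. to_nat_on (set_pmf \<mu>) (\<omega> i)) (Suc n) x)"
  by (induction n) (simp_all add: lifts_ecirc decode_code assms)

end

section \<open>Paths of maps and paths of codes\<close>

abbreviation code_path :: "(complex \<Rightarrow> complex) pmf \<Rightarrow> (nat \<Rightarrow> complex \<Rightarrow> complex) \<Rightarrow> nat \<Rightarrow> nat" where
  "code_path \<mu> \<omega> \<equiv> \<lambda>i. to_nat_on (set_pmf \<mu>) (\<omega> i)"

lemma code_path_measurable:
  "code_path \<mu> \<in> measurable (path_space \<mu>) (PiM UNIV (\<lambda>_. measure_pmf (codes \<mu>)))"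
proof (rule measurable_PiM_single')
  show "(\<lambda>\<omega>. to_nat_on (set_pmf \<mu>) (\<omega> i)) \<in> measurable (path_space \<mu>) (measure_pmf (codes \<mu>))" for i
    unfolding path_space_def
    by (rule measurable_compose[OF measurable_component_singleton]) auto
qed (auto simp: path_space_def space_PiM)

text \<open>Each coded coordinate is a function of one coordinate of the path, so independence
  persists; it is enough to compare finite-dimensional cylinders.\<close>

lemma distr_code_path:
  "distr (path_space \<mu>) (PiM UNIV (\<lambda>_. measure_pmf (codes \<mu>))) (code_path \<mu>) = PiM UNIV (\<lambda>_. measure_pmf (codes \<mu>))"
proof -
  interpret C: product_prob_space "\<lambda>_. measure_pmf (codes \<mu>)" "UNIV :: nat set" by unfold_locales
  interpret M: product_prob_space "\<lambda>_. measure_pmf \<mu>" "UNIV :: nat set" by unfold_locales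
  show ?thesis
  proof (rule C.PiM_eq)
    fix J :: "nat set" and F assume J: "finite J" "\<And>j. j \<in> J \<Longrightarrow> F j \<in> sets (measure_pmf (codes \<mu>))"
    let ?X = "prod_emb UNIV (\<lambda>_. measure_pmf (codes \<mu>)) J (\<Pi>\<^sub>E j\<in>J. F j)"
    have "?X \<in> sets (PiM UNIV (\<lambda>_. measure_pmf (codes \<mu>)))" by (rule sets_PiM_I) (use J in auto)
    then have "emeasure (distr (path_space \<mu>) (PiM UNIV (\<lambda>_. measure_pmf (codes \<mu>))) (code_path \<mu>)) ?X
        = emeasure (path_space \<mu>) (code_path \<mu> -` ?X \<inter> space (path_space \<mu>))"
      by (rule emeasure_distr[OF code_path_measurable])
    also have "code_path \<mu> -` ?X \<inter> space (path_space \<mu>)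
        = prod_emb UNIV (\<lambda>_. measure_pmf \<mu>) J (\<Pi>\<^sub>E j\<in>J. to_nat_on (set_pmf \<mu>) -` F j)"
      by (auto simp: prod_emb_def path_space_def space_PiM PiE_iff)
    also have "emeasure (path_space \<mu>) \<dots> = (\<Prod>j\<in>J. emeasure (measure_pmf \<mu>) (to_nat_on (set_pmf \<mu>) -` F j))"
      unfolding path_space_def by (rule M.emeasure_PiM_emb) (use J in auto)
    also have "\<dots> = (\<Prod>j\<in>J. emeasure (measure_pmf (codes \<mu>)) (F j))"
      by (simp add: codes_def)
    finally show "emeasure (distr (path_space \<mu>) (PiM UNIV (\<lambda>_. measure_pmf (codes \<mu>))) (code_path \<mu>)) ?X
        = (\<Prod>j\<in>J. emeasure (measure_pmf (codes \<mu>)) (F j))" .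
  qed simp
qed

lemma prob_space_path_space: "prob_space (path_space \<mu>)"
  unfolding path_space_def by (intro prob_space_PiM measure_pmf.prob_space_axioms)

lemma AE_path_space_supp: "AE \<omega> in path_space \<mu>. \<forall>i. \<omega> i \<in> set_pmf \<mu>"
  unfolding AE_all_countable path_space_def
  by (intro allI AE_PiM_component) (auto simp: AE_measure_pmf measure_pmf.prob_space_axioms)

theorem theoremB:
  fixes G1 G2 :: "(complex \<Rightarrow> complex) set"
    and \<mu>1 \<mu>2 :: "(complex \<Rightarrow> complex) pmf"
  assumes "subgroup_Homeo_plus G1" and "subgroup_Homeo_plus G2"
    and "countable G1" and "countable G2"
    and "\<not> has_invariant_prob G1" and "\<not> has_invariant_prob G2"
    and "nondegenerate G1 \<mu>1" and "nondegenerate G2 \<mu>2"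
  shows "AE p in path_space \<mu>1 \<Otimes>\<^sub>M path_space \<mu>2.
           (\<lambda>N. real (card {n. n \<le> N \<and> ping_pong_pair (rwalk (fst p) n) (rwalk (snd p) n)})
                 / real N) \<longlonglongrightarrow> 1"
proof -
  let ?\<phi>1 = "lifts \<mu>1" and ?\<phi>2 = "lifts \<mu>2"
  let ?C1 = "PiM UNIV (\<lambda>_. measure_pmf (codes \<mu>1)) :: (nat \<Rightarrow> nat) measure"
  let ?C2 = "PiM UNIV (\<lambda>_. measure_pmf (codes \<mu>2)) :: (nat \<Rightarrow> nat) measure"
  interpret w1: circle_walk "codes \<mu>1" ?\<phi>1 by (rule group_circle_walk[OF assms(1,5,7)])
  interpret w2: circle_walk "codes \<mu>2" ?\<phi>2 by (rule group_circle_walk[OF assms(2,6,8)])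
  interpret two_walks "codes \<mu>1" ?\<phi>1 "codes \<mu>2" ?\<phi>2 ..
  let ?h = "\<lambda>(\<omega>, \<omega>'). (code_path \<mu>1 \<omega>, code_path \<mu>2 \<omega>')"
  have h: "?h \<in> measurable (path_space \<mu>1 \<Otimes>\<^sub>M path_space \<mu>2) (?C1 \<Otimes>\<^sub>M ?C2)"
    unfolding case_prod_beta'
    by (intro measurable_Pair measurable_compose[OF measurable_fst code_path_measurable]
        measurable_compose[OF measurable_snd code_path_measurable])
  have sf: "sigma_finite_measure (distr (path_space \<mu>2) ?C2 (code_path \<mu>2))"
    unfolding distr_code_path by (rule prob_space_imp_sigma_finite) (rule w2.seq.P.prob_space_axioms)
  have dh: "distr (path_space \<mu>1 \<Otimes>\<^sub>M path_space \<mu>2) (?C1 \<Otimes>\<^sub>M ?C2) ?h = ?C1 \<Otimes>\<^sub>M ?C2"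
    using pair_measure_distr[OF code_path_measurable code_path_measurable sf, of \<mu>1] unfolding distr_code_path by simp
  have "AE p in distr (path_space \<mu>1 \<Otimes>\<^sub>M path_space \<mu>2) (?C1 \<Otimes>\<^sub>M ?C2) ?h.
      \<forall>\<delta>>0. rare {n. \<not> lifted_ping_pong (w1.W (fst p) n) (w2.W (snd p) n)} \<delta>"
    unfolding dh by (rule AE_lifted_ping_pong)
  then have "AE p in path_space \<mu>1 \<Otimes>\<^sub>M path_space \<mu>2.
      \<forall>\<delta>>0. rare {n. \<not> lifted_ping_pong (w1.W (fst (?h p)) n) (w2.W (snd (?h p)) n)} \<delta>"
    by (rule AE_distrD[OF h])
  moreover have "AE p in path_space \<mu>1 \<Otimes>\<^sub>M path_space \<mu>2. \<forall>i. fst p i \<in> set_pmf \<mu>1"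
    by (rule AE_pair_fst[OF prob_space_path_space prob_space_path_space AE_path_space_supp])
  moreover have "AE p in path_space \<mu>1 \<Otimes>\<^sub>M path_space \<mu>2. \<forall>i. snd p i \<in> set_pmf \<mu>2"
    by (rule AE_pair_snd[OF prob_space_path_space prob_space_path_space AE_path_space_supp])
  ultimately show ?thesis
  proof eventually_elim
    case (elim p)
    let ?A = "{n. ping_pong_pair (rwalk (fst p) n) (rwalk (snd p) n)}"
    let ?B = "{n. \<not> lifted_ping_pong (w1.W (code_path \<mu>1 (fst p)) n) (w2.W (code_path \<mu>2 (snd p)) n)}"
    \<comment> \<open>\<open>rwalk\<close> at \<open>n\<close> is the coded walk at
      \<open>Suc n\<close>; \<open>rare_Suc\<close> shows that this shift does not affect the
      density.\<close>
    have "n \<in> ?A" if "Suc n \<notin> ?B" for n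
    proof -
      have "ping_pong_pair (rwalk (fst p) n) (rwalk (snd p) n)"
      proof (rule ping_pong_from_lifts)
        show "rwalk (fst p) n (ecirc x) = ecirc (w1.W (code_path \<mu>1 (fst p)) (Suc n) x)" for x
          by (rule rwalk_ecirc[OF assms(1,5,7)]) (use elim(2) in blast)
        show "rwalk (snd p) n (ecirc x) = ecirc (w2.W (code_path \<mu>2 (snd p)) (Suc n) x)" for x
          by (rule rwalk_ecirc[OF assms(2,6,8)]) (use elim(3) in blast)
        show "lifted_ping_pong (w1.W (code_path \<mu>1 (fst p)) (Suc n)) (w2.W (code_path \<mu>2 (snd p)) (Suc n))"
          using that by simp
      qed
      then show ?thesis by simp
    qed
    then have sub: "- ?A \<subseteq> {n. Suc n \<in> ?B}" by blast
    have "rare (- ?A) \<delta>" if "\<delta> > 0" for \<delta>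
    proof (rule rare_mono[OF rare_Suc sub])
      show "rare ?B \<delta>" using elim(1) that by (simp add: case_prod_beta')
    qed (use that in auto)
    from rare_imp_density_one[OF this] show ?case by simp
  qed
qed

end
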